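(* Let $\beta_0=0.50057$ and $c_0=0.997$. Then for all $0\le x\le y\le 1$: \[ G_{\beta_0}[b_{\beta_0}](x,y)\ge 0 \qquad\text{and}\qquad G_{\frac12}[c_0\cdot b_{\frac12}](x,y)\ge 0 . \]
   Context: For $B:[0,1]\to[0,\infty)$, $\beta\ge\frac12$ and $0\le x\le y\le1$ set \[ G^1_\beta[B](x,y)=\big((y-x)^{1/\beta}+B(y)^{1/\beta}\big)^\beta+B(x)-2B(\tfrac{x+y}2), \] \[ G^2_\beta[B](x,y)=y-x+(2^\beta-1)B(y)+B(x)-2B(\tfrac{x+y}2), \] \[ G_\beta[B](x,y)=\max\big(G^1_\beta[B](x,y),\,G^2_\beta[B](x,y)\big). \] Let $L_\beta(x)=x(\log_2(1/x))^\beta$ (with $L_\beta(0)=0$) and \[ Q_\beta(x)=\tfrac23x(1-x)\big(2^{\beta+2}-3+4(3-2^{\beta+1})x\big), \] the cubic polynomial with $Q_\beta(0)=Q_\beta(1)=0$, $Q_\beta(\frac12)=\frac12$, $Q_\beta(\frac14)=2^{\beta-2}$. $J:[\frac12,1]\to[0,\infty)$ is the unique function that is smooth on $(\frac12,1)$, continuous at the endpoints, and satisfies $J''J=-2$ on $(\frac12,1)$, $J(\frac12)=\frac12$, $J(1)=0$. Explicitly, with $\varphi(t)=(2\pi)^{-1/2}e^{-t^2/2}$, $\Phi(t)=\int_{-\infty}^t\varphi$, $I(x)=\varphi(\Phi^{-1}(x))$ for $x\in(0,1)$ and $I(0)=I(1)=0$, one has $J(x)=\sqrt2\,w_0\,I((1-x)/w_0)$,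 where $w_0\in(0,1)$ is the unique value for which $J(\frac12)=\frac12$. Finally, $b_\beta(x)=L_\beta(x)$ for $x\in[0,\frac14]$, $b_\beta(x)=Q_\beta(x)$ for $x\in[\frac14,\frac12]$, $b_\beta(x)=J(x)$ for $x\in[\frac12,1]$. *)

theory Defs
  imports "HOL-Probability.Probability"
begin

text \<open>
  Functions on \<open>[0,1]\<close> or \<open>[1/2,1]\<close> are total functions on the reals; only
  their values on these intervals matter.
\<close>

definition G1_beta :: "real \<Rightarrow> (real \<Rightarrow> real) \<Rightarrow> real \<Rightarrow> real \<Rightarrow> real" where
  "G1_beta \<beta> B x y =
     ((y - x) powr (1 / \<beta>) + B y powr (1 / \<beta>)) powr \<beta> + B x - 2 * B ((x + y) / 2)"

definition G2_beta :: "real \<Rightarrow> (real \<Rightarrow> real) \<Rightarrow> real \<Rightarrow> real \<Rightarrow> real" where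
  "G2_beta \<beta> B x y = y - x + (2 powr \<beta> - 1) * B y + B x - 2 * B ((x + y) / 2)"

definition G_beta :: "real \<Rightarrow> (real \<Rightarrow> real) \<Rightarrow> real \<Rightarrow> real \<Rightarrow> real" where
  "G_beta \<beta> B x y = max (G1_beta \<beta> B x y) (G2_beta \<beta> B x y)"

definition L_beta :: "real \<Rightarrow> real \<Rightarrow> real" where
  "L_beta \<beta> x = (if x = 0 then 0 else x * (log 2 (1 / x)) powr \<beta>)"

definition Q_beta :: "real \<Rightarrow> real \<Rightarrow> real" where
  "Q_beta \<beta> x = 2 / 3 * x * (1 - x) * (2 powr (\<beta> + 2) - 3 + 4 * (3 - 2 powr (\<beta> + 1)) * x)"

definition solves_J :: "(real \<Rightarrow> real) \<Rightarrow> bool" where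
  "solves_J f \<longleftrightarrow>
     (\<forall>n. \<forall>x\<in>{1/2<..<1}. (deriv ^^ n) f differentiable (at x)) \<and>
     continuous_on {1/2..1} f \<and>
     (\<forall>x\<in>{1/2..1}. 0 \<le> f x) \<and>
     (\<forall>x\<in>{1/2<..<1}. deriv (deriv f) x * f x = - 2) \<and>
     f (1/2) = 1/2 \<and> f 1 = 0"

text \<open>
  The value \<open>0\<close> outside \<open>[1/2,1]\<close> is only a normalisation that makes the
  description unique among total functions. Existence and uniqueness are lemma
  \<open>solves_J_ex1\<close>; lemma \<open>J_explicit\<close> is the closed form.
\<close>

definition J :: "real \<Rightarrow> real" where
  "J = (THE f. solves_J f \<and> (\<forall>x. x \<notin> {1/2..1} \<longrightarrow> f x = 0))"

text \<open>
  The three pieces agree at the common endpoints \<open>1/4\<close> and \<open>1/2\<close>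
  (lemma \<open>b_pieces\<close>).
\<close>

definition b_beta :: "real \<Rightarrow> real \<Rightarrow> real" where
  "b_beta \<beta> x = (if x \<le> 1/4 then L_beta \<beta> x else if x \<le> 1/2 then Q_beta \<beta> x else J x)"

abbreviation Phi :: "real \<Rightarrow> real" where
  "Phi \<equiv> cdf std_normal_distribution"

definition gauss_I :: "real \<Rightarrow> real" where
  "gauss_I x = (if 0 < x \<and> x < 1 then std_normal_density (inv Phi x) else 0)"

lemma std_normal_density_pos: "std_normal_density t > 0"
  by (simp add: normal_density_pos)

lemma std_normal_density_deriv:
  "(std_normal_density has_real_derivative - t * std_normal_density t) (at t)"
proof -
  have "((\<lambda>x. 1 / sqrt (2 * pi) * exp (- x\<^sup>2 / 2)) has_real_derivative
      - t * (1 / sqrt (2 * pi) * exp (- t\<^sup>2 / 2))) (at t)"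
    by (auto intro!: derivative_eq_intros simp: field_simps)
  then show ?thesis
    unfolding std_normal_density_def[abs_def] .
qed

lemma continuous_std_normal_density: "continuous_on A std_normal_density"
  by (rule DERIV_continuous_on[where D="\<lambda>t. - t * std_normal_density t"])
     (rule has_field_derivative_at_within[OF std_normal_density_deriv])

lemma std_normal_measure:
  assumes "A \<in> sets borel"
  shows "measure std_normal_distribution A = (LBINT t:A. std_normal_density t)"
proof -
  have "emeasure std_normal_distribution A
      = (\<integral>\<^sup>+t. ennreal (indicator A t * std_normal_density t) \<partial>lborel)"
    using assms
    by (subst emeasure_density) (auto intro!: nn_integral_cong simp: indicator_def)
  then show ?thesis
    unfolding measure_def set_lebesgue_integral_def using assms
    by (subst integral_eq_nn_integral) (auto simp: normal_density_nonneg)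
qed

lemma Phi_diff:
  assumes "a \<le> b"
  shows "Phi b - Phi a = integral {a..b} std_normal_density"
proof -
  interpret real_distribution std_normal_distribution by (rule real_dist_normal_dist)
  have int: "set_integrable lborel {a..b} std_normal_density"
    by (intro borel_integrable_atLeastAtMost' continuous_std_normal_density)
  show ?thesis
  proof (cases "a < b")
    case True
    have "Phi b - Phi a = (LBINT t:{a<..b}. std_normal_density t)"
      using True by (simp add: cdf_diff_eq std_normal_measure)
    also have "\<dots> = (LBINT t:{a..b}. std_normal_density t)"
      unfolding set_lebesgue_integral_def
    proof (rule integral_cong_AE)
      show "AE t in lborel. indicat_real {a<..b} t *\<^sub>R std_normal_density t
          = indicat_real {a..b} t *\<^sub>R std_normal_density t"
        using AE_lborel_singleton[of a] by eventually_elim (auto simp: indicator_def)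
    qed measurable
    also have "\<dots> = integral {a..b} std_normal_density"
      by (rule set_borel_integral_eq_integral(2)[OF int])
    finally show ?thesis .
  qed (use assms in auto)
qed

lemma Phi_deriv: "(Phi has_real_derivative std_normal_density t) (at t)"
proof -
  have "((\<lambda>x. integral {t-1..x} std_normal_density) has_real_derivative std_normal_density t)
      (at t within {t-1..t+1})"
    by (rule integral_has_real_derivative[OF continuous_std_normal_density]) simp
  then have "((\<lambda>x. integral {t-1..x} std_normal_density) has_real_derivative std_normal_density t)
      (at t)"
    using at_within_Icc_at[of "t-1" t "t+1"] by simp
  from DERIV_add[OF DERIV_const[of "Phi (t-1)"] this]
  have "((\<lambda>x. Phi (t-1) + integral {t-1..x} std_normal_density)
      has_real_derivative std_normal_density t) (at t)"
    by simp
  then show ?thesis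
  proof (rule has_field_derivative_transform_within_open[where S="{t-1<..<t+1}"])
    fix x assume "x \<in> {t-1<..<t+1}"
    then show "Phi (t-1) + integral {t-1..x} std_normal_density = Phi x"
      using Phi_diff[of "t-1" x] by auto
  qed auto
qed

lemma Phi_isCont: "isCont Phi t"
  by (rule DERIV_isCont[OF Phi_deriv])

lemma Phi_less: "s < t \<Longrightarrow> Phi s < Phi t"
  by (erule DERIV_pos_imp_increasing, rule exI, rule conjI[OF Phi_deriv std_normal_density_pos])

lemma Phi_less_iff: "Phi s < Phi t \<longleftrightarrow> s < t"
  using Phi_less[of s t] Phi_less[of t s] by (cases s t rule: linorder_cases) auto

lemma Phi_inj: "inj Phi"
proof (rule injI)
  fix s t assume "Phi s = Phi t"
  then show "s = t"
    using Phi_less[of s t] Phi_less[of t s] by (cases s t rule: linorder_cases) auto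
qed

lemma inv_Phi_Phi [simp]: "inv Phi (Phi t) = t"
  by (rule inv_f_f[OF Phi_inj])

lemma Phi_at_top: "(Phi \<longlongrightarrow> 1) at_top"
  by (rule real_distribution.cdf_lim_at_top_prob[OF real_dist_normal_dist])

lemma Phi_at_bot: "(Phi \<longlongrightarrow> 0) at_bot"
  by (rule finite_borel_measure.cdf_lim_at_bot
        [OF real_distribution.finite_borel_measure_M[OF real_dist_normal_dist]])

lemma Phi_gt_0: "0 < Phi t"
  using finite_borel_measure.cdf_nonneg
      [OF real_distribution.finite_borel_measure_M[OF real_dist_normal_dist], of "t - 1"]
    Phi_less[of "t-1" t] by simp

lemma Phi_lt_1: "Phi t < 1"
  using real_distribution.cdf_bounded_prob[OF real_dist_normal_dist, of "t + 1"]
    Phi_less[of t "t+1"] by simp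

lemma Phi_surj:
  assumes "0 < u" "u < 1"
  shows "\<exists>t. Phi t = u"
proof -
  obtain lo where lo: "Phi lo < u"
    using order_tendstoD(2)[OF Phi_at_bot assms(1)]
    by (auto simp: eventually_at_bot_linorder)
  obtain hi where hi: "Phi hi > u"
    using order_tendstoD(1)[OF Phi_at_top assms(2)]
    by (auto simp: eventually_at_top_linorder)
  have "lo < hi" using lo hi Phi_less_iff[of lo hi] by linarith
  then show ?thesis
    using IVT[of Phi lo u hi] lo hi Phi_isCont by auto
qed

lemma Phi_inv_Phi: "0 < u \<Longrightarrow> u < 1 \<Longrightarrow> Phi (inv Phi u) = u"
  using Phi_surj[of u] by auto

lemma inv_Phi_deriv:
  assumes "0 < u" "u < 1"
  shows "(inv Phi has_real_derivative 1 / std_normal_density (inv Phi u)) (at u)"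
proof -
  have "isCont (inv Phi) (Phi (inv Phi u))"
    by (rule isCont_inverse_function[where d=1]) (auto simp: Phi_isCont)
  then have c: "isCont (inv Phi) u" using assms by (simp add: Phi_inv_Phi)
  have "(inv Phi has_real_derivative inverse (std_normal_density (inv Phi u))) (at u)"
    using std_normal_density_pos[of "inv Phi u"] assms
    by (intro DERIV_inverse_function[OF Phi_deriv _ assms _ c]) (auto simp: Phi_inv_Phi)
  then show ?thesis by (simp add: inverse_eq_divide)
qed

lemma Phi_0: "Phi 0 = 1/2"
proof -
  interpret real_distribution std_normal_distribution by (rule real_dist_normal_dist)
  have "emeasure std_normal_distribution {..0} = 
      (\<integral>\<^sup>+t. ennreal (std_normal_density t) * indicator {..0} t \<partial>lborel)"
    by (subst emeasure_density) auto
  also have "\<dots> = (\<integral>\<^sup>+t. ennreal (std_normal_density (- t)) * indicator {..0} (- t) \<partial>lborel)"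
    by (subst nn_integral_real_affine[where c="-1" and t=0]) auto
  also have "\<dots> = (\<integral>\<^sup>+t. ennreal (std_normal_density t) * indicator {0..} t \<partial>lborel)"
    by (intro nn_integral_cong) (auto simp: std_normal_density_def indicator_def)
  also have "\<dots> = emeasure std_normal_distribution {0..}"
    by (subst emeasure_density) auto
  finally have "prob {..0} = prob {0..}" by (simp add: measure_def)
  moreover have "prob {0..} = prob {0<..}"
  proof -
    have "prob {0} = 0"
      using isCont_cdf Phi_isCont by blast
    moreover have "prob ({0} \<union> {0<..}) = prob {0} + prob {0<..}"
      by (rule finite_measure_Union) auto
    moreover have "{0} \<union> {0<..} = {0::real..}" by auto
    ultimately show ?thesis by simp
  qed
  moreover have "prob {..0} + prob {0<..} = 1"
  proof -
    have "prob ({..0} \<union> {0<..}) = prob {..0} + prob {0<..}"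
      by (rule finite_measure_Union) auto
    moreover have "{..0} \<union> {0::real<..} = UNIV" by auto
    ultimately show ?thesis using prob_space by simp
  qed
  ultimately show ?thesis by (simp add: cdf_def)
qed

lemma std_normal_density_at_bot: "(std_normal_density \<longlongrightarrow> 0) at_bot"
proof -
  have "filterlim (\<lambda>t. t * t :: real) at_top at_bot"
    using filterlim_at_top_mult_at_top[OF filterlim_uminus_at_top_at_bot
        filterlim_uminus_at_top_at_bot] by simp
  then have "filterlim (\<lambda>t. (1/2) * (t * t) :: real) at_top at_bot"
    by (intro filterlim_tendsto_pos_mult_at_top[OF tendsto_const]) auto
  then have "filterlim (\<lambda>t. - ((1/2) * (t * t)) :: real) at_bot at_bot"
    by (simp only: filterlim_uminus_at_top)
  then have "((\<lambda>t. exp (- ((1/2) * (t * t)) :: real)) \<longlongrightarrow> 0) at_bot"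
    by (rule filterlim_compose[OF exp_at_bot])
  then have "((\<lambda>t. 1 / sqrt (2 * pi) * exp (- ((1/2) * (t * t)))) \<longlongrightarrow> 1 / sqrt (2 * pi) * 0) at_bot"
    by (intro tendsto_mult tendsto_const)
  then show ?thesis
    unfolding std_normal_density_def[abs_def] by (simp add: power2_eq_square)
qed

lemma gauss_I_at_0: "(gauss_I \<longlongrightarrow> 0) (at_right 0)"
proof -
  have "filterlim (inv Phi) at_bot (at_right 0)"
    unfolding filterlim_at_bot
  proof
    fix Z
    have "eventually (\<lambda>u. u \<in> {0<..<Phi Z}) (at_right 0)"
      by (rule eventually_at_right_real[OF Phi_gt_0])
    then show "eventually (\<lambda>u. inv Phi u \<le> Z) (at_right 0)"
    proof eventually_elim
      case (elim u)
      then have "Phi (inv Phi u) < Phi Z"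
        using Phi_inv_Phi[of u] Phi_lt_1[of Z] by simp
      then show ?case by (simp add: Phi_less_iff)
    qed
  qed
  then have "((\<lambda>u. std_normal_density (inv Phi u)) \<longlongrightarrow> 0) (at_right 0)"
    by (rule filterlim_compose[OF std_normal_density_at_bot])
  moreover have "eventually (\<lambda>u. u \<in> {0<..<1::real}) (at_right 0)"
    by (rule eventually_at_right_real) auto
  then have "eventually (\<lambda>u. std_normal_density (inv Phi u) = gauss_I u) (at_right 0)"
    by eventually_elim (simp add: gauss_I_def)
  ultimately show ?thesis by (rule Lim_transform_eventually)
qed

lemma exp_bound_half: "exp (- 1 / 2 :: real) < 5/8"
proof -
  have "(8/5::real) < 1 + 1/2 + (1/2)\<^sup>2/2" by (simp add: power2_eq_square)
  also have "\<dots> \<le> exp (1/2)" by (rule exp_lower_Taylor_quadratic) simp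
  finally have "8/5 < exp (1/2::real)" .
  then show ?thesis by (simp add: exp_minus field_simps)
qed

lemma ex_w0:
  obtains w :: real where "1/2 < w" "w < 1" "sqrt 2 * w * gauss_I (1 / (2 * w)) = 1/2"
proof -
  let ?f = "\<lambda>t. sqrt 2 * std_normal_density t - Phi t"
  have "?f 0 > 0"
  proof -
    have "?f 0 = 1 / sqrt pi - 1/2"
      unfolding Phi_0 by (simp add: std_normal_density_def real_sqrt_mult)
    moreover have "sqrt pi < 2"
      using pi_less_4 real_sqrt_less_mono[of pi 4] by simp
    moreover have "1 / 2 < 1 / sqrt pi"
      using \<open>sqrt pi < 2\<close> by (intro divide_strict_left_mono) auto
    ultimately show ?thesis by simp
  qed
  moreover have "?f 1 < 0"
  proof -
    have "sqrt 2 * std_normal_density 1 = exp (-1/2) / sqrt pi"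
      by (simp add: std_normal_density_def real_sqrt_mult)
    also have "\<dots> \<le> (5/8) / sqrt pi"
      using exp_bound_half by (intro divide_right_mono) auto
    also have "\<dots> < 1/2"
    proof -
      have "(5/4::real) < sqrt pi"
        by (rule real_less_rsqrt) (use pi_gt3 in \<open>simp add: power2_eq_square\<close>)
      then show ?thesis by (simp add: field_simps)
    qed
    also have "1/2 < Phi 1" using Phi_less[of 0 1] Phi_0 by simp
    finally show ?thesis by simp
  qed
  ultimately obtain t where t: "0 \<le> t" "?f t = 0"
    using IVT2[of ?f 1 0 0] DERIV_isCont[OF std_normal_density_deriv] Phi_isCont
    by (auto intro!: continuous_intros)
  with \<open>?f 0 > 0\<close> have "t > 0" by (cases "t = 0") auto
  then have "Phi t > 1/2" using Phi_less[of 0 t] Phi_0 by simp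
  show thesis
  proof
    show "1/2 < 1 / (2 * Phi t)" "1 / (2 * Phi t) < 1"
      using Phi_lt_1[of t] \<open>Phi t > 1/2\<close> by (auto simp: field_simps)
    show "sqrt 2 * (1 / (2 * Phi t)) * gauss_I (1 / (2 * (1 / (2 * Phi t)))) = 1/2"
      using Phi_lt_1[of t] \<open>Phi t > 1/2\<close> t(2) by (simp add: gauss_I_def field_simps)
  qed
qed

lemma solves_J_gauss:
  assumes w: "1/2 < w" "w < 1" and half: "sqrt 2 * w * gauss_I (1 / (2 * w)) = 1/2"
  defines "K \<equiv> \<lambda>x. if x \<in> {1/2..1} then sqrt 2 * w * gauss_I ((1 - x) / w) else 0"
  shows "solves_J K"
proof -
  define Z where "Z = (\<lambda>x. inv Phi ((1 - x) / w))"
  let ?\<phi> = "\<lambda>x. std_normal_density (Z x)"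
  have pos: "?\<phi> x > 0" for x by (rule std_normal_density_pos)
  have DZ: "(Z has_real_derivative - 1 / (w * ?\<phi> x)) (at x)" if "x \<in> {1-w<..<1}" for x
  proof -
    have "(inv Phi has_real_derivative 1 / ?\<phi> x) (at ((1 - x) / w))"
      unfolding Z_def using that w by (intro inv_Phi_deriv) (auto simp: field_simps)
    moreover have "((\<lambda>x. (1 - x) / w) has_real_derivative - 1 / w) (at x)"
      using w by (auto intro!: derivative_eq_intros)
    ultimately have "((inv Phi \<circ> (\<lambda>x. (1 - x) / w)) has_real_derivative 1 / ?\<phi> x * (- 1 / w)) (at x)"
      by (rule DERIV_chain)
    then show ?thesis by (simp add: Z_def o_def mult.commute)
  qed
  have Dphi: "(?\<phi> has_real_derivative Z x / w) (at x)" if "x \<in> {1-w<..<1}" for x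
    using DERIV_chain2[OF std_normal_density_deriv DZ[OF that]] pos[of x] w
    by (simp add: field_simps)
  define E where "E = (\<lambda>x. sqrt 2 * w * ?\<phi> x)"
  have KE: "K x = E x" if "x \<in> {1/2..<1}" for x
    using that w by (auto simp: K_def E_def gauss_I_def Z_def field_simps)
  have DE: "(E has_real_derivative sqrt 2 * Z x) (at x)" if "x \<in> {1-w<..<1}" for x
    unfolding E_def using DERIV_cmult[OF Dphi[OF that], of "sqrt 2 * w"] w by simp
  have DK: "(K has_real_derivative sqrt 2 * Z x) (at x)" if "x \<in> {1/2<..<1}" for x
    by (rule has_field_derivative_transform_within_open[OF DE, where S="{1/2<..<1}"])
       (use that w KE in auto)
  have Dn: "\<exists>p. \<forall>x\<in>{1/2<..<1}. (deriv ^^ Suc n) K x = poly p (Z x) / ?\<phi> x ^ n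
      \<and> ((deriv ^^ Suc n) K has_real_derivative
            - (1 / w) * poly (pderiv p + smult (of_nat n) ([:0, 1:] * p)) (Z x) / ?\<phi> x ^ Suc n) (at x)"
    for n
  proof -
    have D: "((\<lambda>x. poly p (Z x) / ?\<phi> x ^ n) has_real_derivative
            - (1 / w) * poly (pderiv p + smult (of_nat n) ([:0, 1:] * p)) (Z x) / ?\<phi> x ^ Suc n) (at x)"
      if "x \<in> {1/2<..<1}" for x p n
    proof -
      have x: "x \<in> {1-w<..<1}" using that w by auto
      have 1: "((\<lambda>x. poly p (Z x)) has_real_derivative poly (pderiv p) (Z x) * (- 1 / (w * ?\<phi> x))) (at x)"
        by (rule DERIV_chain2[OF poly_DERIV DZ[OF x]])
      have 2: "((\<lambda>x. ?\<phi> x ^ n) has_real_derivative of_nat n * (Z x / w * ?\<phi> x ^ (n - 1))) (at x)"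
        using DERIV_power[OF Dphi[OF x], of n] by simp
      have 3: "?\<phi> x ^ n \<noteq> 0" using pos[of x] by simp
      have *: "(poly (pderiv p) (Z x) * (- 1 / (w * ?\<phi> x)) * ?\<phi> x ^ n
             - poly p (Z x) * (of_nat n * (Z x / w * ?\<phi> x ^ (n - 1)))) / (?\<phi> x ^ n * ?\<phi> x ^ n)
          = - (1 / w) * poly (pderiv p + smult (of_nat n) ([:0, 1:] * p)) (Z x) / ?\<phi> x ^ Suc n"
        using pos[of x] w by (cases n) (simp_all add: field_simps)
      show ?thesis
        using DERIV_divide[OF 1 2 3] unfolding * .
    qed
    have tr: "((deriv ^^ Suc n) K has_real_derivative d) (at x)"
      if "\<forall>x\<in>{1/2<..<1}. (deriv ^^ Suc n) K x = poly p (Z x) / ?\<phi> x ^ n"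
        "((\<lambda>x. poly p (Z x) / ?\<phi> x ^ n) has_real_derivative d) (at x)" "x \<in> {1/2<..<1}" for p d x n
      by (rule has_field_derivative_transform_within_open[OF that(2), where S="{1/2<..<1}"])
         (use that in auto)
    have "\<exists>p. \<forall>x\<in>{1/2<..<1}. (deriv ^^ Suc n) K x = poly p (Z x) / ?\<phi> x ^ n"
    proof (induction n)
      case 0
      have "deriv K x = poly [:0, sqrt 2:] (Z x)" if "x \<in> {1/2<..<1}" for x
        using DERIV_imp_deriv[OF DK[OF that]] by (simp add: mult.commute)
      then show ?case by (intro exI[of _ "[:0, sqrt 2:]"]) simp
    next
      case (Suc n)
      then obtain p where p: "\<forall>x\<in>{1/2<..<1}. (deriv ^^ Suc n) K x = poly p (Z x) / ?\<phi> x ^ n"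
        by blast
      let ?q = "smult (- (1 / w)) (pderiv p + smult (of_nat n) ([:0, 1:] * p))"
      have "(deriv ^^ Suc (Suc n)) K x = poly ?q (Z x) / ?\<phi> x ^ Suc n" if "x \<in> {1/2<..<1}" for x
        using DERIV_imp_deriv[OF tr[OF p D[OF that] that]] by simp
      then show ?case by blast
    qed
    then show ?thesis using tr D by meson
  qed
  show ?thesis
    unfolding solves_J_def
  proof (intro conjI ballI allI)
    fix n x assume x: "x \<in> {1/2<..<1::real}"
    show "(deriv ^^ n) K differentiable (at x)"
    proof (cases n)
      case 0
      then show ?thesis using DK[OF x] real_differentiable_def by auto
    next
      case (Suc m)
      then show ?thesis using Dn[of m] x real_differentiable_def by blast
    qed
  next
    fix x assume x: "x \<in> {1/2<..<1::real}"
    have "(deriv K has_real_derivative sqrt 2 * (- 1 / (w * ?\<phi> x))) (at x)"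
    proof (rule has_field_derivative_transform_within_open[where S="{1/2<..<1}"])
      show "((\<lambda>x. sqrt 2 * Z x) has_real_derivative sqrt 2 * (- 1 / (w * ?\<phi> x))) (at x)"
        using x w by (intro DERIV_cmult DZ) auto
      show "sqrt 2 * Z y = deriv K y" if "y \<in> {1/2<..<1}" for y
        using DERIV_imp_deriv[OF DK[OF that]] by simp
    qed (use x in auto)
    then have "deriv (deriv K) x = sqrt 2 * (- 1 / (w * ?\<phi> x))" by (rule DERIV_imp_deriv)
    then show "deriv (deriv K) x * K x = - 2"
      using KE[of x] x pos[of x] w by (simp add: E_def)
  next
    show "continuous_on {1/2..1} K"
      unfolding continuous_on_def
    proof
      fix x :: real assume x: "x \<in> {1/2..1}"
      show "(K \<longlongrightarrow> K x) (at x within {1/2..1})"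
      proof (cases "x = 1")
        case False
        with x w have "(E \<longlongrightarrow> E x) (at x)"
          using DERIV_isCont[OF DE[of x]] by (auto simp: isCont_def)
        then have "(E \<longlongrightarrow> E x) (at x within {1/2..1})" by (rule tendsto_within_subset) simp
        moreover have "eventually (\<lambda>y. E y = K y) (at x within {1/2..1})"
          unfolding eventually_at_topological
          by (rule exI[of _ "{..<1}"]) (use x False KE in auto)
        ultimately have "(K \<longlongrightarrow> E x) (at x within {1/2..1})"
          by (rule Lim_transform_eventually)
        then show ?thesis using KE[of x] x False by simp
      next
        case True
        have "filterlim (\<lambda>y. (1 - y) / w) (at_right 0) (at_left 1)"
          unfolding filterlim_at
        proof
          show "((\<lambda>y. (1 - y) / w) \<longlongrightarrow> 0) (at_left 1)"
            using w by (auto intro!: tendsto_eq_intros)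
          show "\<forall>\<^sub>F y in at_left 1. (1 - y) / w \<in> {0<..} \<and> (1 - y) / w \<noteq> 0"
            using w unfolding eventually_at_topological
            by (intro exI[of _ UNIV]) auto
        qed
        then have "((\<lambda>y. sqrt 2 * w * gauss_I ((1 - y) / w)) \<longlongrightarrow> sqrt 2 * w * 0) (at_left 1)"
          by (intro tendsto_mult tendsto_const filterlim_compose[OF gauss_I_at_0])
        moreover have "eventually (\<lambda>y. sqrt 2 * w * gauss_I ((1 - y) / w) = K y) (at_left 1)"
          unfolding eventually_at_topological
          by (rule exI[of _ "{1/2<..}"]) (auto simp: K_def)
        ultimately have "(K \<longlongrightarrow> sqrt 2 * w * 0) (at_left 1)"
          by (rule Lim_transform_eventually)
        moreover have "K 1 = 0" by (simp add: K_def gauss_I_def)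
        ultimately show ?thesis
          using True by (simp add: at_within_Icc_at_left)
      qed
    qed
  next
    fix x :: real
    show "0 \<le> K x" using w by (simp add: K_def gauss_I_def normal_density_nonneg)
  next
    show "K (1/2) = 1/2" using half by (simp add: K_def field_simps)
  next
    show "K 1 = 0" by (simp add: K_def gauss_I_def)
  qed
qed

lemma solves_J_le:
  assumes f: "solves_J f" and g: "solves_J g" and x: "x \<in> {1/2..1}"
  shows "f x \<le> g x"
proof (rule ccontr)
  assume "\<not> f x \<le> g x"
  define d where "d = (\<lambda>t. f t - g t)"
  have "continuous_on {1/2..1} d"
    unfolding d_def using f g by (auto simp: solves_J_def intro!: continuous_intros)
  then obtain m where m: "m \<in> {1/2..1}" "\<And>t. t \<in> {1/2..1} \<Longrightarrow> d t \<le> d m"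
    using continuous_attains_sup[of "{1/2..1::real}" d] by auto
  have "d m > 0" using m(2)[OF x] \<open>\<not> f x \<le> g x\<close> by (simp add: d_def)
  moreover have "d (1/2) = 0" "d 1 = 0" using f g by (auto simp: d_def solves_J_def)
  ultimately have "m \<noteq> 1/2" "m \<noteq> 1" by (metis less_irrefl)+
  then have m': "m \<in> {1/2<..<1}" using m(1) by auto
  have D1: "(h has_real_derivative deriv h t) (at t)"
      and D2: "(deriv h has_real_derivative deriv (deriv h) t) (at t)"
    if "solves_J h" "t \<in> {1/2<..<1}" for h t
  proof -
    have "(deriv ^^ n) h differentiable (at t)" for n
      using that unfolding solves_J_def by blast
    from this[of 0] this[of 1] have "h differentiable (at t)" "deriv h differentiable (at t)" by auto
    then show "(h has_real_derivative deriv h t) (at t)"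
      "(deriv h has_real_derivative deriv (deriv h) t) (at t)"
      by (simp_all add: DERIV_deriv_iff_real_differentiable)
  qed
  have Dd: "(d has_real_derivative deriv f t - deriv g t) (at t)" if "t \<in> {1/2<..<1}" for t
    unfolding d_def using D1[OF f that] D1[OF g that] by (rule DERIV_diff)
  have "deriv f m - deriv g m = 0"
  proof (rule DERIV_local_max[OF Dd[OF m']])
    show "0 < min (m - 1/2) (1 - m)" using m' by auto
    show "\<forall>y. \<bar>m - y\<bar> < min (m - 1/2) (1 - m) \<longrightarrow> d y \<le> d m"
      using m(2) by (auto simp: abs_if split: if_splits)
  qed
  moreover have "deriv (deriv f) m - deriv (deriv g) m > 0"
  proof -
    have "deriv (deriv f) m * f m = - 2" "deriv (deriv g) m * g m = - 2" "0 \<le> f m" "0 \<le> g m"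
      using f g m' unfolding solves_J_def by auto
    moreover from this have "f m \<noteq> 0" "g m \<noteq> 0" by auto
    ultimately have "f m > 0" "g m > 0" "deriv (deriv f) m = - 2 / f m"
      "deriv (deriv g) m = - 2 / g m"
      by (auto simp: field_simps)
    moreover from this have "2 / f m < 2 / g m"
      using \<open>d m > 0\<close> by (intro divide_strict_left_mono) (auto simp: d_def)
    ultimately show ?thesis by simp
  qed
  then obtain e where e: "e > 0"
      "\<And>h. 0 < h \<Longrightarrow> h < e \<Longrightarrow> deriv f m - deriv g m < deriv f (m + h) - deriv g (m + h)"
    using DERIV_pos_inc_right[OF DERIV_diff[OF D2[OF f m'] D2[OF g m']]] by blast
  define r where "r = min e (1 - m) / 2"
  have r: "0 < r" "r < e" "m + r < 1" using e(1) m' by (auto simp: r_def min_def field_simps)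
  have "d m < d (m + r)"
  proof (rule DERIV_pos_imp_increasing_open[where f = d])
    show "m < m + r" using r by simp
    fix t assume t: "m < t" "t < m + r"
    then show "\<exists>y. (d has_real_derivative y) (at t) \<and> 0 < y"
      using Dd[of t] e(2)[of "t - m"] \<open>deriv f m - deriv g m = 0\<close> r m' by auto
  next
    show "continuous_on {m..m+r} d"
      by (rule continuous_on_subset[OF \<open>continuous_on {1/2..1} d\<close>]) (use r m' in auto)
  qed
  then show False using m(2)[of "m + r"] r m' by auto
qed

lemma solves_J_ex1: "\<exists>!f. solves_J f \<and> (\<forall>x. x \<notin> {1/2..1} \<longrightarrow> f x = 0)"
proof -
  obtain w where w: "1/2 < w" "w < 1" "sqrt 2 * w * gauss_I (1 / (2 * w)) = 1/2"
    by (rule ex_w0)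
  show ?thesis
  proof (rule ex_ex1I)
    show "\<exists>f. solves_J f \<and> (\<forall>x. x \<notin> {1/2..1} \<longrightarrow> f x = 0)"
      using solves_J_gauss[OF w]
      by (intro exI[of _ "\<lambda>x. if x \<in> {1/2..1} then sqrt 2 * w * gauss_I ((1 - x) / w) else 0"]) auto
  next
    fix f g
    assume f: "solves_J f \<and> (\<forall>x. x \<notin> {1/2..1} \<longrightarrow> f x = 0)"
      and g: "solves_J g \<and> (\<forall>x. x \<notin> {1/2..1} \<longrightarrow> g x = 0)"
    show "f = g"
    proof
      fix x show "f x = g x"
        using f g solves_J_le[of f g x] solves_J_le[of g f x] by (cases "x \<in> {1/2..1}") auto
    qed
  qed
qed

lemma solves_J_J: "solves_J J"
  unfolding J_def using theI'[OF solves_J_ex1] by blast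

lemma J_unique: "solves_J f \<Longrightarrow> x \<in> {1/2..1} \<Longrightarrow> f x = J x"
  using solves_J_le[of f J x] solves_J_le[of J f x] solves_J_J by simp

lemma J_explicit_if:
  assumes w: "0 < w" "w < 1" "sqrt 2 * w * gauss_I (1 / (2 * w)) = 1/2" and x: "x \<in> {1/2..1}"
  shows "J x = sqrt 2 * w * gauss_I ((1 - x) / w)"
proof -
  have "1/2 < w"
  proof (rule ccontr)
    assume "\<not> 1/2 < w"
    then have "gauss_I (1 / (2 * w)) = 0" using w(1) by (simp add: gauss_I_def field_simps)
    then show False using w(3) by simp
  qed
  from J_unique[OF solves_J_gauss[OF this w(2,3)] x] show ?thesis using x by simp
qed

lemma J_explicit:
  "\<exists>w. 0 < w \<and> w < 1 \<and> (\<forall>x\<in>{1/2..1}. J x = sqrt 2 * w * gauss_I ((1 - x) / w))"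
proof -
  obtain w where w: "1/2 < w" "w < 1" "sqrt 2 * w * gauss_I (1 / (2 * w)) = 1/2"
    by (rule ex_w0)
  then show ?thesis using J_explicit_if[of w] by (intro exI[of _ w]) auto
qed

lemma b_pieces: "L_beta \<beta> (1/4) = Q_beta \<beta> (1/4)" "Q_beta \<beta> (1/2) = J (1/2)"
proof -
  have "log 2 (4::real) = 2" using log_pow_cancel[of 2 2] by simp
  then show "L_beta \<beta> (1/4) = Q_beta \<beta> (1/4)"
    by (simp add: L_beta_def Q_beta_def powr_add field_simps)
  show "Q_beta \<beta> (1/2) = J (1/2)"
  proof -
    have "J (1/2) = 1/2" using solves_J_J unfolding solves_J_def by blast
    then show ?thesis by (simp only:) (simp add: Q_beta_def powr_add field_simps)
  qed
qed

end

theory Submission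
  imports Defs
begin

text \<open>
  Write h = y - x, m = (x + y) / 2 and b for the glued function. Both halves of the claim ask that
  one of
     2 b(m) \<le> N(h, b y) + b x      and      2 b(m) \<le> h + (2^\<beta> - 1) b y + b x
  holds, where N is a norm of the plane: the p-norm with p = 1 / \<beta> in the first half. In the second
  half division by the factor c = 0.997 turns the first alternative into the one with the Euclidean
  norm of (h / c, b y), while the second alternative only gains from c < 1. The properties of N
  that the two cases share form the locale \<open>hamming_norm\<close>, and theorem \<open>good_everywhere\<close> is the
  claim in that generality.

  The equation J'' J = -2 is the infinitesimal form of the first alternative for the Euclidean norm,
  so for x, y \<ge> 1/2 there is nothing to spare near the diagonal. For fixed y the difference of the
  squared sides, as a function of x, first increases and then decreases, and it vanishes at x = y;
  hence everything is decided on the line x = 1/2 (lemma \<open>J_two_point_from_half\<close>). On that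
  line, with t = y - 1/2, the squared sides for the Euclidean norm differ by about J'(1/2) t^3 in
  the wrong direction. Here, and for x slightly to the left of 1/2, the strictly larger norm is
  needed: h^2 has to be multiplied by a factor \<open>lam\<close> slightly above 1
  (lemma \<open>J_two_point_at_half\<close>). This factor is 1 / c^2 in one case. In the other it comes from
  the excess of the p-norm over the Euclidean norm, which contains (2 - p) h^2 ln(b y / h)
  (lemma \<open>lp_norm_gain\<close>).

  Elsewhere cruder lower bounds of N or the second alternative suffice. If y \<le> 1/2 and
  x + y \<le> 1/2, only L matters (b \<ge> L at y), and scaling reduces the claim to an inequality in
  x / y and log(1 / y) (lemma \<open>L_two_point\<close>). If only Q matters, the second difference of the
  cubic is explicit and the claim factors (lemma \<open>Q_difference\<close>). For the p-norm both
  alternatives are equalities at (0, 1/2), and the second one is an equality at (0, 1); the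
  estimates near these points are arranged so that the equalities split off.

  Numbers enter in two ways. J is enclosed between polynomials by comparing
  solutions of f'' f \<le> -2 and f'' f \<ge> -2 that start with the same data (lemma \<open>J_comparison\<close>); only
  the slope of J at 1/2 has to be estimated from its definition (lemma \<open>s0_bounds\<close>). The
  remaining inequalities say that a polynomial in at most two variables is positive on a box, and are
  decided by exact integer arithmetic (lemma \<open>positive_on\<close>).
\<close>


section \<open>Certified positivity of polynomials on a box\<close>

text \<open>
  Reified polynomials with rational coefficients: their positivity on a box becomes a computation
  with integers.
\<close>

datatype pexp =
    PC int int
  | PX
  | PY
  | PNeg pexp
  | PAdd pexp pexp (infixl "\<oplus>" 65)
  | PMul pexp pexp (infixl "\<otimes>" 70)
  | PPow pexp nat (infixr "\<up>" 80)

abbreviation PSub :: "pexp \<Rightarrow> pexp \<Rightarrow> pexp" (infixl "\<ominus>" 65) where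
  "a \<ominus> b \<equiv> a \<oplus> PNeg b"

fun peval :: "pexp \<Rightarrow> real \<Rightarrow> real \<Rightarrow> real" where
  "peval (PC n d) x y = of_int n / of_int d"
| "peval PX x y = x"
| "peval PY x y = y"
| "peval (PNeg a) x y = - peval a x y"
| "peval (a \<oplus> b) x y = peval a x y + peval b x y"
| "peval (a \<otimes> b) x y = peval a x y * peval b x y"
| "peval (a \<up> n) x y = peval a x y ^ n"

text \<open>
  A list stands for the polynomial with these coefficients, constant term first. The parameter \<open>f\<close>
  interprets a coefficient, so that the same operations serve for integer coefficients and for
  coefficients that are themselves polynomials in the second variable.
\<close>

fun lev :: "('a \<Rightarrow> real) \<Rightarrow> 'a list \<Rightarrow> real \<Rightarrow> real" where
  "lev f [] x = 0"
| "lev f (c # cs) x = f c + x * lev f cs x"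

fun ladd :: "('a \<Rightarrow> 'a \<Rightarrow> 'a) \<Rightarrow> 'a list \<Rightarrow> 'a list \<Rightarrow> 'a list" where
  "ladd f [] ys = ys"
| "ladd f (x # xs) [] = x # xs"
| "ladd f (x # xs) (y # ys) = f x y # ladd f xs ys"

fun lmul :: "('a \<Rightarrow> 'a \<Rightarrow> 'a) \<Rightarrow> ('a \<Rightarrow> 'a \<Rightarrow> 'a) \<Rightarrow> 'a \<Rightarrow> 'a list \<Rightarrow> 'a list \<Rightarrow> 'a list" where
  "lmul f g z [] ys = []"
| "lmul f g z (x # xs) ys = ladd f (map (g x) ys) (z # lmul f g z xs ys)"

text \<open>
  The halves [0, 1/2] and [1/2, 1] of the unit interval are rescaled to [0, 1] by first passing from
  p(x) to 2^n p(x / 2), which keeps the coefficients integral, and then from p(x) to p(1 + x).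
\<close>

fun lhalf :: "(int \<Rightarrow> 'a \<Rightarrow> 'a) \<Rightarrow> nat \<Rightarrow> 'a list \<Rightarrow> 'a list" where
  "lhalf g n [] = []"
| "lhalf g n (c # cs) = g (2 ^ n) c # lhalf g (n - 1) cs"

fun lshift :: "('a \<Rightarrow> 'a \<Rightarrow> 'a) \<Rightarrow> 'a list \<Rightarrow> 'a list" where
  "lshift f [] = []"
| "lshift f (c # cs) = (let r = lshift f cs in ladd f (c # r) r)"

fun lower :: "int list \<Rightarrow> int" where
  "lower [] = 0"
| "lower (c # cs) = c + min 0 (lower cs)"

lemma lev_ladd:
  assumes "\<And>a b. f (add a b) = f a + f b"
  shows "lev f (ladd add p q) x = lev f p x + lev f q x"
proof (induction p arbitrary: q)
  case (Cons a p)
  then show ?case by (cases q) (auto simp: assms algebra_simps)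
qed simp

lemma lev_map:
  assumes "\<And>b. f (g b) = k * f b"
  shows "lev f (map g p) x = k * lev f p x"
  by (induction p) (auto simp: assms algebra_simps)

lemma lev_lmul:
  assumes add: "\<And>a b. f (add a b) = f a + f b"
    and mul: "\<And>a b. f (mul a b) = f a * f b" and zero: "f z = 0"
  shows "lev f (lmul add mul z p q) x = lev f p x * lev f q x"
proof (induction p)
  case (Cons a p)
  show ?case
    by (simp add: lev_ladd[OF add] lev_map[of f, OF mul] Cons zero algebra_simps)
qed simp

lemma lev_lhalf:
  assumes "\<And>k c. f (g k c) = of_int k * f c" and "length p \<le> Suc n"
  shows "lev f (lhalf g n p) x = 2 ^ n * lev f p (x / 2)"
  using assms(2)
proof (induction p arbitrary: n)
  case (Cons c p)
  show ?case
  proof (cases n)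
    case 0
    then have "p = []" using Cons.prems by simp
    then show ?thesis using 0 by (simp add: assms(1))
  next
    case (Suc k)
    then show ?thesis using Cons by (simp add: assms(1) algebra_simps)
  qed
qed simp

lemma lev_lshift:
  assumes "\<And>a b. f (add a b) = f a + f b"
  shows "lev f (lshift add p) x = lev f p (1 + x)"
  by (induction p) (auto simp: Let_def lev_ladd[of f add, OF assms] algebra_simps)

text \<open>
  For x in [0, 1], the term x r is at least the smaller of 0 and any lower bound of r. Halving the
  interval makes the higher coefficients small, so enough subdivision makes the bound positive
  whenever the polynomial is.
\<close>

lemma lower_le:
  assumes "\<And>c. c \<in> set p \<Longrightarrow> of_int (g c) \<le> f c" and "0 \<le> x" "x \<le> 1"
  shows "of_int (lower (map g p)) \<le> lev f p x"
  using assms(1)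
proof (induction p)
  case (Cons c p)
  let ?r = "lev f p x" and ?l = "real_of_int (lower (map g p))"
  have IH: "?l \<le> ?r" using Cons by simp
  have "min 0 ?l \<le> x * min 0 ?l"
    using assms(2,3) mult_right_mono_neg[of x 1 "min 0 ?l"] by simp
  also have "\<dots> \<le> x * ?r" using IH assms(2) by (intro mult_left_mono) auto
  finally have "min 0 ?l \<le> x * ?r" .
  moreover have "of_int (g c) \<le> f c" using Cons.prems by simp
  ultimately show ?case by (simp add: of_int_min)
qed simp

type_synonym pol = "int list list"

definition ev2 :: "pol \<Rightarrow> real \<Rightarrow> real \<Rightarrow> real" where
  "ev2 p x y = lev (\<lambda>r. lev of_int r y) p x"

definition add1 :: "int list \<Rightarrow> int list \<Rightarrow> int list" where "add1 = ladd (+)"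
definition mul1 :: "int list \<Rightarrow> int list \<Rightarrow> int list" where "mul1 = lmul (+) (*) 0"
definition add2 :: "pol \<Rightarrow> pol \<Rightarrow> pol" where "add2 = ladd add1"
definition mul2 :: "pol \<Rightarrow> pol \<Rightarrow> pol" where "mul2 = lmul add1 mul1 []"
definition scale1 :: "int \<Rightarrow> int list \<Rightarrow> int list" where "scale1 k = map ((*) k)"
definition scale2 :: "int \<Rightarrow> pol \<Rightarrow> pol" where "scale2 k = map (scale1 k)"
definition lower2 :: "pol \<Rightarrow> int" where "lower2 p = lower (map lower p)"

lemma lev_add1: "lev of_int (add1 p q) y = lev of_int p y + lev of_int q y"
  unfolding add1_def by (rule lev_ladd) simp

lemma lev_mul1: "lev of_int (mul1 p q) y = lev of_int p y * lev of_int q y"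
  unfolding mul1_def by (rule lev_lmul) auto

lemma lev_scale1: "lev of_int (scale1 k p) y = of_int k * lev of_int p y"
  unfolding scale1_def by (rule lev_map) simp

lemma ev2_add: "ev2 (add2 p q) x y = ev2 p x y + ev2 q x y"
  unfolding ev2_def add2_def by (rule lev_ladd) (rule lev_add1)

lemma ev2_mul: "ev2 (mul2 p q) x y = ev2 p x y * ev2 q x y"
  unfolding ev2_def mul2_def by (rule lev_lmul) (auto simp: lev_add1 lev_mul1)

lemma ev2_scale: "ev2 (scale2 k p) x y = of_int k * ev2 p x y"
  unfolding ev2_def scale2_def by (rule lev_map) (rule lev_scale1)

lemma ev2_const: "ev2 [[n]] x y = of_int n"
  by (simp add: ev2_def)

lemma lower2_le:
  assumes "0 \<le> x" "x \<le> 1" "0 \<le> y" "y \<le> 1"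
  shows "of_int (lower2 p) \<le> ev2 p x y"
  unfolding lower2_def ev2_def
proof (rule lower_le)
  fix r
  have "of_int (lower (map id r)) \<le> lev of_int r y"
    by (rule lower_le) (use assms in auto)
  then show "of_int (lower r) \<le> lev of_int r y" by simp
qed (use assms in auto)

fun pow2 :: "pol \<Rightarrow> nat \<Rightarrow> pol" where
  "pow2 p 0 = [[1]]"
| "pow2 p (Suc n) = mul2 p (pow2 p n)"

lemma ev2_pow: "ev2 (pow2 p n) x y = ev2 p x y ^ n"
  by (induction n) (simp_all add: ev2_mul, simp add: ev2_def)

text \<open>
  Pairs stand for an integer polynomial over a positive common denominator. The case distinction
  avoids the product of the denominators where it can, since the size of the integers decides how
  long the computations take.
\<close>

definition qadd :: "pol \<times> int \<Rightarrow> pol \<times> int \<Rightarrow> pol \<times> int" where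
  "qadd a b = (case a of (p, d) \<Rightarrow> case b of (q, e) \<Rightarrow>
     if d = e then (add2 p q, d)
     else if e mod d = 0 then (add2 (scale2 (e div d) p) q, e)
     else if d mod e = 0 then (add2 p (scale2 (d div e) q), d)
     else (add2 (scale2 e p) (scale2 d q), d * e))"

fun compile :: "pol \<times> int \<Rightarrow> pol \<times> int \<Rightarrow> pexp \<Rightarrow> pol \<times> int" where
  "compile vx vy (PC n d) = ([[n]], d)"
| "compile vx vy PX = vx"
| "compile vx vy PY = vy"
| "compile vx vy (PNeg a) = (case compile vx vy a of (p, d) \<Rightarrow> (scale2 (- 1) p, d))"
| "compile vx vy (a \<oplus> b) = qadd (compile vx vy a) (compile vx vy b)"
| "compile vx vy (a \<otimes> b) = (case compile vx vy a of (p, d) \<Rightarrow> case compile vx vy b of (q, e) \<Rightarrow>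
      (mul2 p q, d * e))"
| "compile vx vy (a \<up> n) = (case compile vx vy a of (p, d) \<Rightarrow> (pow2 p n, d ^ n))"

fun denoms_ok :: "pexp \<Rightarrow> bool" where
  "denoms_ok (PC n d) = (0 < d)"
| "denoms_ok PX = True"
| "denoms_ok PY = True"
| "denoms_ok (PNeg a) = denoms_ok a"
| "denoms_ok (a \<oplus> b) = (denoms_ok a \<and> denoms_ok b)"
| "denoms_ok (a \<otimes> b) = (denoms_ok a \<and> denoms_ok b)"
| "denoms_ok (a \<up> n) = denoms_ok a"

definition qev :: "pol \<times> int \<Rightarrow> real \<Rightarrow> real \<Rightarrow> real" where
  "qev a x y = ev2 (fst a) x y / of_int (snd a)"

lemma qadd_correct:
  assumes "0 < snd a" "0 < snd b"
  shows "0 < snd (qadd a b)" "qev (qadd a b) x y = qev a x y + qev b x y"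
proof -
  obtain p d q e where ab: "a = (p, d)" "b = (q, e)" by (cases a, cases b)
  have pos: "0 < d" "0 < e" using assms ab by auto
  have r: "real_of_int (k div l) = of_int k / of_int l" if "k mod l = 0" for k l :: int
    using that by (simp add: real_of_int_div mod_eq_0_iff_dvd)
  show "0 < snd (qadd a b)" using pos by (simp add: ab qadd_def)
  show "qev (qadd a b) x y = qev a x y + qev b x y"
    using pos by (simp add: ab qadd_def qev_def ev2_add ev2_scale r field_simps)
qed

lemma compile_correct:
  assumes "denoms_ok e" "0 < snd vx" "0 < snd vy"
  shows "0 < snd (compile vx vy e) \<and>
    qev (compile vx vy e) x y = peval e (qev vx x y) (qev vy x y)"
  using assms(1)
proof (induction e)
  case (PAdd a b)
  then show ?case using qadd_correct[of "compile vx vy a" "compile vx vy b"] by auto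
next
  case (PMul a b)
  then show ?case
    by (auto simp: qev_def ev2_mul split: prod.splits) (metis times_divide_times_eq)
next
  case (PPow a n)
  then show ?case
    by (auto simp: qev_def ev2_pow split: prod.splits) (metis power_divide)
qed (auto simp: assms qev_def ev2_scale ev2_const split: prod.splits)

text \<open>
  A subdivision tree of the unit square is a certificate: on each of its leaves the bound \<open>lower2\<close> has
  to be positive.
\<close>

datatype cover = Leaf | SplitX cover cover | SplitY cover cover

definition degY :: "pol \<Rightarrow> nat" where "degY p = fold (\<lambda>r. max (length r)) p 0"

fun covers :: "cover \<Rightarrow> pol \<Rightarrow> bool" where
  "covers Leaf p = (0 < lower2 p)"
| "covers (SplitX l r) p =
     (let q = lhalf scale1 (length p) p in covers l q \<and> covers r (lshift add1 q))"
| "covers (SplitY l r) p =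
     (let n = degY p; q = map (lhalf (*) n) p in covers l q \<and> covers r (map (lshift (+)) q))"

lemma degY_ge: "r \<in> set p \<Longrightarrow> length r \<le> degY p"
proof -
  have "n \<le> fold (\<lambda>r. max (length r)) p n \<and> (\<forall>r\<in>set p. length r \<le> fold (\<lambda>r. max (length r)) p n)"
    for n :: nat and p :: pol
  proof (induction p arbitrary: n)
    case (Cons a p)
    from Cons[of "max (length a) n"] show ?case by (auto simp: max.commute)
  qed simp
  then show "r \<in> set p \<Longrightarrow> length r \<le> degY p" by (simp add: degY_def)
qed

lemma ev2_halfX: "ev2 (lhalf scale1 (length p) p) x y = 2 ^ length p * ev2 p (x / 2) y"
  unfolding ev2_def by (rule lev_lhalf) (auto simp: lev_scale1)

lemma ev2_shiftX: "ev2 (lshift add1 p) x y = ev2 p (1 + x) y"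
  unfolding ev2_def by (rule lev_lshift) (rule lev_add1)

lemma ev2_halfY: "ev2 (map (lhalf (*) (degY p)) p) x y = 2 ^ degY p * ev2 p x (y / 2)"
proof -
  have "lev (\<lambda>r. lev of_int r y) (map (lhalf (*) n) p) x = 2 ^ n * lev (\<lambda>r. lev of_int r (y / 2)) p x"
    if "\<And>r. r \<in> set p \<Longrightarrow> length r \<le> n" for n p
    using that
  proof (induction p)
    case (Cons r p)
    have "lev of_int (lhalf (*) n r) y = 2 ^ n * lev of_int r (y / 2)"
      by (rule lev_lhalf) (use Cons.prems[of r] in auto)
    with Cons show ?case by (simp add: algebra_simps)
  qed simp
  from this[of p "degY p"] degY_ge show ?thesis unfolding ev2_def by blast
qed

lemma ev2_shiftY: "ev2 (map (lshift (+)) p) x y = ev2 p x (1 + y)"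
  unfolding ev2_def
  by (induction p) (simp_all add: lev_lshift[of "of_int :: int \<Rightarrow> real"])

lemma covers_pos:
  assumes "covers t p" "0 \<le> x" "x \<le> 1" "0 \<le> y" "y \<le> 1"
  shows "0 < ev2 p x y"
  using assms
proof (induction t arbitrary: p x y)
  case Leaf
  then have "0 < real_of_int (lower2 p)" by simp
  also have "\<dots> \<le> ev2 p x y" using Leaf.prems by (intro lower2_le)
  finally show ?case .
next
  case (SplitX l r)
  let ?q = "lhalf scale1 (length p) p"
  have "0 < 2 ^ length p * ev2 p x y"
  proof (cases "x \<le> 1/2")
    case True
    have "0 < ev2 ?q (2 * x) y"
      by (rule SplitX.IH(1)) (use SplitX.prems True in \<open>auto simp: Let_def\<close>)
    then show ?thesis by (simp add: ev2_halfX)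
  next
    case False
    have "0 < ev2 (lshift add1 ?q) (2 * x - 1) y"
      by (rule SplitX.IH(2)) (use SplitX.prems False in \<open>auto simp: Let_def\<close>)
    then show ?thesis by (simp add: ev2_shiftX ev2_halfX)
  qed
  then show ?case by (simp add: zero_less_mult_iff)
next
  case (SplitY l r)
  let ?q = "map (lhalf (*) (degY p)) p"
  have "0 < 2 ^ degY p * ev2 p x y"
  proof (cases "y \<le> 1/2")
    case True
    have "0 < ev2 ?q x (2 * y)"
      by (rule SplitY.IH(1)) (use SplitY.prems True in \<open>auto simp: Let_def\<close>)
    then show ?thesis by (simp add: ev2_halfY)
  next
    case False
    have "0 < ev2 (map (lshift (+)) ?q) x (2 * y - 1)"
      by (rule SplitY.IH(2)) (use SplitY.prems False in \<open>auto simp: Let_def simp del: map_map\<close>)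
    then show ?thesis by (simp only: ev2_shiftY ev2_halfY) simp
  qed
  then show ?case by (simp add: zero_less_mult_iff)
qed

text \<open>
  The triple (a, b, c) is the interval from a / c to b / c; its affine parametrisation by
  [0, 1] is substituted before the certificate is checked.
\<close>

definition positive_on :: "cover \<Rightarrow> int \<times> int \<times> int \<Rightarrow> int \<times> int \<times> int \<Rightarrow> pexp \<Rightarrow> bool" where
  "positive_on t X Y e = (case X of (a, b, c) \<Rightarrow> case Y of (a', b', c') \<Rightarrow>
     denoms_ok e \<and> 0 < c \<and> 0 < c' \<and> a < b \<and> a' < b' \<and>
     covers t (fst (compile ([[a], [b - a]], c) ([[a', b' - a']], c') e)))"

lemma positive_on:
  assumes "positive_on t (a, b, c) (a', b', c') e"
    and "of_int a / of_int c \<le> x" "x \<le> of_int b / of_int c"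
    and "of_int a' / of_int c' \<le> y" "y \<le> of_int b' / of_int c'"
  shows "0 < peval e x y"
proof -
  define vx :: "pol \<times> int" where "vx = ([[a], [b - a]], c)"
  define vy :: "pol \<times> int" where "vy = ([[a', b' - a']], c')"
  have ok: "denoms_ok e" "0 < c" "0 < c'" "a < b" "a' < b'" "covers t (fst (compile vx vy e))"
    using assms(1) unfolding positive_on_def vx_def vy_def by auto
  define u where "u = (x * c - a) / (b - a)"
  define v where "v = (y * c' - a') / (b' - a')"
  have u: "0 \<le> u" "u \<le> 1" and v: "0 \<le> v" "v \<le> 1"
    using assms(2-) ok(2-5) by (auto simp: u_def v_def field_simps)
  have "qev vx u v = x" "qev vy u v = y"
    using ok(2-5) by (auto simp: qev_def vx_def vy_def ev2_def u_def v_def field_simps)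
  moreover have "0 < snd (compile vx vy e) \<and>
      qev (compile vx vy e) u v = peval e (qev vx u v) (qev vy u v)"
    by (rule compile_correct) (use ok in \<open>auto simp: vx_def vy_def\<close>)
  moreover have "0 < ev2 (fst (compile vx vy e)) u v"
    by (rule covers_pos[OF ok(6) u v])
  ultimately have "0 < snd (compile vx vy e)" "qev (compile vx vy e) u v = peval e x y"
    "0 < ev2 (fst (compile vx vy e)) u v" by simp_all
  then show ?thesis by (metis qev_def divide_pos_pos of_int_0_less_iff)
qed


section \<open>The function J as the solution of an initial value problem\<close>

definition w0 :: real where
  "w0 = (SOME w. 1/2 < w \<and> w < 1 \<and> sqrt 2 * w * gauss_I (1 / (2 * w)) = 1/2)"

text \<open>
  J without its special value at the endpoint 1, and the derivative of J. Here \<open>inv Phi\<close> makes sense on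
  [1/2, 1), since 1 / (2 w0) < 1.
\<close>

definition Je :: "real \<Rightarrow> real" where
  "Je x = sqrt 2 * w0 * std_normal_density (inv Phi ((1 - x) / w0))"

definition dJ :: "real \<Rightarrow> real" where
  "dJ x = sqrt 2 * inv Phi ((1 - x) / w0)"

definition s0 :: real where "s0 = dJ (1/2)"

lemma w0: "1/2 < w0" "w0 < 1" "sqrt 2 * w0 * gauss_I (1 / (2 * w0)) = 1/2"
proof -
  obtain w :: real where "1/2 < w" "w < 1" "sqrt 2 * w * gauss_I (1 / (2 * w)) = 1/2"
    by (rule ex_w0)
  then have "\<exists>w. 1/2 < w \<and> w < 1 \<and> sqrt 2 * w * gauss_I (1 / (2 * w)) = 1/2" by blast
  from someI_ex[OF this]
  show "1/2 < w0" "w0 < 1" "sqrt 2 * w0 * gauss_I (1 / (2 * w0)) = 1/2"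
    unfolding w0_def by blast+
qed

lemma Je_pos: "0 < Je x"
  unfolding Je_def using w0 by (intro mult_pos_pos std_normal_density_pos) auto

lemma J_eq_Je:
  assumes "1/2 \<le> x" "x < 1"
  shows "J x = Je x"
proof -
  have "J x = sqrt 2 * w0 * gauss_I ((1 - x) / w0)"
    by (rule J_explicit_if) (use w0 assms in auto)
  moreover have "0 < (1 - x) / w0" "(1 - x) / w0 < 1" using w0 assms by (auto simp: field_simps)
  ultimately show ?thesis by (simp add: Je_def gauss_I_def)
qed

lemma J_half: "J (1/2) = 1/2" and J_1: "J 1 = 0"
  using solves_J_J unfolding solves_J_def by auto

lemma Je_half: "Je (1/2) = 1/2"
  using J_eq_Je[of "1/2"] J_half by simp

lemma inv_Phi_arg_deriv:
  assumes "1/2 \<le> x" "x < 1"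
  shows "((\<lambda>x. inv Phi ((1 - x) / w0)) has_real_derivative
    - 1 / (w0 * std_normal_density (inv Phi ((1 - x) / w0)))) (at x)"
proof -
  have u: "0 < (1 - x) / w0" "(1 - x) / w0 < 1" using w0 assms by (auto simp: field_simps)
  have "((\<lambda>x. (1 - x) / w0) has_real_derivative - 1 / w0) (at x)"
    using w0 by (auto intro!: derivative_eq_intros)
  from DERIV_chain2[OF inv_Phi_deriv[OF u] this] show ?thesis by (simp add: mult.commute)
qed

lemma Je_deriv:
  assumes "1/2 \<le> x" "x < 1"
  shows "(Je has_real_derivative dJ x) (at x)"
proof -
  let ?z = "inv Phi ((1 - x) / w0)"
  have "(Je has_real_derivative
      sqrt 2 * w0 * (- ?z * std_normal_density ?z * (- 1 / (w0 * std_normal_density ?z)))) (at x)"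
    unfolding Je_def
    by (intro DERIV_cmult DERIV_chain2[OF std_normal_density_deriv] inv_Phi_arg_deriv assms)
  then show ?thesis using w0 std_normal_density_pos[of ?z] by (simp add: dJ_def)
qed

lemma dJ_deriv:
  assumes "1/2 \<le> x" "x < 1"
  shows "(dJ has_real_derivative - 2 / Je x) (at x)"
proof -
  let ?z = "inv Phi ((1 - x) / w0)"
  have "(dJ has_real_derivative sqrt 2 * (- 1 / (w0 * std_normal_density ?z))) (at x)"
    unfolding dJ_def by (intro DERIV_cmult inv_Phi_arg_deriv assms)
  moreover have "sqrt 2 * (- 1 / (w0 * std_normal_density ?z)) = - 2 / Je x"
    using w0 std_normal_density_pos[of ?z] unfolding Je_def
    by (simp add: field_simps)
  ultimately show ?thesis by simp
qed

lemma dJ_antimono: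
  assumes "1/2 \<le> x" "x \<le> m" "m < 1"
  shows "dJ m \<le> dJ x"
proof (rule DERIV_nonpos_imp_nonincreasing[where a=x and b=m and f=dJ])
  show "x \<le> m" by fact
  fix u assume "x \<le> u" "u \<le> m"
  then show "\<exists>y. (dJ has_real_derivative y) (at u) \<and> y \<le> 0"
    using dJ_deriv[of u] Je_pos[of u] assms by (intro exI[of _ "- 2 / Je u"] conjI) auto
qed

lemma std_normal_density_bounds:
  defines "k \<equiv> 1 / sqrt (2 * pi)"
  shows "k * (1 - t\<^sup>2 / 2) \<le> std_normal_density t"
    "std_normal_density t \<le> k * (1 - t\<^sup>2 / 2 + t ^ 4 / 8)"
    "k * (1 - t\<^sup>2 / 2 + t ^ 4 / 8 - t ^ 6 / 48) \<le> std_normal_density t"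
proof -
  have k: "0 < k" by (simp add: k_def)
  have phi: "std_normal_density t = k * exp (- (t\<^sup>2 / 2))"
    by (simp add: std_normal_density_def k_def)
  have e0: "1 - u \<le> exp (- u)" for u :: real using exp_ge_add_one_self[of "- u"] by simp
  have e1: "exp (- u) \<le> 1 - u + u\<^sup>2 / 2" if "0 \<le> u" for u :: real
  proof -
    have "(\<lambda>u. 1 - u + u\<^sup>2 / 2 - exp (- u)) 0 \<le> (\<lambda>u. 1 - u + u\<^sup>2 / 2 - exp (- u)) u"
    proof (rule DERIV_nonneg_imp_nondecreasing[OF that])
      fix v :: real
      have "((\<lambda>u. 1 - u + u\<^sup>2 / 2 - exp (- u)) has_real_derivative exp (- v) - (1 - v)) (at v)"
        by (auto intro!: derivative_eq_intros)
      then show "\<exists>y. ((\<lambda>u. 1 - u + u\<^sup>2 / 2 - exp (- u)) has_real_derivative y) (at v) \<and> 0 \<le> y"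
        using e0[of v] by (intro exI conjI) auto
    qed
    then show ?thesis by simp
  qed
  have e2: "1 - u + u\<^sup>2 / 2 - u ^ 3 / 6 \<le> exp (- u)" if "0 \<le> u" for u :: real
  proof -
    have "(\<lambda>u. exp (- u) - (1 - u + u\<^sup>2 / 2 - u ^ 3 / 6)) 0
        \<le> (\<lambda>u. exp (- u) - (1 - u + u\<^sup>2 / 2 - u ^ 3 / 6)) u"
    proof (rule DERIV_nonneg_imp_nondecreasing[OF that])
      fix v :: real assume "0 \<le> v"
      then have "0 \<le> 1 - v + v\<^sup>2 / 2 - exp (- v)" using e1 by simp
      moreover have "((\<lambda>u. exp (- u) - (1 - u + u\<^sup>2 / 2 - u ^ 3 / 6)) has_real_derivative
          1 - v + v\<^sup>2 / 2 - exp (- v)) (at v)"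
        by (auto intro!: derivative_eq_intros)
      ultimately show "\<exists>y. ((\<lambda>u. exp (- u) - (1 - u + u\<^sup>2 / 2 - u ^ 3 / 6)) has_real_derivative y)
          (at v) \<and> 0 \<le> y" by blast
    qed
    then show ?thesis by simp
  qed
  have u: "0 \<le> t\<^sup>2 / 2" by simp
  have sq: "(t\<^sup>2 / 2)\<^sup>2 / 2 = t ^ 4 / 8" "(t\<^sup>2 / 2) ^ 3 / 6 = t ^ 6 / 48"
    by (simp_all add: power2_eq_square power3_eq_cube eval_nat_numeral)
  show "k * (1 - t\<^sup>2 / 2) \<le> std_normal_density t"
    unfolding phi using k e0[of "t\<^sup>2 / 2"] by (intro mult_left_mono) auto
  show "std_normal_density t \<le> k * (1 - t\<^sup>2 / 2 + t ^ 4 / 8)"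
    unfolding phi using k e1[OF u] unfolding sq by (intro mult_left_mono) auto
  show "k * (1 - t\<^sup>2 / 2 + t ^ 4 / 8 - t ^ 6 / 48) \<le> std_normal_density t"
    unfolding phi using k e2[OF u] unfolding sq by (intro mult_left_mono) auto
qed

text \<open>
  These come from integrating the bounds for the density.
\<close>

lemma Phi_bounds:
  defines "k \<equiv> 1 / sqrt (2 * pi)"
  assumes "0 \<le> t"
  shows "1/2 + k * (t - t ^ 3 / 6) \<le> Phi t" "Phi t \<le> 1/2 + k * (t - t ^ 3 / 6 + t ^ 5 / 40)"
proof -
  have "(\<lambda>t. Phi t - k * (t - t ^ 3 / 6)) 0 \<le> (\<lambda>t. Phi t - k * (t - t ^ 3 / 6)) t"
  proof (rule DERIV_nonneg_imp_nondecreasing[OF assms(2)])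
    fix v :: real
    have "((\<lambda>t. Phi t - k * (t - t ^ 3 / 6)) has_real_derivative
        std_normal_density v - k * (1 - v\<^sup>2 / 2)) (at v)"
      by (auto intro!: derivative_eq_intros Phi_deriv)
    then show "\<exists>y. ((\<lambda>t. Phi t - k * (t - t ^ 3 / 6)) has_real_derivative y) (at v) \<and> 0 \<le> y"
      using std_normal_density_bounds(1)[of v] unfolding k_def by (intro exI conjI) auto
  qed
  then show "1/2 + k * (t - t ^ 3 / 6) \<le> Phi t" by (simp add: Phi_0)
  have "(\<lambda>t. k * (t - t ^ 3 / 6 + t ^ 5 / 40) - Phi t) 0 \<le> (\<lambda>t. k * (t - t ^ 3 / 6 + t ^ 5 / 40) - Phi t) t"
  proof (rule DERIV_nonneg_imp_nondecreasing[OF assms(2)])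
    fix v :: real
    have "((\<lambda>t. k * (t - t ^ 3 / 6 + t ^ 5 / 40) - Phi t) has_real_derivative
        k * (1 - v\<^sup>2 / 2 + v ^ 4 / 8) - std_normal_density v) (at v)"
      by (auto intro!: derivative_eq_intros Phi_deriv)
    then show "\<exists>y. ((\<lambda>t. k * (t - t ^ 3 / 6 + t ^ 5 / 40) - Phi t) has_real_derivative y) (at v) \<and> 0 \<le> y"
      using std_normal_density_bounds(2)[of v] unfolding k_def by (intro exI conjI) auto
  qed
  then show "Phi t \<le> 1/2 + k * (t - t ^ 3 / 6 + t ^ 5 / 40)" by (simp add: Phi_0)
qed

lemma sqrt2_bounds: "1414213562/1000000000 < sqrt 2" "sqrt 2 < 1414213563/1000000000"
proof -
  show "1414213562/1000000000 < sqrt 2" by (rule real_less_rsqrt) (simp add: power2_eq_square)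
  show "sqrt 2 < 1414213563/1000000000" by (rule real_less_lsqrt) (simp_all add: power2_eq_square)
qed

text \<open>
  With t = inv Phi (1 / (2 w0)), the condition J(1/2) = 1/2 reads sqrt 2 * phi(t) = Phi(t), and s0
  is sqrt 2 * t. The difference of the two sides decreases for t \<ge> 0, so its signs at 0.14635 and
  0.14636 enclose t; the truncated exponential series are accurate enough to decide them.
\<close>

lemma s0_bounds: "20697/100000 < s0" "s0 < 206985/1000000"
proof -
  define t where "t = inv Phi (1 / (2 * w0))"
  define k where "k = 1 / sqrt (2 * pi)"
  have u: "0 < 1 / (2 * w0)" "1 / (2 * w0) < 1" "1/2 < 1 / (2 * w0)" using w0 by (auto simp: field_simps)
  have Pt: "Phi t = 1 / (2 * w0)" unfolding t_def by (rule Phi_inv_Phi[OF u(1,2)])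
  have "0 < t" using Phi_less_iff[of 0 t] Pt Phi_0 u(3) by simp
  have root: "sqrt 2 * std_normal_density t = Phi t"
    using w0 u unfolding Pt by (simp add: gauss_I_def t_def field_simps)
  have s0: "s0 = sqrt 2 * t" by (simp add: s0_def dJ_def t_def)
  have decr: "sqrt 2 * std_normal_density b - Phi b \<le> sqrt 2 * std_normal_density a - Phi a"
    if "0 \<le> a" "a \<le> b" for a b
  proof (rule DERIV_nonpos_imp_nonincreasing[OF that(2)])
    fix v assume v: "a \<le> v"
    have "((\<lambda>v. sqrt 2 * std_normal_density v - Phi v) has_real_derivative
        sqrt 2 * (- v * std_normal_density v) - std_normal_density v) (at v)"
      by (intro DERIV_diff DERIV_cmult std_normal_density_deriv Phi_deriv)
    moreover have "sqrt 2 * (- v * std_normal_density v) - std_normal_density v \<le> 0"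
      using v that std_normal_density_pos[of v] mult_nonneg_nonneg[of v "std_normal_density v"]
      by (simp add: mult.assoc)
         (smt (verit) mult_nonneg_nonneg real_sqrt_ge_zero)
    ultimately show "\<exists>y. ((\<lambda>v. sqrt 2 * std_normal_density v - Phi v) has_real_derivative y) (at v) \<and> y \<le> 0"
      by blast
  qed
  have kpos: "0 < k" by (simp add: k_def)
  have k1: "k * c = c / sqrt (2 * pi)" for c by (simp add: k_def)
  have pl: "2506628/1000000 < sqrt (2 * pi)"
    by (rule real_less_rsqrt) (use pi_approx in \<open>simp add: power2_eq_square\<close>)
  have pu: "sqrt (2 * pi) < 2506629/1000000"
    by (rule real_less_lsqrt) (use pi_approx in \<open>auto simp: power2_eq_square\<close>)
  have inv: "k * sqrt (2 * pi) = 1" by (simp add: k_def)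
  have half: "k * (1253314/1000000) < 1/2" "1/2 < k * (12533145/10000000)"
  proof -
    have "k * (2506628/1000000) < k * sqrt (2 * pi)" using pl kpos by (rule mult_strict_left_mono)
    then show "k * (1253314/1000000) < 1/2" using inv by simp
    have "k * sqrt (2 * pi) < k * (2506629/1000000)" using pu kpos by (rule mult_strict_left_mono)
    then show "1/2 < k * (12533145/10000000)" using inv by simp
  qed
  have nn: "0 \<le> (14635/100000::real)" "0 \<le> (14636/100000::real)" by simp_all
  have "t > (14635/100000)"
  proof (rule ccontr)
    assume "\<not> t > (14635/100000)"
    then have "sqrt 2 * std_normal_density (14635/100000) - Phi (14635/100000) \<le> 0"
      using decr[of t "14635/100000"] \<open>0 < t\<close> root by simp
    moreover have "k * (1414213562/1000000000 * (1 - (14635/100000)\<^sup>2 / 2 + (14635/100000) ^ 4 / 8 - (14635/100000) ^ 6 / 48))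
        \<le> sqrt 2 * std_normal_density (14635/100000)"
    proof -
      have "1414213562/1000000000 * (k * (1 - (14635/100000)\<^sup>2 / 2 + (14635/100000) ^ 4 / 8 - (14635/100000) ^ 6 / 48))
          \<le> sqrt 2 * std_normal_density (14635/100000)"
        using sqrt2_bounds kpos std_normal_density_bounds(3)[of "14635/100000"] unfolding k_def
        by (intro mult_mono) (auto simp: power2_eq_square eval_nat_numeral)
      then show ?thesis by (simp only: ac_simps)
    qed
    moreover have "Phi (14635/100000) < k * (12533145/10000000 + (14635/100000 - (14635/100000) ^ 3 / 6 + (14635/100000) ^ 5 / 40))"
      using Phi_bounds(2)[OF nn(1)] half(2)
        distrib_left[of k "12533145/10000000" "14635/100000 - (14635/100000) ^ 3 / 6 + (14635/100000) ^ 5 / 40"]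
      unfolding k_def[symmetric] by linarith
    ultimately have "k * (1414213562/1000000000 * (1 - (14635/100000)\<^sup>2 / 2 + (14635/100000) ^ 4 / 8 - (14635/100000) ^ 6 / 48))
        < k * (12533145/10000000 + (14635/100000 - (14635/100000) ^ 3 / 6 + (14635/100000) ^ 5 / 40))" by linarith
    then show False using kpos by (simp add: mult_less_cancel_left_pos power2_eq_square eval_nat_numeral)
  qed
  moreover have "t < 14636/100000"
  proof (rule ccontr)
    assume "\<not> t < 14636/100000"
    then have "0 \<le> sqrt 2 * std_normal_density (14636/100000) - Phi (14636/100000)"
      using decr[of "14636/100000" t] root by simp
    moreover have "sqrt 2 * std_normal_density (14636/100000) \<le> k * (1414213563/1000000000 * (1 - (14636/100000)\<^sup>2 / 2 + (14636/100000) ^ 4 / 8))"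
    proof -
      have "sqrt 2 * std_normal_density (14636/100000) \<le> 1414213563/1000000000 * (k * (1 - (14636/100000)\<^sup>2 / 2 + (14636/100000) ^ 4 / 8))"
        using sqrt2_bounds std_normal_density_bounds(2)[of "14636/100000"] std_normal_density_pos[of "14636/100000"]
        unfolding k_def by (intro mult_mono) (auto simp: less_imp_le)
      then show ?thesis by (simp only: ac_simps)
    qed
    moreover have "k * (1253314/1000000 + (14636/100000 - (14636/100000) ^ 3 / 6)) < Phi (14636/100000)"
      using Phi_bounds(1)[OF nn(2)] half(1)
        distrib_left[of k "1253314/1000000" "14636/100000 - (14636/100000) ^ 3 / 6"]
      unfolding k_def[symmetric] by linarith
    ultimately have "k * (1253314/1000000 + (14636/100000 - (14636/100000) ^ 3 / 6))
        < k * (1414213563/1000000000 * (1 - (14636/100000)\<^sup>2 / 2 + (14636/100000) ^ 4 / 8))" by linarith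
    then show False using kpos by (simp add: mult_less_cancel_left_pos power2_eq_square eval_nat_numeral)
  qed
  ultimately have t: "14635/100000 < t" "t < 14636/100000" by simp_all
  have "1414213562/1000000000 * (14635/100000) \<le> sqrt 2 * t" using t sqrt2_bounds by (intro mult_mono) auto
  then show "20697/100000 < s0" unfolding s0 by simp
  have "sqrt 2 * t \<le> 1414213563/1000000000 * (14636/100000)" using t sqrt2_bounds \<open>0 < t\<close> by (intro mult_mono) auto
  then show "s0 < 206985/1000000" unfolding s0 by simp
qed

text \<open>
  Adding e exp(K t) with large K makes both the differential inequality and the initial conditions
  strict. As long as the sum g is positive, g'' \<ge> q g \<ge> 0 and g increases, so it cannot
  reach 0.
\<close>

lemma second_order_nonneg:
  fixes d d' d'' q :: "real \<Rightarrow> real"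
  assumes d: "\<And>t. 0 \<le> t \<Longrightarrow> t \<le> T \<Longrightarrow> (d has_real_derivative d' t) (at t)"
    and d': "\<And>t. 0 \<le> t \<Longrightarrow> t \<le> T \<Longrightarrow> (d' has_real_derivative d'' t) (at t)"
    and ineq: "\<And>t. 0 \<le> t \<Longrightarrow> t \<le> T \<Longrightarrow> q t * d t \<le> d'' t"
    and q: "\<And>t. 0 \<le> t \<Longrightarrow> t \<le> T \<Longrightarrow> 0 \<le> q t" "\<And>t. 0 \<le> t \<Longrightarrow> t \<le> T \<Longrightarrow> q t \<le> C"
    and init: "0 \<le> d 0" "0 \<le> d' 0"
    and t: "0 \<le> t" "t \<le> T"
  shows "0 \<le> d t \<and> 0 \<le> d' t"
proof -
  have nonneg: "0 \<le> d t" if t: "0 \<le> t" "t \<le> T" for t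
  proof (rule ccontr)
    assume neg: "\<not> 0 \<le> d t"
    define K where "K = C + 1"
    have "0 \<le> C" using q[of t] t by linarith
    then have K: "0 < K" "C \<le> K\<^sup>2" by (simp_all add: K_def power2_eq_square algebra_simps)
    \<comment> \<open>Small enough that the perturbed function is still negative at t.\<close>
    define e where "e = - d t / (2 * exp (K * t))"
    have e: "0 < e" using neg by (simp add: e_def divide_neg_pos)
    define g where "g = (\<lambda>s. d s + e * exp (K * s))"
    define g' where "g' = (\<lambda>s. d' s + e * (K * exp (K * s)))"
    have Dg: "(g has_real_derivative g' s) (at s)"
      and Dg': "(g' has_real_derivative d'' s + e * (K\<^sup>2 * exp (K * s))) (at s)"
      if "0 \<le> s" "s \<le> T" for s
      using that unfolding g_def g'_def
      by (auto intro!: derivative_eq_intros d d' simp: power2_eq_square)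
    have cont: "continuous_on {0..t} g"
      by (rule DERIV_continuous_on[where D = g'])
         (use Dg t in \<open>auto intro: has_field_derivative_at_within\<close>)
    define Z where "Z = {0..t} \<inter> g -` {..0}"
    have "closed Z" unfolding Z_def by (rule continuous_closed_preimage[OF cont]) auto
    then have "compact Z" unfolding Z_def by (metis compact_Icc compact_Int_closed inf.idem inf_assoc)
    moreover have "t \<in> Z" using t neg by (simp add: Z_def g_def e_def)
    ultimately obtain z where z: "z \<in> Z" "\<And>s. s \<in> Z \<Longrightarrow> z \<le> s"
      using compact_attains_inf[of Z] by auto
    have zt: "0 \<le> z" "z \<le> t" "g z \<le> 0" using z(1) by (auto simp: Z_def)
    have slope: "0 < g' s" if s: "0 \<le> s" "s < z" for s
    proof -
      have "g' 0 \<le> g' s"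
      proof (rule DERIV_nonneg_imp_nondecreasing[OF s(1)])
        fix u assume u: "0 \<le> u" "u \<le> s"
        then have uT: "0 \<le> u" "u \<le> T" using s zt t by auto
        have "u \<notin> Z" using z(2)[of u] u s by auto
        then have "0 < g u" using u s zt by (auto simp: Z_def)
        then have "0 \<le> q u * g u" using q(1)[OF uT] by simp
        also have "\<dots> = q u * d u + e * (q u * exp (K * u))" by (simp add: g_def algebra_simps)
        also have "\<dots> \<le> d'' u + e * (K\<^sup>2 * exp (K * u))"
          using ineq[OF uT] q(2)[OF uT] K e
          by (intro add_mono mult_left_mono mult_right_mono) auto
        finally show "\<exists>y. (g' has_real_derivative y) (at u) \<and> 0 \<le> y" using Dg'[OF uT] by blast
      qed
      moreover have "0 < g' 0" using init e K by (simp add: g'_def add_nonneg_pos)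
      ultimately show ?thesis by simp
    qed
    have "g 0 \<le> g z"
    proof (rule DERIV_nonneg_imp_increasing_open[OF zt(1)])
      show "\<exists>y. (g has_real_derivative y) (at s) \<and> 0 \<le> y" if "0 < s" "s < z" for s
        using Dg[of s] slope[of s] that zt t by (intro exI[of _ "g' s"]) auto
      show "continuous_on {0..z} g" by (rule continuous_on_subset[OF cont]) (use zt in auto)
    qed
    moreover have "0 < g 0" using init e by (simp add: g_def)
    ultimately show False using zt by simp
  qed
  have "d' 0 \<le> d' t"
  proof (rule DERIV_nonneg_imp_nondecreasing[OF t(1)])
    fix s assume "0 \<le> s" "s \<le> t"
    then have s: "0 \<le> s" "s \<le> T" using t by auto
    have "0 \<le> q s * d s" using q(1)[OF s] nonneg[OF s] by simp
    then show "\<exists>y. (d' has_real_derivative y) (at s) \<and> 0 \<le> y"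
      using d'[OF s] ineq[OF s] by (intro exI[of _ "d'' s"]) auto
  qed
  then show ?thesis using nonneg[OF t] init by simp
qed

text \<open>
  The difference d = f - J satisfies d'' \<ge> 2 / J - 2 / f = q d with q = 2 / (f J) \<ge> 0 if
  f'' f \<ge> -2, and the opposite inequality if f'' f \<le> -2.
\<close>

lemma J_comparison:
  fixes f f' f'' :: "real \<Rightarrow> real"
  assumes f: "\<And>t. 0 \<le> t \<Longrightarrow> t \<le> T \<Longrightarrow> (f has_real_derivative f' t) (at t)"
    and f': "\<And>t. 0 \<le> t \<Longrightarrow> t \<le> T \<Longrightarrow> (f' has_real_derivative f'' t) (at t)"
    and pos: "\<And>t. 0 \<le> t \<Longrightarrow> t \<le> T \<Longrightarrow> 0 < f t"
    and init: "f 0 = 1/2" "f' 0 = s0"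
    and t: "0 \<le> t" "t \<le> T" and T: "T < 1/2"
  shows "(\<And>t. 0 \<le> t \<Longrightarrow> t \<le> T \<Longrightarrow> - 2 \<le> f'' t * f t) \<Longrightarrow> Je (1/2 + t) \<le> f t \<and> dJ (1/2 + t) \<le> f' t"
    and "(\<And>t. 0 \<le> t \<Longrightarrow> t \<le> T \<Longrightarrow> f'' t * f t \<le> - 2) \<Longrightarrow> f t \<le> Je (1/2 + t) \<and> f' t \<le> dJ (1/2 + t)"
proof -
  define j where "j = (\<lambda>t. Je (1/2 + t))"
  define j' where "j' = (\<lambda>t. dJ (1/2 + t))"
  define q where "q = (\<lambda>t. 2 / (f t * j t))"
  have j: "(j has_real_derivative j' t) (at t)" and j': "(j' has_real_derivative - 2 / j t) (at t)"
    if "0 \<le> t" "t \<le> T" for t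
  proof -
    have "((\<lambda>t. 1/2 + t) has_real_derivative 1) (at t)" by (auto intro!: derivative_eq_intros)
    from DERIV_chain2[OF Je_deriv this] DERIV_chain2[OF dJ_deriv this] that T
    show "(j has_real_derivative j' t) (at t)" "(j' has_real_derivative - 2 / j t) (at t)"
      unfolding j_def j'_def by auto
  qed
  have jpos: "0 < j t" for t by (simp add: j_def Je_pos)
  have j0: "j 0 = 1/2" "j' 0 = s0" by (simp_all add: j_def j'_def Je_half s0_def)
  have cont: "continuous_on {0..T} q"
    unfolding q_def
    using DERIV_continuous_on[where D=f' and f=f and s="{0..T}"] DERIV_continuous_on[where D=j' and f=j and s="{0..T}"]
      f j pos jpos
    by (intro continuous_intros) (auto intro: has_field_derivative_at_within simp: less_imp_neq[symmetric])
  then obtain c where c: "c \<in> {0..T}" "\<And>t. t \<in> {0..T} \<Longrightarrow> q t \<le> q c"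
    using continuous_attains_sup[of "{0..T}" q] t by auto
  have qpos: "0 \<le> q t" if "0 \<le> t" "t \<le> T" for t
    using pos[OF that] jpos[of t] by (simp add: q_def)
  have key: "2 / j t - 2 / f t = q t * (f t - j t)" if "0 \<le> t" "t \<le> T" for t
    using pos[OF that] jpos[of t] by (simp add: q_def field_simps)
  have "j t \<le> f t \<and> j' t \<le> f' t" if *: "\<And>t. 0 \<le> t \<Longrightarrow> t \<le> T \<Longrightarrow> - 2 \<le> f'' t * f t"
  proof -
    have "0 \<le> (\<lambda>t. f t - j t) t \<and> 0 \<le> (\<lambda>t. f' t - j' t) t"
    proof (rule second_order_nonneg[where T=T and C="q c" and q=q and d="\<lambda>t. f t - j t"
            and d'="\<lambda>t. f' t - j' t" and d''="\<lambda>t. f'' t - (- 2 / j t)"])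
      fix t assume t: "0 \<le> t" "t \<le> T"
      show "((\<lambda>t. f t - j t) has_real_derivative f' t - j' t) (at t)"
        by (rule DERIV_diff[OF f[OF t] j[OF t]])
      show "((\<lambda>t. f' t - j' t) has_real_derivative f'' t - (- 2 / j t)) (at t)"
        by (rule DERIV_diff[OF f'[OF t] j'[OF t]])
      have "- 2 / f t \<le> f'' t" using *[OF t] pos[OF t] by (simp add: field_simps)
      then show "q t * (f t - j t) \<le> f'' t - (- 2 / j t)" using key[OF t] by simp
      show "0 \<le> q t" "q t \<le> q c" using qpos c t by auto
    qed (use init j0 t in auto)
    then show ?thesis by simp
  qed
  then show "(\<And>t. 0 \<le> t \<Longrightarrow> t \<le> T \<Longrightarrow> - 2 \<le> f'' t * f t) \<Longrightarrow> Je (1/2 + t) \<le> f t \<and> dJ (1/2 + t) \<le> f' t"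
    by (simp add: j_def j'_def)
  have "f t \<le> j t \<and> f' t \<le> j' t" if *: "\<And>t. 0 \<le> t \<Longrightarrow> t \<le> T \<Longrightarrow> f'' t * f t \<le> - 2"
  proof -
    have "0 \<le> (\<lambda>t. j t - f t) t \<and> 0 \<le> (\<lambda>t. j' t - f' t) t"
    proof (rule second_order_nonneg[where T=T and C="q c" and q=q and d="\<lambda>t. j t - f t"
            and d'="\<lambda>t. j' t - f' t" and d''="\<lambda>t. - 2 / j t - f'' t"])
      fix t assume t: "0 \<le> t" "t \<le> T"
      show "((\<lambda>t. j t - f t) has_real_derivative j' t - f' t) (at t)"
        by (rule DERIV_diff[OF j[OF t] f[OF t]])
      show "((\<lambda>t. j' t - f' t) has_real_derivative - 2 / j t - f'' t) (at t)"
        by (rule DERIV_diff[OF j'[OF t] f'[OF t]])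
      have "f'' t \<le> - 2 / f t" using *[OF t] pos[OF t] by (simp add: field_simps)
      then show "q t * (j t - f t) \<le> - 2 / j t - f'' t" using key[OF t] by (simp add: algebra_simps)
      show "0 \<le> q t" "q t \<le> q c" using qpos c t by auto
    qed (use init j0 t in auto)
    then show ?thesis by simp
  qed
  then show "(\<And>t. 0 \<le> t \<Longrightarrow> t \<le> T \<Longrightarrow> f'' t * f t \<le> - 2) \<Longrightarrow> f t \<le> Je (1/2 + t) \<and> f' t \<le> dJ (1/2 + t)"
    by (simp add: j_def j'_def)
qed


section \<open>Polynomial bounds for J\<close>

fun hornerP :: "(int \<times> int) list \<Rightarrow> pexp \<Rightarrow> pexp" where
  "hornerP [] v = PC 0 1"
| "hornerP [(n, d)] v = PC n d"
| "hornerP ((n, d) # c # cs) v = PC n d \<oplus> v \<otimes> hornerP (c # cs) v"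

text \<open>
  Lower and upper approximations 1/2 + t (s0 + t p(t)) of J(1/2 + t), with p = \<open>pL\<close> or \<open>pU\<close>. The leading
  coefficients are those of the Taylor expansion of J for s0 \<approx> 0.207, rounded, and the last
  ones are chosen so that J'' J + 2 gets the required sign for t \<le> 4/10 and all slopes s0 within
  the bounds above. The derivatives are s0 + t p1(t) and -4 + t p2(t).
\<close>

definition pL :: "real \<Rightarrow> real" where
  "pL t = -2 + t * (2759/10000 + t * (-(1391/1000) + t * (78/100 + t * (-3 + t * (-8)))))"
definition pU :: "real \<Rightarrow> real" where
  "pU t = -2 + t * (276/1000 + t * (-(139/100) + t * (79/100 + t * (-2))))"
definition pL1 :: "real \<Rightarrow> real" where
  "pL1 t = -4 + t * (8277/10000 + t * (-(5564/1000) + t * (39/10 + t * (-18 + t * (-56)))))"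
definition pU1 :: "real \<Rightarrow> real" where
  "pU1 t = -4 + t * (828/1000 + t * (-(556/100) + t * (395/100 + t * (-12))))"
definition pL2 :: "real \<Rightarrow> real" where
  "pL2 t = 16554/10000 + t * (-(16692/1000) + t * (156/10 + t * (-90 + t * (-336))))"
definition pU2 :: "real \<Rightarrow> real" where
  "pU2 t = 1656/1000 + t * (-(1668/100) + t * (158/10 + t * (-60)))"

definition "pLP = hornerP [(-2,1), (2759,10000), (-1391,1000), (78,100), (-3,1), (-8,1)]"
definition "pUP = hornerP [(-2,1), (276,1000), (-139,100), (79,100), (-2,1)]"
definition "pL1P = hornerP [(-4,1), (8277,10000), (-5564,1000), (39,10), (-18,1), (-56,1)]"
definition "pL2P = hornerP [(16554,10000), (-16692,1000), (156,10), (-90,1), (-336,1)]"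
definition "pU2P = hornerP [(1656,1000), (-1668,100), (158,10), (-60,1)]"

lemma peval_bounds [simp]:
  "peval (pLP e) x y = pL (peval e x y)" "peval (pUP e) x y = pU (peval e x y)"
  "peval (pL1P e) x y = pL1 (peval e x y)"
  "peval (pL2P e) x y = pL2 (peval e x y)" "peval (pU2P e) x y = pU2 (peval e x y)"
  by (simp_all add: pLP_def pUP_def pL1P_def pL2P_def pU2P_def pL_def pU_def pL1_def pL2_def pU2_def)

definition JL :: "real \<Rightarrow> real" where "JL t = 1/2 + t * (s0 + t * pL t)"
definition JU :: "real \<Rightarrow> real" where "JU t = 1/2 + t * (s0 + t * pU t)"

lemma s0_box: "of_int 206970 / of_int 1000000 \<le> s0" "s0 \<le> of_int 206985 / of_int 1000000"
  using s0_bounds by simp_all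

text \<open>
  J''(1/2) = -4 is exact in the approximation, so the residual is divisible by t, and the
  cofactor is bounded away from 0 on the whole box of values of s0 and t.
\<close>

lemma JL_residual:
  assumes "0 \<le> t" "t \<le> 4/10"
  shows "0 < JL t" "(-4 + t * pL2 t) * JL t \<le> -2"
proof -
  let ?a = "PX \<oplus> PY \<otimes> pLP PY" and ?b = "pL2P PY"
  have "positive_on Leaf (206970, 206985, 1000000) (0, 4, 10) (PC 1 2 \<oplus> PY \<otimes> ?a)"
    by code_simp
  from positive_on[OF this, of s0 t] assms s0_box show "0 < JL t"
    by (simp add: JL_def)
  have "positive_on Leaf (206970, 206985, 1000000) (0, 4, 10)
      (PC 4 1 \<otimes> ?a \<ominus> PC 1 2 \<otimes> ?b \<ominus> PY \<otimes> ?a \<otimes> ?b)"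
    by code_simp
  from positive_on[OF this, of s0 t] assms s0_box
  have "0 < 4 * (s0 + t * pL t) - 1/2 * pL2 t - t * (s0 + t * pL t) * pL2 t"
    by simp
  then have "0 \<le> t * (4 * (s0 + t * pL t) - 1/2 * pL2 t - t * (s0 + t * pL t) * pL2 t)"
    using assms by simp
  then show "(-4 + t * pL2 t) * JL t \<le> -2"
    by (simp add: JL_def algebra_simps)
qed

lemma JU_residual:
  assumes "0 \<le> t" "t \<le> 4/10"
  shows "0 < JU t" "-2 \<le> (-4 + t * pU2 t) * JU t"
proof -
  let ?a = "PX \<oplus> PY \<otimes> pUP PY" and ?b = "pU2P PY"
  have "positive_on Leaf (206970, 206985, 1000000) (0, 4, 10) (PC 1 2 \<oplus> PY \<otimes> ?a)"
    by code_simp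
  from positive_on[OF this, of s0 t] assms s0_box show "0 < JU t"
    by (simp add: JU_def)
  have "positive_on (SplitY Leaf Leaf) (206970, 206985, 1000000) (0, 4, 10)
      (PC 1 2 \<otimes> ?b \<oplus> PY \<otimes> ?a \<otimes> ?b \<ominus> PC 4 1 \<otimes> ?a)"
    by code_simp
  from positive_on[OF this, of s0 t] assms s0_box
  have "0 < 1/2 * pU2 t + t * (s0 + t * pU t) * pU2 t - 4 * (s0 + t * pU t)"
    by simp
  then have "0 \<le> t * (1/2 * pU2 t + t * (s0 + t * pU t) * pU2 t - 4 * (s0 + t * pU t))"
    using assms by simp
  then show "-2 \<le> (-4 + t * pU2 t) * JU t"
    by (simp add: JU_def algebra_simps)
qed

lemma JL_deriv: "(JL has_real_derivative s0 + t * pL1 t) (at t)"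
  "((\<lambda>t. s0 + t * pL1 t) has_real_derivative -4 + t * pL2 t) (at t)"
  unfolding JL_def[abs_def] pL_def pL1_def pL2_def
  by (auto intro!: derivative_eq_intros simp: algebra_simps)

lemma JU_deriv: "(JU has_real_derivative s0 + t * pU1 t) (at t)"
  "((\<lambda>t. s0 + t * pU1 t) has_real_derivative -4 + t * pU2 t) (at t)"
  unfolding JU_def[abs_def] pU_def pU1_def pU2_def
  by (auto intro!: derivative_eq_intros simp: algebra_simps)

lemma J_bounds:
  assumes "0 \<le> t" "t \<le> 4/10"
  shows "JL t \<le> J (1/2 + t)" "J (1/2 + t) \<le> JU t" "s0 + t * pL1 t \<le> dJ (1/2 + t)"
proof -
  have J: "J (1/2 + t) = Je (1/2 + t)" using assms by (intro J_eq_Je) auto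
  have L: "JL t \<le> Je (1/2 + t) \<and> s0 + t * pL1 t \<le> dJ (1/2 + t)"
    by (rule J_comparison(2)[OF JL_deriv JL_residual(1) _ _ assms _ JL_residual(2)])
       (simp_all add: JL_def)
  have U: "Je (1/2 + t) \<le> JU t \<and> dJ (1/2 + t) \<le> s0 + t * pU1 t"
    by (rule J_comparison(1)[OF JU_deriv JU_residual(1) _ _ assms _ JU_residual(2)])
       (simp_all add: JU_def)
  show "JL t \<le> J (1/2 + t)" "J (1/2 + t) \<le> JU t" "s0 + t * pL1 t \<le> dJ (1/2 + t)"
    using L U J by auto
qed

text \<open>
  Coarser bounds with rational coefficients and low degree keep the two-variable computations below
  small.
\<close>

lemma J_ge_quadratic:
  assumes "0 \<le> t" "t \<le> 2/10"
  shows "1/2 + 2069/10000 * t - 202/100 * t\<^sup>2 \<le> J (1/2 + t)"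
proof -
  have "positive_on Leaf (0, 2, 10) (206970, 206985, 1000000)
      (PY \<ominus> PC 2069 10000 \<oplus> PX \<otimes> (pLP PX \<oplus> PC 202 100))" by code_simp
  from positive_on[OF this, of t s0] assms s0_box
  have "0 < s0 - 2069/10000 + t * (pL t + 202/100)" by simp
  then have "0 \<le> t * (s0 - 2069/10000 + t * (pL t + 202/100))" using assms by simp
  then have "1/2 + 2069/10000 * t - 202/100 * t\<^sup>2 \<le> JL t" by (simp add: JL_def algebra_simps power2_eq_square)
  then show ?thesis using J_bounds(1)[of t] assms by simp
qed

lemma J_ge_quartic:
  assumes "0 \<le> t" "t \<le> 3/10"
  shows "1/2 + 2069/10000 * t - 2 * t\<^sup>2 + 2/10 * t ^ 3 - 15/10 * t ^ 4 \<le> J (1/2 + t)"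
proof -
  have "positive_on Leaf (0, 3, 10) (206970, 206985, 1000000)
      (PY \<ominus> PC 2069 10000 \<oplus> PX \<otimes> (pLP PX \<ominus> hornerP [(-2,1), (2,10), (-15,10)] PX))" by code_simp
  from positive_on[OF this, of t s0] assms s0_box
  have "0 < s0 - 2069/10000 + t * (pL t - (-2 + t * (2/10 + t * (-(15/10)))))" by (simp add: algebra_simps)
  then have "0 \<le> t * (s0 - 2069/10000 + t * (pL t - (-2 + t * (2/10 + t * (-(15/10))))))" using assms by simp
  then have "1/2 + 2069/10000 * t - 2 * t\<^sup>2 + 2/10 * t ^ 3 - 15/10 * t ^ 4 \<le> JL t"
    by (simp add: JL_def algebra_simps eval_nat_numeral)
  then show ?thesis using J_bounds(1)[of t] assms by simp
qed

lemma J_le_cubic: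
  assumes "0 \<le> t" "t \<le> 25/100"
  shows "J (1/2 + t) \<le> 1/2 + 207/1000 * t - 2 * t\<^sup>2 + 276/1000 * t ^ 3"
proof -
  have "-(139/100) + t * (79/100 + t * (-2)) \<le> 0"
  proof -
    have "t * (79/100 + t * (-2)) \<le> 25/100 * (79/100)" using assms by (intro mult_mono) auto
    then show ?thesis by simp
  qed
  then have "t ^ 4 * (-(139/100) + t * (79/100 + t * (-2))) \<le> 0" by (intro mult_nonneg_nonpos) auto
  moreover have "t * s0 \<le> t * (207/1000)" using assms s0_bounds by (intro mult_left_mono) auto
  ultimately have "JU t \<le> 1/2 + 207/1000 * t - 2 * t\<^sup>2 + 276/1000 * t ^ 3"
    by (simp add: JU_def pU_def algebra_simps eval_nat_numeral)
  then show ?thesis using J_bounds(2)[of t] assms by simp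
qed

lemma dJ_ge_cubic:
  assumes "0 \<le> t" "t \<le> 175/1000"
  shows "2069/10000 - 4 * t + 8/10 * t\<^sup>2 - 6 * t ^ 3 \<le> dJ (1/2 + t)"
proof -
  have "positive_on Leaf (0, 175, 1000) (206970, 206985, 1000000)
      (PY \<oplus> PX \<otimes> pL1P PX \<ominus> hornerP [(2069,10000), (-4,1), (8,10), (-6,1)] PX)" by code_simp
  from positive_on[OF this, of t s0] assms s0_box
  have "0 < s0 + t * pL1 t - (2069/10000 + t * (-4 + t * (8/10 + t * (-6))))" by simp
  then show ?thesis using J_bounds(3)[of t] assms
    by (simp add: algebra_simps eval_nat_numeral)
qed

definition above_lineP :: "int \<Rightarrow> int \<Rightarrow> pexp" where
  "above_lineP n m = PC 1 2 \<oplus> PX \<otimes> (PY \<oplus> PX \<otimes> pLP PX) \<ominus> (PC n 1000 \<ominus> PC m 1000 \<otimes> PX)"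

lemma J_ge_line:
  assumes "positive_on Leaf (a, b, 100) (206970, 206985, 1000000) (above_lineP n m)"
    and "of_int a / 100 \<le> y - 1/2" "y - 1/2 \<le> of_int b / 100" "1/2 \<le> y" "y \<le> 9/10"
  shows "of_int n / 1000 - of_int m / 1000 * (y - 1/2) \<le> J y"
proof -
  from positive_on[OF assms(1) _ _ s0_box, of "y - 1/2"] assms(2,3)
  have "of_int n / 1000 - of_int m / 1000 * (y - 1/2) < JL (y - 1/2)"
    by (simp add: JL_def above_lineP_def)
  also have "\<dots> \<le> J (1/2 + (y - 1/2))" by (rule J_bounds) (use assms in auto)
  finally show ?thesis by simp
qed

lemma J_ge_chords:
  shows "7/10 \<le> y \<Longrightarrow> y \<le> 8/10 \<Longrightarrow> (631/1000) - 85/100 * (y - 1/2) \<le> J y"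
    and "8/10 \<le> y \<Longrightarrow> y \<le> 85/100 \<Longrightarrow> (772/1000) - 132/100 * (y - 1/2) \<le> J y"
    and "85/100 \<le> y \<Longrightarrow> y \<le> 9/10 \<Longrightarrow> (94/100) - 18/10 * (y - 1/2) \<le> J y"
proof -
  have "positive_on Leaf (20, 30, 100) (206970, 206985, 1000000) (above_lineP 631 850)"
    "positive_on Leaf (30, 35, 100) (206970, 206985, 1000000) (above_lineP 772 1320)"
    "positive_on Leaf (35, 40, 100) (206970, 206985, 1000000) (above_lineP 940 1800)"
    by code_simp+
  from this[THEN J_ge_line, of y]
  show "7/10 \<le> y \<Longrightarrow> y \<le> 8/10 \<Longrightarrow> (631/1000) - 85/100 * (y - 1/2) \<le> J y"
    and "8/10 \<le> y \<Longrightarrow> y \<le> 85/100 \<Longrightarrow> (772/1000) - 132/100 * (y - 1/2) \<le> J y"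
    and "85/100 \<le> y \<Longrightarrow> y \<le> 9/10 \<Longrightarrow> (94/100) - 18/10 * (y - 1/2) \<le> J y"
    by simp_all
qed

lemma J_nonneg: "1/2 \<le> x \<Longrightarrow> x \<le> 1 \<Longrightarrow> 0 \<le> J x"
  using solves_J_J unfolding solves_J_def by auto

lemma continuous_J: "continuous_on {1/2..1} J"
  using solves_J_J unfolding solves_J_def by auto

text \<open>
  J vanishes at 1 and lies above the line at 9/10; a concave function lies above its chords. If the
  minimum of the difference were negative, the difference would be stationary there and
  decrease from there on to the value 0 at 1.
\<close>

lemma J_ge_end:
  assumes "9/10 \<le> y" "y \<le> 1"
  shows "22/10 * (1 - y) \<le> J y"
proof -
  define g where "g = (\<lambda>y. J y - 22/10 * (1 - y))"
  have cont: "continuous_on {0.9..1} g"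
    unfolding g_def by (intro continuous_intros continuous_on_subset[OF continuous_J]) auto
  then obtain m where m: "m \<in> {0.9..1}" "\<And>v. v \<in> {0.9..1} \<Longrightarrow> g m \<le> g v"
    using continuous_attains_inf[of "{0.9..1::real}" g] by auto
  have "0 \<le> g m"
  proof (rule ccontr)
    assume neg: "\<not> 0 \<le> g m"
    have "g 1 = 0" by (simp add: g_def J_1)
    have "0 \<le> g (9/10)" using J_ge_chords(3)[of "9/10"] by (simp add: g_def)
    have "m \<noteq> (9/10)" using neg \<open>0 \<le> g (9/10)\<close> by metis
    moreover have "m \<noteq> 1" using neg \<open>g 1 = 0\<close> by auto
    ultimately have im: "9/10 < m" "m < 1" using m(1) by (auto simp: less_le)
    have Dg: "(g has_real_derivative dJ v + 22/10) (at v)" if "9/10 < v" "v < 1" for v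
    proof -
      have "((\<lambda>y. Je y - 22/10 * (1 - y)) has_real_derivative dJ v + 22/10) (at v)"
        using that by (auto intro!: derivative_eq_intros Je_deriv)
      then show ?thesis
        by (rule has_field_derivative_transform_within_open[where S="{(9/10)<..<1}"])
           (use that in \<open>auto simp: g_def J_eq_Je\<close>)
    qed
    have "dJ m + 22/10 = 0"
    proof (rule DERIV_local_min[OF Dg[OF im]])
      show "0 < min (m - 9/10) (1 - m)" using im by simp
      show "\<forall>y. \<bar>m - y\<bar> < min (m - 9/10) (1 - m) \<longrightarrow> g m \<le> g y"
        using m(2) by (auto simp: abs_if split: if_splits)
    qed
    have "g 1 \<le> g m"
    proof (rule DERIV_nonpos_imp_decreasing_open[where a=m and b=1 and f=g])
      show "m \<le> 1" using im by simp
      show "continuous_on {m..1} g" by (rule continuous_on_subset[OF cont]) (use im in auto)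
      fix v assume v: "m < v" "v < 1"
      have "dJ v \<le> dJ m"
        by (rule dJ_antimono) (use v im in auto)
      then show "\<exists>y. (g has_real_derivative y) (at v) \<and> y \<le> 0"
        using Dg[of v] v im \<open>dJ m + 22/10 = 0\<close> by (intro exI[of _ "dJ v + 22/10"] conjI) auto
    qed
    then show False using neg \<open>g 1 = 0\<close> by simp
  qed
  then have "0 \<le> g y" using m(2)[of y] assms by auto
  then show ?thesis by (simp add: g_def)
qed

text \<open>
  The constant and the linear terms of the two sides agree, so t^2 splits off after J has been replaced
  by its bounds.
\<close>

lemma J_two_point_at_half_quotient:
  fixes t lam :: real
  assumes "0 \<le> t" "t \<le> 4/10"
    and "0 < lam + (pL t - 1/2 * pU (t / 2)) * (1 + 2 * s0 * t + t\<^sup>2 * (pL t + 1/2 * pU (t / 2)))"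
  shows "(2 * J (1/2 + t / 2) - 1/2)\<^sup>2 \<le> lam * t\<^sup>2 + (J (1/2 + t))\<^sup>2"
proof -
  have L: "0 \<le> JL t" "JL t \<le> J (1/2 + t)"
    using JL_residual(1)[of t] J_bounds(1)[of t] assms(1,2) by auto
  have "JL (t / 2) \<le> J (1/2 + t / 2)" "J (1/2 + t / 2) \<le> JU (t / 2)"
    using J_bounds(1,2)[of "t / 2"] assms(1,2) by auto
  moreover have "1/4 \<le> JL (t / 2)"
  proof -
    have "positive_on Leaf (0, 2, 10) (206970, 206985, 1000000)
      (PC 1 4 \<oplus> PX \<otimes> (PY \<oplus> PX \<otimes> pLP PX))" by code_simp
    from positive_on[OF this, of "t / 2" s0] assms s0_box show ?thesis by (simp add: JL_def)
  qed
  ultimately have "(2 * J (1/2 + t / 2) - 1/2)\<^sup>2 \<le> (2 * JU (t / 2) - 1/2)\<^sup>2"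
    by (intro power_mono) auto
  moreover have "(JL t)\<^sup>2 \<le> (J (1/2 + t))\<^sup>2" using L by (intro power_mono) auto
  moreover have "lam * t\<^sup>2 + (JL t)\<^sup>2 - (2 * JU (t / 2) - 1/2)\<^sup>2
      = t\<^sup>2 * (lam + (pL t - 1/2 * pU (t / 2)) * (1 + 2 * s0 * t + t\<^sup>2 * (pL t + 1/2 * pU (t / 2))))"
    by (simp add: JL_def JU_def power2_eq_square field_simps)
  ultimately show ?thesis using assms(3) by (smt (verit) mult_nonneg_nonneg zero_le_power2)
qed

definition at_half_quotientP :: "pexp \<Rightarrow> pexp" where
  "at_half_quotientP l = (let h = PC 1 2 \<otimes> PX in l \<oplus> (pLP PX \<ominus> PC 1 2 \<otimes> pUP h) \<otimes>
     (PC 1 1 \<oplus> PC 2 1 \<otimes> PY \<otimes> PX \<oplus> PX \<up> 2 \<otimes> (pLP PX \<oplus> PC 1 2 \<otimes> pUP h)))"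

lemma J_two_point_at_half_checked:
  assumes "positive_on tr (a, b, c) (206970, 206985, 1000000) (at_half_quotientP l)"
    and "of_int a / of_int c \<le> t" "t \<le> of_int b / of_int c" "0 \<le> t" "t \<le> 4/10"
    and "peval l t s0 \<le> lam"
  shows "(2 * J (1/2 + t / 2) - 1/2)\<^sup>2 \<le> lam * t\<^sup>2 + (J (1/2 + t))\<^sup>2"
proof (rule J_two_point_at_half_quotient[OF assms(4,5)])
  show "0 < lam + (pL t - 1/2 * pU (t / 2)) * (1 + 2 * s0 * t + t\<^sup>2 * (pL t + 1/2 * pU (t / 2)))"
    using positive_on[OF assms(1-3) s0_box] assms(6) by (simp add: at_half_quotientP_def Let_def)
qed

text \<open>
  The left side exceeds t^2 + J(1/2 + t)^2 by s0 t^3 up to higher order, so \<open>lam\<close> must exceed 1 for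
  small t. The first part suits \<open>lam\<close> = 1 / c^2 with c = 0.997, the next two suit the gain of the
  norm with exponent 1 / 0.50057 (lemma \<open>lp_norm_gain\<close>). From t = 2/10 on, the Euclidean norm
  suffices.
\<close>

lemma J_two_point_at_half:
  shows "0 \<le> t \<Longrightarrow> t \<le> 2/10 \<Longrightarrow> (100602/100000) \<le> lam \<Longrightarrow>
      (2 * J (1/2 + t / 2) - 1/2)\<^sup>2 \<le> lam * t\<^sup>2 + (J (1/2 + t))\<^sup>2"
    and "0 \<le> t \<Longrightarrow> t \<le> 1/10 \<Longrightarrow> (100114/100000) * (1 + 2277/1000000 * (3 - 147784/10000 * t)) \<le> lam \<Longrightarrow>
      (2 * J (1/2 + t / 2) - 1/2)\<^sup>2 \<le> lam * t\<^sup>2 + (J (1/2 + t))\<^sup>2"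
    and "1/10 \<le> t \<Longrightarrow> t \<le> 2/10 \<Longrightarrow> (100114/100000) * (1 + 2277/1000000 * (3 - 160633/10000 * t)) \<le> lam \<Longrightarrow>
      (2 * J (1/2 + t / 2) - 1/2)\<^sup>2 \<le> lam * t\<^sup>2 + (J (1/2 + t))\<^sup>2"
    and "2/10 \<le> t \<Longrightarrow> t \<le> 1/2 \<Longrightarrow> 1 \<le> lam \<Longrightarrow>
      (2 * J (1/2 + t / 2) - 1/2)\<^sup>2 \<le> lam * t\<^sup>2 + (J (1/2 + t))\<^sup>2"
proof -
  let ?X = SplitX and ?L = Leaf
  have 1: "positive_on (?X (?X (?X ?L (?X ?L (?X ?L ?L))) (?X (?X (?X ?L ?L) ?L) ?L)) ?L)
     (0, 2, 10) (206970, 206985, 1000000) (at_half_quotientP (PC 100602 100000))" by code_simp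
  have 2: "positive_on (?X (?X ?L (?X ?L ?L)) (?X (?X (?X ?L ?L) (?X (?X ?L ?L) ?L)) ?L))
     (0, 1, 10) (206970, 206985, 1000000)
     (at_half_quotientP (PC 100114 100000 \<otimes> (PC 1 1 \<oplus> PC 2277 1000000 \<otimes> (PC 3 1 \<ominus> PC 147784 10000 \<otimes> PX))))"
    by code_simp
  have 3: "positive_on ?L (1, 2, 10) (206970, 206985, 1000000)
     (at_half_quotientP (PC 100114 100000 \<otimes> (PC 1 1 \<oplus> PC 2277 1000000 \<otimes> (PC 3 1 \<ominus> PC 160633 10000 \<otimes> PX))))"
    by code_simp
  have 4: "positive_on ?L (2, 4, 10) (206970, 206985, 1000000) (at_half_quotientP (PC 1 1))" by code_simp
  show "0 \<le> t \<Longrightarrow> t \<le> 2/10 \<Longrightarrow> (100602/100000) \<le> lam \<Longrightarrow>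
      (2 * J (1/2 + t / 2) - 1/2)\<^sup>2 \<le> lam * t\<^sup>2 + (J (1/2 + t))\<^sup>2"
    using J_two_point_at_half_checked[OF 1, of t lam] by simp
  show "0 \<le> t \<Longrightarrow> t \<le> 1/10 \<Longrightarrow> (100114/100000) * (1 + 2277/1000000 * (3 - 147784/10000 * t)) \<le> lam \<Longrightarrow>
      (2 * J (1/2 + t / 2) - 1/2)\<^sup>2 \<le> lam * t\<^sup>2 + (J (1/2 + t))\<^sup>2"
    using J_two_point_at_half_checked[OF 2, of t lam] by simp
  show "1/10 \<le> t \<Longrightarrow> t \<le> 2/10 \<Longrightarrow> (100114/100000) * (1 + 2277/1000000 * (3 - 160633/10000 * t)) \<le> lam \<Longrightarrow>
      (2 * J (1/2 + t / 2) - 1/2)\<^sup>2 \<le> lam * t\<^sup>2 + (J (1/2 + t))\<^sup>2"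
    using J_two_point_at_half_checked[OF 3, of t lam] by simp
  show "(2 * J (1/2 + t / 2) - 1/2)\<^sup>2 \<le> lam * t\<^sup>2 + (J (1/2 + t))\<^sup>2"
    if t: "2/10 \<le> t" "t \<le> 1/2" "1 \<le> lam"
  proof (cases "t \<le> 4/10")
    case True
    then show ?thesis using J_two_point_at_half_checked[OF 4, of t lam] t by simp
  next
    case False
    have J1: "22/10 * (1/2 - t) \<le> J (1/2 + t)" using J_ge_end[of "1/2 + t"] False t by (simp add: algebra_simps)
    have "J (1/2 + t / 2) \<le> 1/2 + 207/1000 * (t / 2) - 2 * (t / 2)\<^sup>2 + 276/1000 * (t / 2) ^ 3"
      by (rule J_le_cubic) (use t in auto)
    moreover have "positive_on ?L (4, 5, 10) (0, 1, 1) (PX \<up> 2 \<oplus> (PC 22 10 \<otimes> (PC 1 2 \<ominus> PX)) \<up> 2 \<ominus>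
        (PC 1 2 \<oplus> PC 207 1000 \<otimes> PX \<ominus> PX \<up> 2 \<oplus> PC 69 1000 \<otimes> PX \<up> 3) \<up> 2)" by code_simp
    from positive_on[OF this, of t 0] False t
    have "(1/2 + 207/1000 * t - t\<^sup>2 + 69/1000 * t ^ 3)\<^sup>2 < t\<^sup>2 + (22/10 * (1/2 - t))\<^sup>2" by simp
    moreover have "1/4 \<le> J (1/2 + t / 2)"
    proof -
      have "positive_on Leaf (2, 25, 100) (206970, 206985, 1000000)
        (PC 1 4 \<oplus> PX \<otimes> (PY \<oplus> PX \<otimes> pLP PX))" by code_simp
      from positive_on[OF this, of "t / 2" s0] False t s0_box have "1/4 \<le> JL (t / 2)" by (simp add: JL_def)
      then show ?thesis using J_bounds(1)[of "t / 2"] t by simp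
    qed
    ultimately have "(2 * J (1/2 + t / 2) - 1/2)\<^sup>2 \<le> (1/2 + 207/1000 * t - t\<^sup>2 + 69/1000 * t ^ 3)\<^sup>2"
      by (intro power_mono) (auto simp: power_divide)
    also have "\<dots> \<le> t\<^sup>2 + (22/10 * (1/2 - t))\<^sup>2"
      using \<open>(1/2 + 207/1000 * t - t\<^sup>2 + 69/1000 * t ^ 3)\<^sup>2 < t\<^sup>2 + (22/10 * (1/2 - t))\<^sup>2\<close> by simp
    also have "\<dots> \<le> lam * t\<^sup>2 + (J (1/2 + t))\<^sup>2"
      using J1 t by (intro add_mono power_mono mult_right_mono[of 1 lam "t\<^sup>2", simplified]) auto
    finally show ?thesis .
  qed
qed


section \<open>The pieces L and Q\<close>

lemma nondecreasing_from_0: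
  fixes f f' :: "real \<Rightarrow> real"
  assumes "0 \<le> x" "\<And>v. 0 \<le> v \<Longrightarrow> v \<le> x \<Longrightarrow> (f has_real_derivative f' v) (at v)"
    and "\<And>v. 0 \<le> v \<Longrightarrow> v \<le> x \<Longrightarrow> 0 \<le> f' v"
  shows "f 0 \<le> f x"
  using DERIV_nonneg_imp_nondecreasing[OF assms(1), of f] assms(2,3) by blast

text \<open>
  ln 2 = ln (1 + z) - ln (1 - z) for z = 1/3, and the derivative 2 / (1 - z^2) of the right side lies
  between truncations of the geometric series.
\<close>

lemma ln2_bounds: "6931/10000 < ln (2::real)" "ln (2::real) < 69316/100000"
proof -
  have ln2: "ln 2 = ln (1 + 1/3) - ln (1 - 1/3 :: real)"
    using ln_div[of "4/3" "2/3 :: real"] by simp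
  let ?l = "\<lambda>z::real. 2 * (z + z ^ 3 / 3 + z ^ 5 / 5 + z ^ 7 / 7)"
  let ?u = "\<lambda>z::real. 2 * (z + z ^ 3 / 3 + z ^ 5 / 5 + 9 / 8 * z ^ 7 / 7)"
  have D: "((\<lambda>z. ln (1 + z) - ln (1 - z)) has_real_derivative 2 / (1 - v\<^sup>2)) (at v)"
    if "0 \<le> v" "v \<le> 1/3" for v :: real
  proof -
    have "1 / (1 + v) + 1 / (1 - v) = 2 / (1 - v\<^sup>2)"
      using that by (simp add: field_simps power2_eq_square)
    then show ?thesis
      using that by (auto intro!: derivative_eq_intros simp: inverse_eq_divide)
  qed
  have sq: "0 < 1 - v\<^sup>2" "v\<^sup>2 \<le> 1/9" if "0 \<le> v" "v \<le> 1/3" for v :: real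
  proof -
    have "v\<^sup>2 \<le> (1/3)\<^sup>2" using that by (intro power_mono)
    then show "0 < 1 - v\<^sup>2" "v\<^sup>2 \<le> 1/9" by (simp_all add: power2_eq_square)
  qed
  have "(\<lambda>z. ln (1 + z) - ln (1 - z) - ?l z) 0 \<le> (\<lambda>z. ln (1 + z) - ln (1 - z) - ?l z) (1/3)"
  proof (rule nondecreasing_from_0)
    fix v :: real assume v: "0 \<le> v" "v \<le> 1/3"
    show "((\<lambda>z. ln (1 + z) - ln (1 - z) - ?l z) has_real_derivative
        2 / (1 - v\<^sup>2) - 2 * (1 + v\<^sup>2 + v ^ 4 + v ^ 6)) (at v)"
      by (rule DERIV_diff[OF D[OF v]]) (auto intro!: derivative_eq_intros)
    have "(1 + v\<^sup>2 + v ^ 4 + v ^ 6) * (1 - v\<^sup>2) = 1 - v ^ 8"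
      by (simp add: algebra_simps eval_nat_numeral)
    then have "(1 + v\<^sup>2 + v ^ 4 + v ^ 6) * (1 - v\<^sup>2) \<le> 1" by simp
    then have "1 + v\<^sup>2 + v ^ 4 + v ^ 6 \<le> 1 / (1 - v\<^sup>2)" using sq(1)[OF v] by (simp add: pos_le_divide_eq)
    then show "0 \<le> 2 / (1 - v\<^sup>2) - 2 * (1 + v\<^sup>2 + v ^ 4 + v ^ 6)" by simp
  qed simp
  then show "6931/10000 < ln (2::real)" unfolding ln2 by (simp add: eval_nat_numeral)
  have "(\<lambda>z. ?u z - (ln (1 + z) - ln (1 - z))) 0 \<le> (\<lambda>z. ?u z - (ln (1 + z) - ln (1 - z))) (1/3)"
  proof (rule nondecreasing_from_0)
    fix v :: real assume v: "0 \<le> v" "v \<le> 1/3"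
    show "((\<lambda>z. ?u z - (ln (1 + z) - ln (1 - z))) has_real_derivative
        2 * (1 + v\<^sup>2 + v ^ 4 + 9 / 8 * v ^ 6) - 2 / (1 - v\<^sup>2)) (at v)"
      by (rule DERIV_diff[OF _ D[OF v]]) (auto intro!: derivative_eq_intros)
    have "(1 + v\<^sup>2 + v ^ 4 + 9 / 8 * v ^ 6) * (1 - v\<^sup>2) = 1 + v ^ 6 * (9 / 8 * (1 - v\<^sup>2) - 1)"
      by (simp add: algebra_simps eval_nat_numeral)
    moreover have "0 \<le> v ^ 6 * (9 / 8 * (1 - v\<^sup>2) - 1)"
      using sq(2)[OF v] by (intro mult_nonneg_nonneg) auto
    ultimately have "1 \<le> (1 + v\<^sup>2 + v ^ 4 + 9 / 8 * v ^ 6) * (1 - v\<^sup>2)" by simp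
    then have "1 / (1 - v\<^sup>2) \<le> 1 + v\<^sup>2 + v ^ 4 + 9 / 8 * v ^ 6" using sq(1)[OF v] by (simp add: pos_divide_le_eq)
    then show "0 \<le> 2 * (1 + v\<^sup>2 + v ^ 4 + 9 / 8 * v ^ 6) - 2 / (1 - v\<^sup>2)" by simp
  qed simp
  then show "ln (2::real) < 69316/100000" unfolding ln2 by (simp add: eval_nat_numeral)
qed

definition ell :: "real \<Rightarrow> real" where "ell x = log 2 (1 / x)"

lemma ell_eq: "0 < x \<Longrightarrow> ell x = - ln x / ln 2"
  by (simp add: ell_def log_def ln_div)

lemma ell_antimono: "0 < x \<Longrightarrow> x \<le> y \<Longrightarrow> ell y \<le> ell x"
  by (simp add: ell_def frac_le)

lemma ell_values: "ell (1/2) = 1" "ell (1/4) = 2" "ell (1/8) = 3" "ell (1/16) = 4"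
  using log_pow_cancel[of 2 2] log_pow_cancel[of 2 3] log_pow_cancel[of 2 4]
  by (simp_all add: ell_def)

lemma L_beta_ell: "0 < x \<Longrightarrow> L_beta \<beta> x = x * ell x powr \<beta>"
  by (simp add: L_beta_def ell_def)

lemma ell_deriv: "0 < x \<Longrightarrow> (ell has_real_derivative - 1 / (x * ln 2)) (at x)"
proof -
  assume x: "0 < x"
  have "((\<lambda>x. - ln x / ln 2) has_real_derivative - 1 / (x * ln 2)) (at x)"
    using x by (auto intro!: derivative_eq_intros simp: field_simps)
  then show ?thesis
    by (rule has_field_derivative_transform_within_open[where S="{0<..}"]) (use x ell_eq in auto)
qed

lemma ell_powr_deriv:
  assumes "0 < x" "x \<le> 1/2"
  shows "((\<lambda>x. ell x powr \<beta>) has_real_derivative - \<beta> * ell x powr (\<beta> - 1) / (x * ln 2)) (at x)"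
proof -
  have "1 \<le> ell x" using ell_antimono[OF assms] ell_values(1) by simp
  then have "((\<lambda>x. ell x powr \<beta>) has_real_derivative \<beta> * ell x powr (\<beta> - 1) * (- 1 / (x * ln 2))) (at x)"
    using DERIV_chain2[OF has_real_derivative_powr ell_deriv[OF assms(1)]] by simp
  then show ?thesis by simp
qed

text \<open>
  The second derivative has the sign of ell x * ln 2 - (1 - \<beta>), and ell x \<ge> 1 for x \<le> 1/2.
\<close>

lemma ell_powr_convex:
  assumes "1/2 \<le> \<beta>"
  shows "convex_on {0<..1/2} (\<lambda>x. ell x powr \<beta>)"
proof (rule f''_ge0_imp_convex)
  fix x :: real assume "x \<in> {0<..1/2}"
  then have x: "0 < x" "x \<le> 1/2" by auto
  show "((\<lambda>x. ell x powr \<beta>) has_real_derivative - \<beta> * ell x powr (\<beta> - 1) / (x * ln 2)) (at x)"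
    by (rule ell_powr_deriv[OF x])
  have e1: "1 \<le> ell x" using ell_antimono[OF x] ell_values(1) by simp
  have "((\<lambda>x. - \<beta> * ell x powr (\<beta> - 1) / (x * ln 2)) has_real_derivative
     (- \<beta> * ((\<beta> - 1) * ell x powr (\<beta> - 1 - 1) * (- 1 / (x * ln 2))) * (x * ln 2)
       - (- \<beta> * ell x powr (\<beta> - 1)) * (1 * ln 2)) / ((x * ln 2) * (x * ln 2))) (at x)"
    using e1 x
    by (intro DERIV_divide DERIV_cmult DERIV_cmult_right DERIV_ident
        DERIV_chain2[OF has_real_derivative_powr ell_deriv[OF x(1)]]) auto
  then show "((\<lambda>x. - \<beta> * ell x powr (\<beta> - 1) / (x * ln 2)) has_real_derivative
     \<beta> * ell x powr (\<beta> - 2) * (ell x * ln 2 - (1 - \<beta>)) / (x * ln 2)\<^sup>2) (at x)"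
  proof -
    have p: "ell x powr (\<beta> - 1) = ell x powr (\<beta> - 2) * ell x"
      using e1 powr_add[of "ell x" "\<beta> - 2" 1] by simp
    have "(- \<beta> * ((\<beta> - 1) * ell x powr (\<beta> - 1 - 1) * (- 1 / (x * ln 2))) * (x * ln 2)
       - (- \<beta> * ell x powr (\<beta> - 1)) * (1 * ln 2)) / ((x * ln 2) * (x * ln 2))
      = \<beta> * ell x powr (\<beta> - 2) * (ell x * ln 2 - (1 - \<beta>)) / (x * ln 2)\<^sup>2"
      unfolding p using x by (simp add: power2_eq_square) (simp add: algebra_simps)
    with \<open>((\<lambda>x. - \<beta> * ell x powr (\<beta> - 1) / (x * ln 2)) has_real_derivative
     (- \<beta> * ((\<beta> - 1) * ell x powr (\<beta> - 1 - 1) * (- 1 / (x * ln 2))) * (x * ln 2)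
       - (- \<beta> * ell x powr (\<beta> - 1)) * (1 * ln 2)) / ((x * ln 2) * (x * ln 2))) (at x)\<close>
    show ?thesis by simp
  qed
  have "1 * (6931/10000) \<le> ell x * ln 2" using e1 ln2_bounds by (intro mult_mono) auto
  then have "0 \<le> ell x * ln 2 - (1 - \<beta>)" using assms by simp
  then show "0 \<le> \<beta> * ell x powr (\<beta> - 2) * (ell x * ln 2 - (1 - \<beta>)) / (x * ln 2)\<^sup>2"
    using assms by simp
qed simp

lemma ell_powr_ge_tangent:
  assumes "1/2 \<le> \<beta>" "0 < x" "x \<le> 1/2" "0 < a" "a < 1/2"
  shows "ell a powr \<beta> - \<beta> * ell a powr (\<beta> - 1) / (a * ln 2) * (x - a) \<le> ell x powr \<beta>"
proof -
  have "- \<beta> * ell a powr (\<beta> - 1) / (a * ln 2) * (x - a) \<le> ell x powr \<beta> - ell a powr \<beta>"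
  proof (rule convex_on_imp_above_tangent[OF ell_powr_convex[OF assms(1)]])
    have "a \<in> {0<..<1/2}" "open {0<..<1/2::real}" "{0<..<1/2} \<subseteq> {0<..1/2::real}" using assms by auto
    then show "a \<in> interior {0<..1/2}" by (meson interiorI)
    show "((\<lambda>x. ell x powr \<beta>) has_real_derivative - \<beta> * ell a powr (\<beta> - 1) / (a * ln 2))
        (at a within {0<..1/2})"
      using ell_powr_deriv[of a \<beta>] assms by (auto intro: has_field_derivative_at_within)
  qed (use assms in auto)
  then show ?thesis by simp
qed

lemma sqrt_ell_ge_tangent:
  assumes "0 < x" "x \<le> 1/2" "0 < a" "a < 1/2"
  shows "sqrt (ell a) + 1 / (2 * sqrt (ell a) * a * ln 2) * (a - x) \<le> sqrt (ell x)"
proof -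
  have e: "1 \<le> ell a" using ell_antimono[of a "1/2"] ell_values(1) assms by simp
  have e': "1 \<le> ell x" using ell_antimono[of x "1/2"] ell_values(1) assms by simp
  have p: "ell a powr (1/2 - 1) = 1 / sqrt (ell a)"
    using e powr_minus[of "ell a" "1/2"] by (simp add: powr_half_sqrt inverse_eq_divide)
  have "ell a powr (1/2) - 1/2 * ell a powr (1/2 - 1) / (a * ln 2) * (x - a) \<le> ell x powr (1/2)"
    by (rule ell_powr_ge_tangent) (use assms in auto)
  then have "sqrt (ell a) - 1 / (2 * sqrt (ell a) * a * ln 2) * (x - a) \<le> sqrt (ell x)"
    unfolding p using e e' by (simp add: powr_half_sqrt)
  then show ?thesis unfolding right_diff_distrib by linarith
qed

lemma L_beta_ge_half:
  assumes "1/2 \<le> \<beta>" "0 < x" "x \<le> 1/2"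
  shows "x * sqrt (ell x) \<le> L_beta \<beta> x"
proof -
  have e: "1 \<le> ell x" using ell_antimono[OF assms(2,3)] ell_values(1) by simp
  have "sqrt (ell x) = ell x powr (1/2)" using e by (simp add: powr_half_sqrt)
  also have "\<dots> \<le> ell x powr \<beta>" using e assms by (intro powr_mono) auto
  finally show ?thesis using assms by (simp add: L_beta_ell)
qed

lemma sqrt3_bounds: "173205/100000 < sqrt 3" "sqrt 3 < 173206/100000"
proof -
  show "173205/100000 < sqrt 3" by (rule real_less_rsqrt) (simp add: power2_eq_square)
  show "sqrt 3 < 173206/100000" by (rule real_less_lsqrt) (simp_all add: power2_eq_square)
qed

text \<open>
  L(x) / x is at least sqrt (ell x), a convex function; its tangents at 1/16, 1/8 and 1/4, with
  rounded coefficients, are the second factors.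
\<close>

lemma L_beta_ge_quadratic:
  assumes \<beta>: "1/2 \<le> \<beta>" and x: "0 < x"
  shows "x \<le> 1/16 \<Longrightarrow> x * (2 + 577/100 * (1/16 - x)) \<le> L_beta \<beta> x"
    and "x \<le> 1/8 \<Longrightarrow> x * (1732/1000 + 333/100 * (1/8 - x)) \<le> L_beta \<beta> x"
    and "1/8 \<le> x \<Longrightarrow> x \<le> 1/4 \<Longrightarrow> x * (1732/1000 - 3332/1000 * (x - 1/8)) \<le> L_beta \<beta> x"
    and "x \<le> 1/4 \<Longrightarrow> x * (14142/10000 + 204/100 * (1/4 - x)) \<le> L_beta \<beta> x"
proof -
  have L: "x * c \<le> L_beta \<beta> x" if "c \<le> sqrt (ell x)" "x \<le> 1/2" for c
  proof -
    have "x * c \<le> x * sqrt (ell x)" using that x by (intro mult_left_mono) auto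
    also have "\<dots> \<le> L_beta \<beta> x" by (rule L_beta_ge_half[OF \<beta> x that(2)])
    finally show ?thesis .
  qed
  have ln2: "6931/10000 < ln (2::real)" "ln (2::real) < 69316/100000" by (rule ln2_bounds)+
  have slope: "k * c \<le> k * d" if "0 \<le> k" "c \<le> d" for k c d :: real using that by (rule mult_left_mono[rotated])
  show "x * (2 + 577/100 * (1/16 - x)) \<le> L_beta \<beta> x" if "x \<le> 1/16"
  proof (rule L)
    have "sqrt (ell (1/16)) = 2" by (simp add: ell_values real_sqrt_unique)
    then have "2 + 4 / ln 2 * (1/16 - x) \<le> sqrt (ell x)"
      using sqrt_ell_ge_tangent[of x "1/16"] that x by (simp add: field_simps)
    moreover have "577/100 * (1/16 - x) \<le> 4 / ln 2 * (1/16 - x)"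
      using that ln2 by (intro mult_right_mono) (auto simp: field_simps)
    ultimately show "2 + 577/100 * (1/16 - x) \<le> sqrt (ell x)" by linarith
  qed (use that in auto)
  define k3 where "k3 = 4 / (sqrt 3 * ln 2)"
  have t8: "sqrt 3 + k3 * (1/8 - x) \<le> sqrt (ell x)" if "x \<le> 1/4"
    using sqrt_ell_ge_tangent[of x "1/8"] that x by (simp add: ell_values k3_def)
  have s3: "1200481/1000000 \<le> sqrt 3 * ln 2" "sqrt 3 * ln 2 \<le> 12007/10000"
  proof -
    have "173205/100000 * (6931/10000) \<le> sqrt 3 * ln 2" "sqrt 3 * ln 2 \<le> 173206/100000 * (69316/100000)"
      using sqrt3_bounds ln2 by (intro mult_mono; simp)+
    then show "1200481/1000000 \<le> sqrt 3 * ln 2" "sqrt 3 * ln 2 \<le> 12007/10000" by simp_all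
  qed
  have q3: "333/100 \<le> k3" "k3 \<le> 3332/1000"
    using s3 by (simp_all add: k3_def pos_le_divide_eq pos_divide_le_eq)
  show "x * (1732/1000 + 333/100 * (1/8 - x)) \<le> L_beta \<beta> x" if "x \<le> 1/8"
  proof (rule L)
    have "333/100 * (1/8 - x) \<le> k3 * (1/8 - x)"
      using that q3 by (intro mult_right_mono) auto
    moreover have "x \<le> 1/4" using that by simp
    note t8[OF this]
    ultimately show "1732/1000 + 333/100 * (1/8 - x) \<le> sqrt (ell x)" using sqrt3_bounds by linarith
  qed (use that in auto)
  show "x * (1732/1000 - 3332/1000 * (x - 1/8)) \<le> L_beta \<beta> x" if "1/8 \<le> x" "x \<le> 1/4"
  proof (rule L)
    have "k3 * (x - 1/8) \<le> 3332/1000 * (x - 1/8)"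
      using that q3 by (intro mult_right_mono) auto
    then show "1732/1000 - 3332/1000 * (x - 1/8) \<le> sqrt (ell x)"
      using t8[OF that(2)] sqrt3_bounds unfolding right_diff_distrib by linarith
  qed (use that in auto)
  show "x * (14142/10000 + 204/100 * (1/4 - x)) \<le> L_beta \<beta> x" if "x \<le> 1/4"
  proof (rule L)
    have "sqrt 2 + 2 / (sqrt 2 * ln 2) * (1/4 - x) \<le> sqrt (ell x)"
      using sqrt_ell_ge_tangent[of x "1/4"] that x by (simp add: ell_values)
    moreover have "204/100 * (1/4 - x) \<le> 2 / (sqrt 2 * ln 2) * (1/4 - x)"
    proof (rule mult_right_mono)
      have "sqrt 2 * ln 2 \<le> 141422/100000 * (69316/100000)"
        using sqrt2_bounds ln2 by (intro mult_mono) auto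
      then show "204/100 \<le> 2 / (sqrt 2 * ln 2)" using ln2 by (simp add: pos_le_divide_eq)
    qed (use that in auto)
    ultimately show "14142/10000 + 204/100 * (1/4 - x) \<le> sqrt (ell x)" using sqrt2_bounds by linarith
  qed (use that in auto)
qed

subsection \<open>Comparing L and Q\<close>

text \<open>
  Q in terms of the distance n of its argument from 1/2. The parameter e = 3 - 2 * 2^\<beta>, which is
  about 0.171 here, enters linearly.
\<close>

definition Qn :: "real \<Rightarrow> real \<Rightarrow> real" where
  "Qn e n = 1/2 - 2/3 * e * n - 2 * n\<^sup>2 + 8/3 * e * n ^ 3"

lemma Q_beta_Qn: "Q_beta \<beta> x = Qn (3 - 2 * 2 powr \<beta>) (1/2 - x)"
proof -
  have "2 powr (\<beta> + 2) = 4 * 2 powr \<beta>" "2 powr (\<beta> + 1) = 2 * 2 powr \<beta>"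
    by (simp_all add: powr_add)
  then show ?thesis
    unfolding Q_beta_def Qn_def by (simp add: field_simps power2_eq_square power3_eq_cube)
qed

lemma theta_bounds:
  assumes "1/2 \<le> \<beta>" "\<beta> \<le> 50057/100000"
  shows "sqrt 2 \<le> 2 powr \<beta>" "14142/10000 \<le> 2 powr \<beta>" "2 powr \<beta> \<le> 14148/10000"
proof -
  have "2 powr (1/2) \<le> (2::real) powr \<beta>" using assms by (intro powr_mono) auto
  then show *: "sqrt 2 \<le> 2 powr \<beta>" by (simp add: powr_half_sqrt)
  have "14142/10000 \<le> sqrt 2" using sqrt2_bounds by simp
  with * show "14142/10000 \<le> 2 powr \<beta>" by linarith
  have "2 powr \<beta> \<le> (2::real) powr (1/2 + 57/100000)" using assms by (intro powr_mono) auto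
  also have "\<dots> = sqrt 2 * exp (57/100000 * ln 2)"
  proof -
    have "(2::real) powr (57/100000) = exp (57/100000 * ln 2)" by (simp add: powr_def)
    then show ?thesis unfolding powr_add by (simp add: powr_half_sqrt)
  qed
  also have "\<dots> \<le> sqrt 2 * (1 + 4/10000 + (4/10000)\<^sup>2)"
  proof (rule mult_left_mono)
    have "exp (57/100000 * ln 2) \<le> exp (4/10000 :: real)" using ln2_bounds by simp
    also have "\<dots> \<le> 1 + 4/10000 + (4/10000)\<^sup>2" by (rule exp_bound) auto
    finally show "exp (57/100000 * ln 2) \<le> (1 + 4/10000 + (4/10000)\<^sup>2 :: real)" .
  qed simp
  also have "\<dots> \<le> 141422/100000 * (1 + 4/10000 + (4/10000)\<^sup>2)"
    using sqrt2_bounds by (intro mult_right_mono) (auto simp: power2_eq_square)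
  also have "\<dots> \<le> 14148/10000" by (simp add: power2_eq_square)
  finally show "2 powr \<beta> \<le> 14148/10000" .
qed

text \<open>
  Two forms of Q(x) / x: the expansion at 1/4, and the chord over [1/4, 1/2] plus a nonnegative
  term.
\<close>

lemma Q_beta_factor:
  defines "R \<equiv> \<lambda>\<theta> x. 2/3 * (1 - x) * (4 * \<theta> - 3 + 4 * (3 - 2 * \<theta>) * x)"
  shows "Q_beta \<beta> x = x * R (2 powr \<beta>) x"
    and "R \<theta> x = \<theta> + (6 - 16/3 * \<theta>) * (x - 1/4) - 8/3 * (3 - 2 * \<theta>) * (x - 1/4)\<^sup>2"
    and "R \<theta> x = \<theta> + (1 - \<theta>) * (4 * (x - 1/4)) + 8/3 * (3 - 2 * \<theta>) * (x - 1/4) * (1/2 - x)"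
  by (simp_all add: R_def Q_beta_def powr_add field_simps power2_eq_square)

text \<open>
  L(x) / x and Q(x) / x agree at 1/4. The first lies above its tangent there, the second, being
  concave, below its own, which is less steep.
\<close>

lemma Q_le_L:
  assumes \<beta>: "1/2 \<le> \<beta>" "\<beta> \<le> 50057/100000" and x: "0 < x" "x \<le> 1/4"
  shows "Q_beta \<beta> x \<le> L_beta \<beta> x"
proof -
  define \<theta> where "\<theta> = (2::real) powr \<beta>"
  have \<theta>: "14142/10000 \<le> \<theta>" "\<theta> \<le> 14148/10000" using theta_bounds[OF \<beta>] by (auto simp: \<theta>_def)
  have "2 powr (\<beta> - 1) = \<theta> / 2" by (simp add: \<theta>_def powr_diff)
  then have p: "2 powr (\<beta> - 1) = \<theta> / 2" .
  have "\<theta> + 2 * \<beta> * \<theta> / ln 2 * (1/4 - x) \<le> ell x powr \<beta>"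
  proof -
    have "\<theta> - \<beta> * 2 powr (\<beta> - 1) / (1/4 * ln 2) * (x - 1/4) \<le> ell x powr \<beta>"
      using ell_powr_ge_tangent[of \<beta> x "1/4"] \<beta> x by (simp add: ell_values \<theta>_def)
    moreover have "\<beta> * 2 powr (\<beta> - 1) / (1/4 * ln 2) * (x - 1/4) = - (2 * \<beta> * \<theta> / ln 2 * (1/4 - x))"
      unfolding p by (simp add: field_simps)
    ultimately show ?thesis by linarith
  qed
  moreover have "(16/3 * \<theta> - 6) * (1/4 - x) \<le> 2 * \<beta> * \<theta> / ln 2 * (1/4 - x)"
  proof (rule mult_right_mono)
    have "16/10 * ln 2 \<le> 1 * (14142/10000::real)" using ln2_bounds by simp
    also have "\<dots> \<le> (2 * \<beta>) * \<theta>" using \<theta> \<beta> by (intro mult_mono) auto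
    finally have "16/10 \<le> 2 * \<beta> * \<theta> / ln 2" by (simp add: pos_le_divide_eq)
    then show "16/3 * \<theta> - 6 \<le> 2 * \<beta> * \<theta> / ln 2" using \<theta> by simp
  qed (use x in simp)
  moreover have "0 \<le> 8/3 * (3 - 2 * \<theta>) * (x - 1/4)\<^sup>2" using \<theta> by (intro mult_nonneg_nonneg) auto
  moreover have "(6 - 16/3 * \<theta>) * (x - 1/4) = (16/3 * \<theta> - 6) * (1/4 - x)" by (simp add: field_simps)
  ultimately have "\<theta> + (6 - 16/3 * \<theta>) * (x - 1/4) - 8/3 * (3 - 2 * \<theta>) * (x - 1/4)\<^sup>2 \<le> ell x powr \<beta>"
    by linarith
  then show ?thesis
    unfolding L_beta_ell[OF x(1)] Q_beta_factor(1) Q_beta_factor(2) \<theta>_def[symmetric]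
    using x by (intro mult_left_mono) auto
qed

text \<open>
  L(x) / x is convex, hence below its chord over [1/4, 1/2], while Q(x) / x is above the same chord.
\<close>

lemma L_le_Q:
  assumes \<beta>: "1/2 \<le> \<beta>" "\<beta> \<le> 50057/100000" and x: "1/4 \<le> x" "x \<le> 1/2"
  shows "L_beta \<beta> x \<le> Q_beta \<beta> x"
proof -
  define \<theta> where "\<theta> = (2::real) powr \<beta>"
  have \<theta>: "14142/10000 \<le> \<theta>" "\<theta> \<le> 14148/10000" using theta_bounds[OF \<beta>] by (auto simp: \<theta>_def)
  define u where "u = 4 * (x - 1/4)"
  have u: "0 \<le> u" "u \<le> 1" "x = (1 - u) * (1/4) + u * (1/2)"
    using x by (auto simp: u_def field_simps)
  have "ell ((1 - u) *\<^sub>R (1/4) + u *\<^sub>R (1/2)) powr \<beta> \<le> (1 - u) * ell (1/4) powr \<beta> + u * ell (1/2) powr \<beta>"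
    by (rule convex_onD[OF ell_powr_convex[OF \<beta>(1)]]) (use u in auto)
  then have "ell x powr \<beta> \<le> (1 - u) * \<theta> + u"
    using u(3) by (simp add: ell_values \<theta>_def)
  moreover have "0 \<le> 8/3 * (3 - 2 * \<theta>) * (x - 1/4) * (1/2 - x)"
    using x \<theta> by (intro mult_nonneg_nonneg) auto
  ultimately have "ell x powr \<beta> \<le> \<theta> + (1 - \<theta>) * (4 * (x - 1/4)) + 8/3 * (3 - 2 * \<theta>) * (x - 1/4) * (1/2 - x)"
  proof -
    assume a: "ell x powr \<beta> \<le> (1 - u) * \<theta> + u"
      and b: "0 \<le> 8/3 * (3 - 2 * \<theta>) * (x - 1/4) * (1/2 - x)"
    have "(1 - u) * \<theta> + u = \<theta> + (1 - \<theta>) * (4 * (x - 1/4))" by (simp add: u_def algebra_simps)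
    with a b show ?thesis by linarith
  qed
  then show ?thesis
    unfolding L_beta_ell[OF order.strict_trans2[OF _ x(1)], simplified] Q_beta_factor(1) Q_beta_factor(3) \<theta>_def[symmetric]
    using x by (intro mult_left_mono) auto
qed


section \<open>Both points in the range of L\<close>

lemma ln_quadratic_lower: "0 \<le> v \<Longrightarrow> v - v\<^sup>2 / 2 \<le> ln (1 + v)" for v :: real
proof -
  assume v: "0 \<le> v"
  have "(\<lambda>v. ln (1 + v) - (v - v\<^sup>2 / 2)) 0 \<le> (\<lambda>v. ln (1 + v) - (v - v\<^sup>2 / 2)) v"
  proof (rule nondecreasing_from_0[OF v])
    fix u :: real assume u: "0 \<le> u" "u \<le> v"
    show "((\<lambda>v. ln (1 + v) - (v - v\<^sup>2 / 2)) has_real_derivative 1 / (1 + u) - (1 - u)) (at u)"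
      using u by (auto intro!: derivative_eq_intros simp: inverse_eq_divide)
    show "0 \<le> 1 / (1 + u) - (1 - u)" using u by (simp add: field_simps)
  qed
  then show ?thesis by simp
qed

lemma xlnx_deriv:
  fixes a b u :: real
  assumes "0 < a + b * u"
  shows "((\<lambda>s. (a + b * s) * ln (a + b * s)) has_real_derivative b * (ln (a + b * u) + 1)) (at u)"
proof -
  have "((\<lambda>s. (a + b * s) * ln (a + b * s)) has_real_derivative
      b * ln (a + b * u) + inverse (a + b * u) * b * (a + b * u)) (at u)"
    using assms by (auto intro!: derivative_eq_intros simp: inverse_eq_divide)
  moreover have "b * ln (a + b * u) + inverse (a + b * u) * b * (a + b * u) = b * (ln (a + b * u) + 1)"
    using assms by (simp add: field_simps)
  ultimately show ?thesis by simp
qed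

lemma entropy_lower_1: "0 \<le> s \<Longrightarrow> s + s\<^sup>2 / 2 - s ^ 3 / 6 \<le> (1 + s) * ln (1 + s)" for s :: real
proof -
  assume s: "0 \<le> s"
  let ?f = "\<lambda>s. (1 + s) * ln (1 + s) - (s + s\<^sup>2 / 2 - s ^ 3 / 6)"
  have "?f 0 \<le> ?f s"
  proof (rule nondecreasing_from_0[OF s])
    fix u :: real assume u: "0 \<le> u" "u \<le> s"
    have "((\<lambda>s. (1 + s) * ln (1 + s)) has_real_derivative ln (1 + u) + 1) (at u)"
      using xlnx_deriv[of 1 1 u] u by simp
    moreover have "((\<lambda>s. s + s\<^sup>2 / 2 - s ^ 3 / 6) has_real_derivative 1 + u - u\<^sup>2 / 2) (at u)"
      by (auto intro!: derivative_eq_intros)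
    ultimately have "(?f has_real_derivative ln (1 + u) + 1 - (1 + u - u\<^sup>2 / 2)) (at u)"
      by (rule DERIV_diff)
    then show "(?f has_real_derivative ln (1 + u) - (u - u\<^sup>2 / 2)) (at u)" by (simp add: algebra_simps)
    show "0 \<le> ln (1 + u) - (u - u\<^sup>2 / 2)" using ln_quadratic_lower[OF u(1)] by simp
  qed
  then show ?thesis by simp
qed

lemma ln_cubic_upper:
  fixes e :: real
  assumes "0 \<le> e" "e \<le> 1/2"
  shows "- ln (1 - e) \<le> e + e\<^sup>2 / 2 + 2/3 * e ^ 3"
proof -
  let ?f = "\<lambda>e. e + e\<^sup>2 / 2 + 2/3 * e ^ 3 + ln (1 - e)"
  have "?f 0 \<le> ?f e"
  proof (rule nondecreasing_from_0[OF assms(1)])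
    fix u :: real assume u: "0 \<le> u" "u \<le> e"
    show "(?f has_real_derivative 1 + u + 2 * u\<^sup>2 - 1 / (1 - u)) (at u)"
      using u assms by (auto intro!: derivative_eq_intros simp: inverse_eq_divide)
    have "(1 + u + 2 * u\<^sup>2) * (1 - u) = 1 + u\<^sup>2 * (1 - 2 * u)"
      by (simp add: algebra_simps power2_eq_square)
    moreover have "0 \<le> u\<^sup>2 * (1 - 2 * u)" using u assms by (intro mult_nonneg_nonneg) auto
    ultimately have "1 \<le> (1 + u + 2 * u\<^sup>2) * (1 - u)" by linarith
    then show "0 \<le> 1 + u + 2 * u\<^sup>2 - 1 / (1 - u)" using u assms by (simp add: pos_divide_le_eq)
  qed
  then show ?thesis by simp
qed

lemma entropy_lower_2:
  fixes e :: real
  assumes "0 \<le> e" "e \<le> 1/2"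
  shows "e - e\<^sup>2 / 2 - e ^ 3 / 6 - e ^ 4 / 6 \<le> (1 - e) * (- ln (1 - e))"
proof -
  let ?f = "\<lambda>e. (1 - e) * (- ln (1 - e)) - (e - e\<^sup>2 / 2 - e ^ 3 / 6 - e ^ 4 / 6)"
  have "?f 0 \<le> ?f e"
  proof (rule nondecreasing_from_0[OF assms(1)])
    fix u :: real assume u: "0 \<le> u" "u \<le> e"
    have "((\<lambda>e. (1 - e) * ln (1 - e)) has_real_derivative - (ln (1 - u) + 1)) (at u)"
      using xlnx_deriv[of 1 "-1" u] u assms by simp
    from DERIV_minus[OF this]
    have "((\<lambda>e. (1 - e) * (- ln (1 - e))) has_real_derivative ln (1 - u) + 1) (at u)"
      by (simp add: add.commute)
    moreover have "((\<lambda>e. e - e\<^sup>2 / 2 - e ^ 3 / 6 - e ^ 4 / 6) has_real_derivative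
        1 - u - u\<^sup>2 / 2 - 2/3 * u ^ 3) (at u)"
      by (auto intro!: derivative_eq_intros)
    ultimately have "(?f has_real_derivative ln (1 - u) + 1 - (1 - u - u\<^sup>2 / 2 - 2/3 * u ^ 3)) (at u)"
      by (rule DERIV_diff)
    then show "(?f has_real_derivative ln (1 - u) + (u + u\<^sup>2 / 2 + 2/3 * u ^ 3)) (at u)"
      by (simp add: algebra_simps)
    show "0 \<le> ln (1 - u) + (u + u\<^sup>2 / 2 + 2/3 * u ^ 3)" using ln_cubic_upper[of u] u assms by simp
  qed
  then show ?thesis by simp
qed

lemma entropy_lower_3:
  fixes e :: real
  assumes "0 \<le> e" "e \<le> 1"
  shows "- e + e\<^sup>2 / 4 \<le> (2 - e) * ln (1 - e / 2)"
proof -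
  let ?f = "\<lambda>e. (2 - e) * ln (1 - e / 2) - (- e + e\<^sup>2 / 4)"
  have "?f 0 \<le> ?f e"
  proof (rule nondecreasing_from_0[OF assms(1)])
    fix u :: real assume u: "0 \<le> u" "u \<le> e"
    have "((\<lambda>e. (1 - e / 2) * ln (1 - e / 2)) has_real_derivative - 1/2 * (ln (1 - u / 2) + 1)) (at u)"
      using xlnx_deriv[of 1 "-1/2" u] u assms by simp
    from DERIV_cmult[OF this, of 2]
    have "((\<lambda>e. (2 - e) * ln (1 - e / 2)) has_real_derivative - (ln (1 - u / 2) + 1)) (at u)"
      by (simp add: algebra_simps)
    moreover have "((\<lambda>e. - e + e\<^sup>2 / 4) has_real_derivative - 1 + u / 2) (at u)"
      by (auto intro!: derivative_eq_intros)
    ultimately have "(?f has_real_derivative - (ln (1 - u / 2) + 1) - (- 1 + u / 2)) (at u)"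
      by (rule DERIV_diff)
    then show "(?f has_real_derivative - ln (1 - u / 2) - u / 2) (at u)" by (simp add: algebra_simps)
    show "0 \<le> - ln (1 - u / 2) - u / 2" using ln_one_minus_pos_upper_bound[of "u / 2"] u assms by simp
  qed
  then show ?thesis by simp
qed

lemma inverse_ln2_bounds: "144/100 \<le> 1 / ln (2::real)" "1 / ln (2::real) \<le> 145/100"
  using ln2_bounds by (auto simp: field_simps)

text \<open>
  Put x = s y and L = ell y. After division by y, the inequality for \<beta> = 1/2 compares square roots of
  L + a, L + l and L + m, and a + s l - (1 + s) m is the coefficient of 1 / (2 sqrt L) in the
  difference of its sides for large L. The lemma says that this coefficient dominates the correction
  due to the concavity of the square root. Near s = 1 both sides vanish to second order, which is
  why s \<le> 1/2 and s \<ge> 1/2 are treated with different bounds for the logarithms.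
\<close>

lemma L_two_point_first_order:
  fixes s :: real
  assumes s: "0 < s" "s \<le> 1"
  defines "a \<equiv> (1 - s)\<^sup>2" and "l \<equiv> log 2 (1 / s)" and "m \<equiv> 1 - log 2 (1 + s)"
  shows "s * (l - a)\<^sup>2 \<le> (1 + s) * (a + s * l - (1 + s) * m) * (4 + a + l)"
proof -
  define k where "k = 1 / ln (2::real)"
  have k: "144/100 \<le> k" "k \<le> 145/100" using inverse_ln2_bounds by (auto simp: k_def)
  have l: "l = k * (- ln s)" using s by (simp add: l_def log_def ln_div k_def)
  have m: "m = 1 - k * ln (1 + s)" by (simp add: m_def log_def k_def)
  define E where "E = a + s * l - (1 + s) * m"
  have "ln s \<le> s - 1" using s by (intro ln_le_minus_one)
  have l_ge: "144/100 * (1 - s) \<le> l"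
    unfolding l using k s \<open>ln s \<le> s - 1\<close> by (intro mult_mono) auto
  have a: "0 \<le> a" "a \<le> 1" "a \<le> 1 - s"
  proof -
    show "0 \<le> a" by (simp add: a_def)
    have "(1 - s) * (1 - s) \<le> (1 - s) * 1" using s by (intro mult_left_mono) auto
    then show "a \<le> 1 - s" by (simp add: a_def power2_eq_square)
    then show "a \<le> 1" using s by simp
  qed
  have "1 - s \<le> 144/100 * (1 - s)" using s by simp
  from order_trans[OF a(3) order_trans[OF this l_ge]] have "a \<le> l" by simp
  show ?thesis
  proof (cases "s \<le> 1/2")
    case True
    \<comment> \<open>k (1 + s) ln (1 + s) is replaced by the Taylor bound with k = 1.44, which turns E into a
        lower bound linear in l.\<close>
    define c where "c = 156/100 - 172/100 * s + 24/100 * s\<^sup>2"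
    have E1: "s * (l - c) \<le> E"
    proof -
      have "0 \<le> s + s\<^sup>2 / 2 - s ^ 3 / 6"
      proof -
        have "s ^ 3 \<le> s\<^sup>2 * 1" using s by (simp add: power3_eq_cube power2_eq_square mult_left_le)
        then show ?thesis using s zero_le_power2[of s] by linarith
      qed
      then have "144/100 * (s + s\<^sup>2 / 2 - s ^ 3 / 6) \<le> k * ((1 + s) * ln (1 + s))"
        using k entropy_lower_1[of s] s by (intro mult_mono) auto
      then show ?thesis unfolding E_def c_def m a_def
        by (simp add: algebra_simps power2_eq_square power3_eq_cube)
    qed
    have key: "(l - a)\<^sup>2 \<le> (l - c) * (4 + a + l)" and "c \<le> l"
    proof -
      have lin: "(l - c) * (4 + a + l) - (l - a)\<^sup>2 = l * (4 - c + 3 * a) - c * (4 + a) - a\<^sup>2"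
        by (simp add: algebra_simps power2_eq_square)
      have cb: "c \<le> 156/100"
      proof -
        have "24/100 * s * s \<le> 24/100 * s * 1" using s by (intro mult_left_mono) auto
        then show ?thesis using s by (simp add: c_def power2_eq_square)
      qed
      have "0 \<le> l * (4 - c + 3 * a) - c * (4 + a) - a\<^sup>2 \<and> c \<le> l"
      proof (cases "s \<le> 1/4")
        case s4: True
        have "log 2 4 \<le> l" unfolding l_def using s s4 by (simp add: field_simps)
        then have l2: "2 \<le> l" using ell_values(2) by (simp add: ell_def)
        have a2: "5625/10000 \<le> a"
        proof -
          have "(3/4)\<^sup>2 \<le> a" unfolding a_def using s4 by (intro power_mono) auto
          then show ?thesis by (simp add: power2_eq_square)
        qed
        have "2 * (4 - c + 3 * a) \<le> l * (4 - c + 3 * a)" using l2 cb a by (intro mult_right_mono) auto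
        moreover have "c * (6 + a) \<le> 156/100 * (6 + a)" using cb a by (intro mult_right_mono) auto
        moreover have "a\<^sup>2 \<le> 1 * a" unfolding power2_eq_square using a by (intro mult_right_mono) auto
        ultimately have "0 \<le> l * (4 - c + 3 * a) - c * (4 + a) - a\<^sup>2"
          using a2 by (simp add: field_simps)
        then show ?thesis using l2 cb by simp
      next
        case s4: False
        have "ln (2 * s) \<le> 2 * s - 1" using s by (intro ln_le_minus_one) auto
        moreover have "ln (2 * s) = ln 2 + ln s" using s by (simp add: ln_mult)
        ultimately have "1 - 2 * s \<le> - ln s - ln 2" by simp
        then have "144/100 * (1 - 2 * s) \<le> k * (- ln s - ln 2)"
          using k True by (intro mult_mono) auto
        also have "\<dots> = l - 1" by (simp add: l k_def field_simps)
        finally have l2: "244/100 - 288/100 * s \<le> l" by (simp add: field_simps)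
        have "(244/100 - 288/100 * s) * (4 - c + 3 * a) \<le> l * (4 - c + 3 * a)"
          using l2 cb a by (intro mult_right_mono) auto
        moreover have "0 < (244/100 - 288/100 * s) * (4 - c + 3 * a) - c * (4 + a) - a\<^sup>2"
        proof -
          let ?a = "(PC 1 1 \<ominus> PX) \<up> 2" and ?c = "PC 156 100 \<ominus> PC 172 100 \<otimes> PX \<oplus> PC 24 100 \<otimes> PX \<up> 2"
          have "positive_on Leaf (1, 2, 4) (0, 1, 1)
            ((PC 244 100 \<ominus> PC 288 100 \<otimes> PX) \<otimes> (PC 4 1 \<ominus> ?c \<oplus> PC 3 1 \<otimes> ?a) \<ominus> ?c \<otimes> (PC 4 1 \<oplus> ?a) \<ominus> ?a \<up> 2)"
            by code_simp
          from positive_on[OF this, of s 0] True s4 show ?thesis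
            by (simp add: a_def c_def field_simps)
        qed
        moreover have "c \<le> 244/100 - 288/100 * s"
        proof -
          have "24/100 * s * s \<le> 24/100 * s * 1" using s by (intro mult_left_mono) auto
          then show ?thesis using True by (simp add: c_def power2_eq_square)
        qed
        ultimately show ?thesis using l2 by linarith
      qed
      then show "(l - a)\<^sup>2 \<le> (l - c) * (4 + a + l)" "c \<le> l" using lin by linarith+
    qed
    have "s * (l - a)\<^sup>2 \<le> s * ((l - c) * (4 + a + l))" using key s by (intro mult_left_mono) auto
    also have "\<dots> = s * (l - c) * (4 + a + l)" by simp
    also have "\<dots> \<le> ((1 + s) * E) * (4 + a + l)"
    proof (rule mult_right_mono)
      have "0 \<le> E" using E1 s \<open>c \<le> l\<close> by (smt (verit) mult_nonneg_nonneg)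
      then have "E \<le> (1 + s) * E" using s by (simp add: distrib_right)
      then show "s * (l - c) \<le> (1 + s) * E" using E1 by linarith
    qed (use a \<open>a \<le> l\<close> in linarith)
    finally show ?thesis by (simp add: E_def)
  next
    case False
    define e where "e = 1 - s"
    have e: "0 \<le> e" "e \<le> 1/2" "s = 1 - e" using s False by (auto simp: e_def)
    have ae: "a = e\<^sup>2" by (simp add: a_def e_def)
    have E2: "43/100 * e\<^sup>2 \<le> E"
    proof -
      have "1 + s = 2 * (1 - e / 2)" using e(3) by (simp add: field_simps)
      then have "ln (1 + s) = ln 2 + ln (1 - e / 2)"
        using e ln_mult[of 2 "1 - e / 2"] by simp
      moreover have "k * ln 2 = 1" by (simp add: k_def)
      ultimately have "m = - (k * ln (1 - e / 2))" unfolding m by (simp add: distrib_left)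
      then have "E = e\<^sup>2 + k * ((1 - e) * (- ln (1 - e)) + (2 - e) * ln (1 - e / 2))"
        unfolding E_def ae l e(3) by (simp add: algebra_simps)
      moreover have "k * (- e\<^sup>2 * (1/4 + e / 6 + e\<^sup>2 / 6))
          \<le> k * ((1 - e) * (- ln (1 - e)) + (2 - e) * ln (1 - e / 2))"
      proof (rule mult_left_mono)
        show "- e\<^sup>2 * (1/4 + e / 6 + e\<^sup>2 / 6) \<le> (1 - e) * (- ln (1 - e)) + (2 - e) * ln (1 - e / 2)"
          using entropy_lower_2[of e] entropy_lower_3[of e] e
          by (simp add: algebra_simps power2_eq_square eval_nat_numeral)
      qed (use k in simp)
      moreover have "e\<^sup>2 * (k * (1/4 + e / 6 + e\<^sup>2 / 6)) \<le> e\<^sup>2 * (57/100)"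
      proof (rule mult_left_mono)
        have "e\<^sup>2 \<le> (1/2)\<^sup>2" using e by (intro power_mono) auto
        then have "e\<^sup>2 \<le> 1/4" by (simp add: power2_eq_square)
        then have "k * (1/4 + e / 6 + e\<^sup>2 / 6) \<le> 145/100 * (1/4 + 1/2 / 6 + 1/4 / 6)"
          using k e by (intro mult_mono add_mono) auto
        then show "k * (1/4 + e / 6 + e\<^sup>2 / 6) \<le> 57/100" by simp
      qed simp
      ultimately show ?thesis by (simp add: field_simps)
    qed
    have l_le: "l \<le> e * (145/100 * (1 + e / 2 + 2/3 * e\<^sup>2))"
    proof -
      have "l = k * (- ln (1 - e))" using l e by simp
      also have "\<dots> \<le> 145/100 * (e + e\<^sup>2 / 2 + 2/3 * e ^ 3)"
        using k ln_cubic_upper[of e] e ln_one_minus_pos_upper_bound[of e] by (intro mult_mono) auto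
      finally show ?thesis by (simp add: algebra_simps power2_eq_square power3_eq_cube)
    qed
    have pull: "(1 - e) * (e * c)\<^sup>2 = e\<^sup>2 * ((1 - e) * c\<^sup>2)" for c
      by (simp add: power_mult_distrib)
    have "(l - a)\<^sup>2 \<le> l\<^sup>2" using \<open>a \<le> l\<close> a by (intro power_mono) auto
    also have "\<dots> \<le> (e * (145/100 * (1 + e / 2 + 2/3 * e\<^sup>2)))\<^sup>2"
      using l_le \<open>a \<le> l\<close> a by (intro power_mono) auto
    finally have "s * (l - a)\<^sup>2 \<le> (1 - e) * (e * (145/100 * (1 + e / 2 + 2/3 * e\<^sup>2)))\<^sup>2"
      using e by (simp add: mult_left_mono)
    also have "\<dots> = e\<^sup>2 * ((1 - e) * (145/100 * (1 + e / 2 + 2/3 * e\<^sup>2))\<^sup>2)"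
      by (rule pull)
    also have "\<dots> \<le> e\<^sup>2 * ((2 - e) * (43/100) * 4)"
    proof (rule mult_left_mono)
      have "positive_on (SplitX Leaf Leaf) (0, 1, 2) (0, 1, 1)
        ((PC 2 1 \<ominus> PX) \<otimes> PC 172 100 \<ominus> (PC 1 1 \<ominus> PX) \<otimes>
          (PC 145 100 \<otimes> (PC 1 1 \<oplus> PC 1 2 \<otimes> PX \<oplus> PC 2 3 \<otimes> PX \<up> 2)) \<up> 2)" by code_simp
      from positive_on[OF this, of e 0] e
      show "(1 - e) * (145/100 * (1 + e / 2 + 2/3 * e\<^sup>2))\<^sup>2 \<le> (2 - e) * (43/100) * 4" by (simp add: field_simps)
    qed simp
    also have "\<dots> = (1 + s) * (43/100 * e\<^sup>2) * 4" using e by simp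
    also have "\<dots> \<le> (1 + s) * E * (4 + a + l)"
    proof -
      have "0 \<le> 43/100 * e\<^sup>2" by simp
      then have "0 \<le> E" using E2 by linarith
      then show ?thesis using E2 s a \<open>a \<le> l\<close> by (intro mult_mono) auto
    qed
    finally show ?thesis by (simp add: E_def)
  qed
qed

text \<open>
  (A + s B)^2 = (1 + s) (A^2 + s B^2) - s (A - B)^2, where A and B are the roots on the right, and
  (A - B)^2 = (A^2 - B^2)^2 / (A + B)^2 with (A + B)^2 \<ge> 4 + a + l because L \<ge> 1.
\<close>

lemma L_two_point_sqrt:
  fixes s :: real
  assumes s: "0 < s" "s \<le> 1" and L: "1 \<le> L"
  shows "(1 + s) * sqrt (L + (1 - log 2 (1 + s))) \<le> sqrt ((1 - s)\<^sup>2 + L) + s * sqrt (L + log 2 (1 / s))"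
proof -
  define a and l and m where "a = (1 - s)\<^sup>2" and "l = log 2 (1 / s)" and "m = 1 - log 2 (1 + s)"
  have a: "0 \<le> a" by (simp add: a_def)
  have l: "0 \<le> l" using s by (simp add: l_def)
  define A and B where "A = sqrt (a + L)" and "B = sqrt (L + l)"
  have A2: "A\<^sup>2 = a + L" and B2: "B\<^sup>2 = L + l" using a l L by (simp_all add: A_def B_def)
  have pos: "0 < A" "0 < B" using a l L by (auto simp: A_def B_def)
  have E: "s * (l - a)\<^sup>2 \<le> (1 + s) * (a + s * l - (1 + s) * m) * (4 + a + l)"
    unfolding a_def l_def m_def by (rule L_two_point_first_order[OF s])
  have AB: "L \<le> A * B"
  proof -
    have "L = sqrt L * sqrt L" using L by simp
    also have "\<dots> \<le> A * B" using a l L by (intro mult_mono) (auto simp: A_def B_def)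
    finally show ?thesis .
  qed
  have "s * (A - B)\<^sup>2 \<le> (1 + s) * (a + s * l - (1 + s) * m)"
  proof -
    have "(A + B)\<^sup>2 = A\<^sup>2 + B\<^sup>2 + 2 * (A * B)" by (simp add: power2_eq_square algebra_simps)
    then have sum: "4 + a + l \<le> (A + B)\<^sup>2" using A2 B2 AB L by linarith
    have "(A - B)\<^sup>2 * (A + B)\<^sup>2 = (A\<^sup>2 - B\<^sup>2)\<^sup>2" by (simp add: power2_eq_square algebra_simps)
    also have "\<dots> = (l - a)\<^sup>2" unfolding A2 B2 by (simp add: power2_eq_square algebra_simps)
    finally have "(A - B)\<^sup>2 * (4 + a + l) \<le> (l - a)\<^sup>2"
      using mult_left_mono[OF sum, of "(A - B)\<^sup>2"] by simp
    then have "s * ((A - B)\<^sup>2 * (4 + a + l)) \<le> s * (l - a)\<^sup>2" using s by (intro mult_left_mono) auto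
    with E have "s * (A - B)\<^sup>2 * (4 + a + l) \<le> (1 + s) * (a + s * l - (1 + s) * m) * (4 + a + l)"
      by (simp add: mult.assoc)
    then show ?thesis by (rule mult_right_le_imp_le) (use a l in simp)
  qed
  then have "(1 + s)\<^sup>2 * (L + m) \<le> (1 + s) * ((a + L) + s * (L + l)) - s * (A - B)\<^sup>2"
    by (simp add: algebra_simps power2_eq_square)
  also have "\<dots> = (A + s * B)\<^sup>2"
    unfolding A2[symmetric] B2[symmetric] by (simp add: algebra_simps power2_eq_square)
  finally have "sqrt ((1 + s)\<^sup>2 * (L + m)) \<le> A + s * B"
    using pos s by (intro real_le_lsqrt) auto
  then show ?thesis using s by (simp add: real_sqrt_mult A_def B_def a_def l_def m_def)
qed

lemma powr_tangent:
  fixes z c :: real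
  assumes "1 \<le> q" "0 < c" "0 \<le> z"
  shows "c powr q + q * c powr (q - 1) * (z - c) \<le> z powr q"
proof (cases "z = 0")
  case True
  have "c powr q = c powr (q - 1) * c" using assms powr_add[of c "q - 1" 1] by simp
  then have "c powr q + q * c powr (q - 1) * (z - c) = - (q - 1) * c powr q"
    using True by (simp add: algebra_simps)
  moreover have "- (q - 1) * c powr q \<le> 0" using assms by (intro mult_nonpos_nonneg) auto
  ultimately show ?thesis using True assms by simp
next
  case False
  have "q * c powr (q - 1) * (z - c) \<le> z powr q - c powr q"
  proof (rule convex_on_imp_above_tangent[OF powr_convex[OF assms(1)]])
    show "c \<in> interior {0<..}" using assms by (simp add: interior_open)
    show "((\<lambda>x. x powr q) has_real_derivative q * c powr (q - 1)) (at c within {0<..})"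
      by (rule has_field_derivative_at_within[OF has_real_derivative_powr]) (use assms in simp)
  qed (use False assms in auto)
  then show ?thesis by simp
qed

text \<open>
  z^\<beta> is the power 2 \<beta> \<ge> 1 of sqrt z, and this power lies above its tangent at the root on the left
  side.
\<close>

lemma L_two_point_powr:
  fixes s :: real
  assumes \<beta>: "1/2 \<le> \<beta>" and s: "0 < s" "s \<le> 1" and L: "1 \<le> L"
  shows "(1 + s) * (L + (1 - log 2 (1 + s))) powr \<beta> \<le> ((1 - s)\<^sup>2 + L) powr \<beta> + s * (L + log 2 (1 / s)) powr \<beta>"
proof -
  define A and B and C where "A = (1 - s)\<^sup>2 + L" and "B = L + log 2 (1 / s)" and "C = L + (1 - log 2 (1 + s))"
  have l: "0 \<le> log 2 (1 / s)" using s by simp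
  have m: "log 2 (1 + s) \<le> 1" using s by simp
  have pos: "0 < A" "0 < B" "0 < C" using l m L by (auto simp: A_def B_def C_def add_nonneg_pos)
  have half: "x powr \<beta> = sqrt x powr (2 * \<beta>)" if "0 < x" for x :: real
    using that by (simp add: powr_half_sqrt[symmetric] powr_powr)
  define q and c where "q = 2 * \<beta>" and "c = sqrt C"
  have "0 \<le> q * c powr (q - 1) * (sqrt A + s * sqrt B - (1 + s) * c)"
    using L_two_point_sqrt[OF s L] \<beta> by (intro mult_nonneg_nonneg) (auto simp: q_def c_def A_def B_def C_def)
  moreover have "c powr q + q * c powr (q - 1) * (sqrt A - c) \<le> sqrt A powr q"
    using pos \<beta> by (intro powr_tangent) (auto simp: q_def c_def)
  moreover have "s * (c powr q + q * c powr (q - 1) * (sqrt B - c)) \<le> s * sqrt B powr q"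
    using pos \<beta> s by (intro mult_left_mono powr_tangent) (auto simp: q_def c_def)
  ultimately have "(1 + s) * c powr q \<le> sqrt A powr q + s * sqrt B powr q"
    by (simp add: algebra_simps)
  then show ?thesis
    using half[OF pos(1)] half[OF pos(2)] half[OF pos(3)] by (simp add: q_def c_def A_def B_def C_def)
qed

text \<open>
  Division by y leads to the variables of the previous lemma; 1 / \<beta> \<le> 2 bounds the power of 1 - s
  from below by its square.
\<close>

lemma L_two_point:
  assumes \<beta>: "1/2 \<le> \<beta>" "\<beta> < 1" and xy: "0 \<le> x" "x \<le> y" "0 < y" "y \<le> 1/2"
  shows "2 * L_beta \<beta> ((x + y) / 2)
    \<le> ((y - x) powr (1 / \<beta>) + L_beta \<beta> y powr (1 / \<beta>)) powr \<beta> + L_beta \<beta> x"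
proof -
  define p where "p = 1 / \<beta>"
  have p: "1 < p" "p \<le> 2" "p * \<beta> = 1" using \<beta> by (auto simp: p_def field_simps)
  define L where "L = ell y"
  have L: "1 \<le> L" using ell_antimono[of y "1/2"] ell_values(1) xy by (simp add: L_def)
  define s where "s = x / y"
  have s: "0 \<le> s" "s \<le> 1" "x = y * s" using xy by (auto simp: s_def)
  have ypow: "(y powr p) powr \<beta> = y" unfolding powr_powr p(3) using xy by simp
  have Ly: "L_beta \<beta> y powr p = y powr p * L"
    using xy L \<beta> by (simp add: L_beta_ell L_def powr_mult powr_powr p_def)
  have "(y - x) powr p = y powr p * (1 - s) powr p"
    using s xy by (simp add: s(3) powr_mult[symmetric] algebra_simps)
  then have N: "((y - x) powr p + L_beta \<beta> y powr p) powr \<beta> = y * ((1 - s) powr p + L) powr \<beta>"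
    using s L ypow by (simp add: Ly distrib_left[symmetric] powr_mult)
  have mid: "2 * L_beta \<beta> ((x + y) / 2) = y * ((1 + s) * (L + (1 - log 2 (1 + s))) powr \<beta>)"
  proof -
    have pos: "0 < (x + y) / 2" using xy by simp
    have ellm: "ell ((x + y) / 2) = L + (1 - log 2 (1 + s))"
    proof -
      have e: "(x + y) / 2 = y * (1 + s) / 2" by (simp add: s(3) algebra_simps)
      have "ln (y * (1 + s)) = ln y + ln (1 + s)" using xy s ln_mult[of y "1 + s"] by simp
      moreover have "ln (y * (1 + s) / 2) = ln (y * (1 + s)) - ln 2" using xy s ln_div[of "y * (1 + s)" 2] by simp
      ultimately have "ln ((x + y) / 2) = ln y + ln (1 + s) - ln 2" unfolding e by simp
      then show ?thesis unfolding ell_eq[OF pos] L_def ell_eq[OF xy(3)] log_def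
        by (simp add: add_divide_distrib diff_divide_distrib)
    qed
    have "2 * L_beta \<beta> ((x + y) / 2) = (x + y) * ell ((x + y) / 2) powr \<beta>"
      unfolding L_beta_ell[OF pos] by simp
    moreover have "x + y = y * (1 + s)" by (simp add: s(3) algebra_simps)
    ultimately show ?thesis unfolding ellm by (simp only: mult.assoc)
  qed
  show ?thesis
  proof (cases "s = 0")
    case True
    then show ?thesis using N mid s by (simp add: p_def L_beta_def add.commute)
  next
    case False
    then have s0: "0 < s" using s by simp
    have Lx: "L_beta \<beta> x = y * (s * (L + log 2 (1 / s)) powr \<beta>)"
    proof -
      have "0 < x" using s0 xy s by simp
      moreover have "ell x = L + log 2 (1 / s)"
      proof -
        have "ln x = ln y + ln s" unfolding s(3) using xy s0 ln_mult[of y s] by simp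
        moreover have "ln (1 / s) = - ln s" using s0 by (simp add: ln_div)
        ultimately show ?thesis unfolding ell_eq[OF \<open>0 < x\<close>] L_def ell_eq[OF xy(3)] log_def
          by (simp add: add_divide_distrib diff_divide_distrib)
      qed
      ultimately show ?thesis using L_beta_ell[of x \<beta>] s by simp
    qed
    have "(1 - s)\<^sup>2 \<le> (1 - s) powr p"
    proof (cases "s = 1")
      case False
      then have "(1 - s) powr 2 \<le> (1 - s) powr p" using s s0 p by (intro powr_mono') auto
      then show ?thesis using s False by (simp add: powr_numeral)
    qed simp
    then have "((1 - s)\<^sup>2 + L) powr \<beta> \<le> ((1 - s) powr p + L) powr \<beta>"
      using L \<beta> by (intro powr_mono2) auto
    then have "(1 + s) * (L + (1 - log 2 (1 + s))) powr \<beta>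
        \<le> ((1 - s) powr p + L) powr \<beta> + s * (L + log 2 (1 / s)) powr \<beta>"
      using L_two_point_powr[OF \<beta>(1) s0 s(2) L] by linarith
    then have "y * ((1 + s) * (L + (1 - log 2 (1 + s))) powr \<beta>)
        \<le> y * (((1 - s) powr p + L) powr \<beta> + s * (L + log 2 (1 / s)) powr \<beta>)"
      using xy by (intro mult_left_mono) auto
    then show ?thesis using N mid Lx by (simp add: p_def distrib_left)
  qed
qed


section \<open>Both points in the range of J\<close>

lemma Je_concave:
  assumes "1/2 \<le> x" "x \<le> m" "m < 1"
  shows "Je m \<le> Je x + dJ x * (m - x)" "Je x \<le> Je m - dJ m * (m - x)"
proof -
  have "(\<lambda>v. Je v - dJ x * (v - x)) m \<le> (\<lambda>v. Je v - dJ x * (v - x)) x"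
  proof (rule DERIV_nonpos_imp_nonincreasing[where a=x and b=m and f="\<lambda>v. Je v - dJ x * (v - x)"])
    fix u assume u: "x \<le> u" "u \<le> m"
    have "((\<lambda>v. Je v - dJ x * (v - x)) has_real_derivative dJ u - dJ x) (at u)"
      using u assms by (auto intro!: derivative_eq_intros Je_deriv)
    then show "\<exists>y. ((\<lambda>v. Je v - dJ x * (v - x)) has_real_derivative y) (at u) \<and> y \<le> 0"
      using dJ_antimono[of x u] u assms by (intro exI[of _ "dJ u - dJ x"] conjI) auto
  qed fact
  then show "Je m \<le> Je x + dJ x * (m - x)" by simp
  have "(\<lambda>v. Je v + dJ m * (m - v)) x \<le> (\<lambda>v. Je v + dJ m * (m - v)) m"
  proof (rule DERIV_nonneg_imp_nondecreasing[where a=x and b=m and f="\<lambda>v. Je v + dJ m * (m - v)"])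
    fix u assume u: "x \<le> u" "u \<le> m"
    have "((\<lambda>v. Je v + dJ m * (m - v)) has_real_derivative dJ u - dJ m) (at u)"
      using u assms by (auto intro!: derivative_eq_intros Je_deriv)
    then show "\<exists>y. ((\<lambda>v. Je v + dJ m * (m - v)) has_real_derivative y) (at u) \<and> 0 \<le> y"
      using dJ_antimono[of u m] u assms by (intro exI[of _ "dJ u - dJ m"] conjI) auto
  qed fact
  then show "Je x \<le> Je m - dJ m * (m - x)" by simp
qed

text \<open>
  1 / J is convex, so the trapezoidal rule overestimates the integral of 2 / J = - J''.
\<close>

lemma dJ_trapezoid:
  assumes "1/2 \<le> x" "x \<le> m" "m < 1"
  shows "dJ x - dJ m \<le> (m - x) * (1 / Je x + 1 / Je m)"
proof -
  let ?g = "\<lambda>v. (v - x) * (1 / Je x + 1 / Je v) + dJ v"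
  have "?g x \<le> ?g m"
  proof (rule DERIV_nonneg_imp_nondecreasing[where a=x and b=m and f="?g"])
    fix u assume u: "x \<le> u" "u \<le> m"
    let ?X = "Je x" and ?U = "Je u"
    have pos: "0 < ?X" "0 < ?U" by (rule Je_pos)+
    have "(?g has_real_derivative
       (1 / ?X + 1 / ?U) + (u - x) * (- dJ u / ?U\<^sup>2) + (- 2 / ?U)) (at u)"
      using u assms pos
      by (auto intro!: derivative_eq_intros Je_deriv dJ_deriv simp: power2_eq_square)
    moreover have "0 \<le> (1 / ?X + 1 / ?U) + (u - x) * (- dJ u / ?U\<^sup>2) + (- 2 / ?U)"
    proof -
      define k where "k = dJ u * (u - x)"
      have X: "?X \<le> ?U - k" using Je_concave(2)[of x u] u assms by (simp add: k_def)
      have "?X * (?U + k) \<le> ?U\<^sup>2"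
      proof (cases "?U + k \<le> 0")
        case True
        then have "?X * (?U + k) \<le> 0" using pos by (intro mult_nonneg_nonpos) auto
        then show ?thesis by (smt (verit) zero_le_power2)
      next
        case False
        then have "?X * (?U + k) \<le> (?U - k) * (?U + k)" using X by (intro mult_right_mono) auto
        also have "\<dots> = ?U\<^sup>2 - k\<^sup>2" by (simp add: power2_eq_square algebra_simps)
        also have "\<dots> \<le> ?U\<^sup>2" by simp
        finally show ?thesis .
      qed
      then have "0 \<le> (?U\<^sup>2 - ?X * ?U - ?X * k) / (?X * ?U\<^sup>2)" using pos by (simp add: algebra_simps)
      also have "\<dots> = (1 / ?X + 1 / ?U) + (u - x) * (- dJ u / ?U\<^sup>2) + (- 2 / ?U)"
        using pos by (simp add: k_def field_simps power2_eq_square)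
      finally show ?thesis .
    qed
    ultimately show "\<exists>y. (?g has_real_derivative y) (at u) \<and> 0 \<le> y" by blast
  qed fact
  then show ?thesis by simp
qed

text \<open>
  Let f be the right side minus the left side as a function of x, let h = y - x, let A be the base of
  the square on the left, and d \<ge> 0 the drop of J' from x to the midpoint. Then
  f' = 2 (A d - lam h) and f(y) = 0. The trapezoidal bound for d gives f' \<le> 0
  wherever J is not larger at the midpoint than at x. If f'(z) > 0 at some z, then J increases up to
  the midpoint on all of [1/2, z], and there A d / h decreases, so f' > 0 on [1/2, z] as well.
  Hence f increases first and decreases afterwards, and its minimum over [1/2, y] is attained
  at an end.
\<close>

lemma J_two_point_from_half:
  assumes lam: "1 \<le> lam" and y: "y \<le> 1"
    and half: "(2 * J ((1/2 + y) / 2) - J (1/2))\<^sup>2 \<le> lam * (y - 1/2)\<^sup>2 + (J y)\<^sup>2"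
    and x: "1/2 \<le> x" "x \<le> y"
  shows "(2 * J ((x + y) / 2) - J x)\<^sup>2 \<le> lam * (y - x)\<^sup>2 + (J y)\<^sup>2"
proof (cases "x = y")
  case True
  then show ?thesis by simp
next
  case False
  with x have xy: "x < y" by simp
  define A where "A = (\<lambda>v. 2 * Je ((v + y) / 2) - Je v)"
  define d where "d = (\<lambda>v. dJ v - dJ ((v + y) / 2))"
  define f where "f = (\<lambda>v. lam * (y - v)\<^sup>2 + (J y)\<^sup>2 - (2 * J ((v + y) / 2) - J v)\<^sup>2)"
  have mid: "1/2 \<le> (v + y) / 2" "v \<le> (v + y) / 2" "(v + y) / 2 < 1" "v < 1"
    if "1/2 \<le> v" "v < y" for v using that y by auto
  have DA: "(A has_real_derivative - d v) (at v)"
    and Dd: "(d has_real_derivative - 2 / Je v + 1 / Je ((v + y) / 2)) (at v)"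
    if v: "1/2 \<le> v" "v < y" for v
  proof -
    have m: "((\<lambda>v. (v + y) / 2) has_real_derivative 1/2) (at v)"
      by (auto intro!: derivative_eq_intros)
    note DERIV_chain2[OF Je_deriv[OF mid(1,3)[OF v]] m] DERIV_chain2[OF dJ_deriv[OF mid(1,3)[OF v]] m]
      Je_deriv[OF v(1) mid(4)[OF v]] dJ_deriv[OF v(1) mid(4)[OF v]]
    note D = this
    show "(A has_real_derivative - d v) (at v)"
      unfolding A_def d_def by (rule DERIV_cong[OF DERIV_diff[OF DERIV_cmult[OF D(1)] D(3)]]) simp
    show "(d has_real_derivative - 2 / Je v + 1 / Je ((v + y) / 2)) (at v)"
      unfolding d_def by (rule DERIV_cong[OF DERIV_diff[OF D(4) D(2)]]) simp
  qed
  have cont: "continuous_on {1/2..y} f"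
    unfolding f_def using y
    by (intro continuous_intros continuous_on_compose2[OF continuous_J]) auto
  have Df: "(f has_real_derivative 2 * (A v * d v - lam * (y - v))) (at v)" if v: "1/2 < v" "v < y" for v
  proof -
    have "((\<lambda>v. lam * (y - v)\<^sup>2 + (J y)\<^sup>2 - (A v)\<^sup>2) has_real_derivative 2 * (A v * d v - lam * (y - v))) (at v)"
      using DA[of v] v by (auto intro!: derivative_eq_intros simp: algebra_simps)
    then show ?thesis
    proof (rule has_field_derivative_transform_within_open[where S="{1/2<..<y}"])
      fix u assume u: "u \<in> {1/2<..<y}"
      then have "1/2 \<le> u" "u < y" by auto
      from mid[OF this] this show "lam * (y - u)\<^sup>2 + (J y)\<^sup>2 - (A u)\<^sup>2 = f u"
        by (simp add: f_def A_def J_eq_Je)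
    qed (use v in auto)
  qed
  have d_nonneg: "0 \<le> d v" and d_le: "d v \<le> (y - v) / 2 * (1 / Je v + 1 / Je ((v + y) / 2))"
    if v: "1/2 \<le> v" "v < y" for v
  proof -
    show "0 \<le> d v" using dJ_antimono[OF v(1) mid(2,3)[OF v]] by (simp add: d_def)
    have "(v + y) / 2 - v = (y - v) / 2" by (simp add: field_simps)
    then show "d v \<le> (y - v) / 2 * (1 / Je v + 1 / Je ((v + y) / 2))"
      using dJ_trapezoid[OF v(1) mid(2,3)[OF v]] by (simp add: d_def)
  qed
  have down: "A v * d v \<le> lam * (y - v)" if v: "1/2 \<le> v" "v < y" and le: "Je ((v + y) / 2) \<le> Je v" for v
  proof -
    define X M where XM: "X = Je v" "M = Je ((v + y) / 2)"
    have pos: "0 < X" "0 < M" by (simp_all add: XM Je_pos)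
    have A: "A v = 2 * M - X" by (simp add: A_def XM)
    have "A v * d v \<le> y - v"
    proof (cases "A v \<le> 0")
      case True
      then show ?thesis using d_nonneg[OF v] v by (smt (verit) mult_nonpos_nonneg)
    next
      case False
      then have "A v * d v \<le> A v * ((y - v) / 2 * (1 / X + 1 / M))"
        using d_le[OF v] by (intro mult_left_mono) (auto simp: XM)
      also have "\<dots> = (y - v) * ((2 * M - X) * (X + M) / (2 * X * M))"
        using pos by (simp add: A field_simps)
      also have "\<dots> \<le> (y - v) * 1"
      proof (rule mult_left_mono)
        have "(2 * M + X) * (M - X) \<le> 0" using pos le by (intro mult_nonneg_nonpos) (auto simp: XM)
        then have "(2 * M - X) * (X + M) \<le> 2 * X * M" by (simp add: algebra_simps)
        then show "(2 * M - X) * (X + M) / (2 * X * M) \<le> 1" using pos by simp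
      qed (use v in simp)
      finally show ?thesis by simp
    qed
    also have "\<dots> \<le> lam * (y - v)" using lam v by (simp add: mult_right_le_one_le)
    finally show ?thesis .
  qed
  have "0 \<le> f x"
  proof (cases "\<exists>v. x \<le> v \<and> v < y \<and> lam * (y - v) < A v * d v")
    case False
    have "f y \<le> f x"
    proof (rule DERIV_nonpos_imp_decreasing_open[where a=x and b=y and f=f])
      show "x \<le> y" using xy by simp
      show "continuous_on {x..y} f" by (rule continuous_on_subset[OF cont]) (use x in auto)
      fix v assume v: "x < v" "v < y"
      then have "A v * d v \<le> lam * (y - v)" using False by (meson less_imp_le not_less)
      then show "\<exists>D. (f has_real_derivative D) (at v) \<and> D \<le> 0"
        using Df[of v] v x by (intro exI[of _ "2 * (A v * d v - lam * (y - v))"] conjI) (auto simp: not_less)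
    qed
    moreover have "f y = 0" by (simp add: f_def)
    ultimately show ?thesis by simp
  next
    case True
    then obtain z where z: "x \<le> z" "z < y" "lam * (y - z) < A z * d z" by blast
    have z2: "1/2 \<le> z" using x z by simp
    have Mz: "Je z < Je ((z + y) / 2)" using down[OF z2 z(2)] z(3) by (meson not_less)
    then have dz: "0 < dJ z"
      using Je_concave(1)[OF z2 mid(2,3)[OF z2 z(2)]] z(2) by (smt (verit) mult_nonpos_nonneg mid(2) z2)
    have M_ge: "Je v \<le> Je ((v + y) / 2)" if v: "1/2 \<le> v" "v \<le> z" for v
    proof -
      let ?k = "\<lambda>v. Je ((v + y) / 2) - Je v"
      have "?k z \<le> ?k v"
      proof (rule DERIV_nonpos_imp_nonincreasing[where a=v and b=z and f="?k"])
        fix u assume u: "v \<le> u" "u \<le> z"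
        have u': "1/2 \<le> u" "u < y" using u v z by auto
        have m: "((\<lambda>v. (v + y) / 2) has_real_derivative 1/2) (at u)"
          by (auto intro!: derivative_eq_intros)
        have D: "(?k has_real_derivative dJ ((u + y) / 2) * (1/2) - dJ u) (at u)"
          by (rule DERIV_diff[OF DERIV_chain2[OF Je_deriv[OF mid(1,3)[OF u']] m] Je_deriv[OF u'(1) mid(4)[OF u']]])
        have "dJ z \<le> dJ u" by (rule dJ_antimono) (use u u' z y in auto)
        moreover have "dJ ((u + y) / 2) \<le> dJ u" by (rule dJ_antimono[OF u'(1) mid(2,3)[OF u']])
        ultimately have "dJ ((u + y) / 2) * (1/2) - dJ u \<le> 0" using dz by linarith
        with D show "\<exists>D. (?k has_real_derivative D) (at u) \<and> D \<le> 0" by blast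
      qed (use v in simp)
      then show ?thesis using Mz by simp
    qed
    \<comment> \<open>The quotient A d / h decreases on [1/2, z], because the trapezoidal bound gives
        A d \<le> h A (1 / J u + 1 / J ((u + y) / 2)) / 2.\<close>
    have up: "lam * (y - v) \<le> A v * d v" if v: "1/2 \<le> v" "v \<le> z" for v
    proof -
      let ?q = "\<lambda>v. A v * d v / (y - v)"
      have "?q z \<le> ?q v"
      proof (rule DERIV_nonpos_imp_nonincreasing[where a=v and b=z and f="?q"])
        fix u assume u: "v \<le> u" "u \<le> z"
        have u': "1/2 \<le> u" "u < y" using u v z by auto
        define X M where XM: "X = Je u" "M = Je ((u + y) / 2)"
        have pos: "0 < X" "X \<le> M" using M_ge[of u] u' u by (simp_all add: XM Je_pos)
        have A: "A u = 2 * M - X" by (simp add: A_def XM)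
        let ?num = "(- d u * d u + (- 2 / X + 1 / M) * A u) * (y - u) - A u * d u * (0 - 1)"
        have "(?q has_real_derivative ?num / ((y - u) * (y - u))) (at u)"
          unfolding XM
          by (intro DERIV_divide DERIV_mult DA Dd DERIV_diff DERIV_const DERIV_ident u') (use u' in simp)
        moreover have "?num \<le> 0"
        proof -
          have "A u * d u \<le> A u * ((y - u) / 2 * (1 / X + 1 / M))"
            using d_le[OF u'] pos by (intro mult_left_mono) (auto simp: XM A)
          then have "?num \<le> (- (d u)\<^sup>2 + (- 2 / X + 1 / M) * A u) * (y - u) + A u * ((y - u) / 2 * (1 / X + 1 / M))"
            by (simp add: power2_eq_square)
          also have "\<dots> = (y - u) * (- (d u)\<^sup>2 - 3/2 * A u * ((M - X) / (X * M)))"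
            using pos by (simp add: field_simps)
          also have "\<dots> \<le> 0"
          proof (rule mult_nonneg_nonpos)
            have "0 \<le> 3/2 * A u * ((M - X) / (X * M))"
              using pos by (intro mult_nonneg_nonneg divide_nonneg_nonneg) (auto simp: A)
            then show "- (d u)\<^sup>2 - 3/2 * A u * ((M - X) / (X * M)) \<le> 0" by (smt (verit) zero_le_power2)
          qed (use u' in simp)
          finally show ?thesis .
        qed
        then have "?num / ((y - u) * (y - u)) \<le> 0" using u' by (intro divide_nonpos_nonneg) auto
        ultimately show "\<exists>D. (?q has_real_derivative D) (at u) \<and> D \<le> 0" by blast
      qed (use v in simp)
      moreover have "lam < ?q z" using z by (simp add: pos_less_divide_eq)
      ultimately have "lam \<le> A v * d v / (y - v)" by linarith
      then show ?thesis using v z by (simp add: pos_le_divide_eq)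
    qed
    have "f (1/2) \<le> f x"
    proof (rule DERIV_nonneg_imp_increasing_open[where a="1/2" and b=x and f=f])
      show "continuous_on {1/2..x} f" by (rule continuous_on_subset[OF cont]) (use xy in auto)
      fix v assume v: "1/2 < v" "v < x"
      then show "\<exists>D. (f has_real_derivative D) (at v) \<and> 0 \<le> D"
        using Df[of v] up[of v] z by (intro exI[of _ "2 * (A v * d v - lam * (y - v))"] conjI) auto
    qed (use x in simp)
    moreover have "0 \<le> f (1/2)" using half by (simp add: f_def)
    ultimately show ?thesis by simp
  qed
  then show ?thesis by (simp add: f_def)
qed


section \<open>The function b and the regions of the triangle\<close>

text \<open>
  For the exponents under consideration, e = 3 - 2 * 2^\<beta> lies between \<open>eL\<close> and \<open>eU\<close>. The other
  functions are the polynomial bounds for J, its derivative and L from above; the suffix P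
  marks their reified form.
\<close>

abbreviation eL :: real where "eL \<equiv> 1704/10000"
abbreviation eU :: real where "eU \<equiv> 1716/10000"

definition Jq :: "real \<Rightarrow> real" where "Jq t = 1/2 + 2069/10000 * t - 202/100 * t\<^sup>2"
definition Jr :: "real \<Rightarrow> real" where "Jr t = 1/2 + 2069/10000 * t - 2 * t\<^sup>2 + 2/10 * t ^ 3 - 15/10 * t ^ 4"
definition Ju :: "real \<Rightarrow> real" where "Ju t = 1/2 + 207/1000 * t - 2 * t\<^sup>2 + 276/1000 * t ^ 3"
definition dJl :: "real \<Rightarrow> real" where "dJl t = 2069/10000 - 4 * t + 8/10 * t\<^sup>2 - 6 * t ^ 3"
definition L16 :: "real \<Rightarrow> real" where "L16 x = x * (2 + 577/100 * (1/16 - x))"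
definition L8 :: "real \<Rightarrow> real" where "L8 x = x * (1732/1000 + 333/100 * (1/8 - x))"
definition L8' :: "real \<Rightarrow> real" where "L8' x = x * (1732/1000 - 3332/1000 * (x - 1/8))"
definition L4 :: "real \<Rightarrow> real" where "L4 x = x * (14142/10000 + 204/100 * (1/4 - x))"

abbreviation eLP :: pexp where "eLP \<equiv> PC 1704 10000"
abbreviation eUP :: pexp where "eUP \<equiv> PC 1716 10000"
definition QP :: "pexp \<Rightarrow> pexp \<Rightarrow> pexp" where
  "QP e n = PC 1 2 \<ominus> PC 2 3 \<otimes> e \<otimes> n \<ominus> PC 2 1 \<otimes> n \<up> 2 \<oplus> PC 8 3 \<otimes> e \<otimes> n \<up> 3"
definition "JqP = hornerP [(1,2), (2069,10000), (-202,100)]"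
definition "JrP = hornerP [(1,2), (2069,10000), (-2,1), (2,10), (-15,10)]"
definition "JuP = hornerP [(1,2), (207,1000), (-2,1), (276,1000)]"
definition "dJlP = hornerP [(2069,10000), (-4,1), (8,10), (-6,1)]"
definition "L8P x = x \<otimes> (PC 1732 1000 \<oplus> PC 333 100 \<otimes> (PC 1 8 \<ominus> x))"
definition "L8P' x = x \<otimes> (PC 1732 1000 \<ominus> PC 3332 1000 \<otimes> (x \<ominus> PC 1 8))"
definition "L4P x = x \<otimes> (PC 14142 10000 \<oplus> PC 204 100 \<otimes> (PC 1 4 \<ominus> x))"

lemma peval_pieces [simp]:
  "peval (QP e n) x y = Qn (peval e x y) (peval n x y)"
  "peval (JqP a) x y = Jq (peval a x y)" "peval (JrP a) x y = Jr (peval a x y)"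
  "peval (JuP a) x y = Ju (peval a x y)" "peval (dJlP a) x y = dJl (peval a x y)"
  "peval (L8P a) x y = L8 (peval a x y)"
  "peval (L8P' a) x y = L8' (peval a x y)" "peval (L4P a) x y = L4 (peval a x y)"
  by (simp_all add: QP_def Qn_def JqP_def Jq_def JrP_def Jr_def JuP_def Ju_def dJlP_def dJl_def
      L8P_def L8_def L8P'_def L8'_def L4P_def L4_def)
     (simp_all add: field_simps eval_nat_numeral)

definition midP :: pexp where "midP = PC 1 2 \<otimes> (PX \<oplus> PY)"

lemma peval_midP [simp]: "peval midP x y = (x + y) / 2"
  by (simp add: midP_def)

lemma J_pieces:
  "1/2 \<le> y \<Longrightarrow> y \<le> 7/10 \<Longrightarrow> Jq (y - 1/2) \<le> J y"
  "1/2 \<le> y \<Longrightarrow> y \<le> 8/10 \<Longrightarrow> Jr (y - 1/2) \<le> J y"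
  "1/2 \<le> y \<Longrightarrow> y \<le> 3/4 \<Longrightarrow> J y \<le> Ju (y - 1/2)"
  using J_ge_quadratic[of "y - 1/2"] J_ge_quartic[of "y - 1/2"] J_le_cubic[of "y - 1/2"]
  by (simp_all add: Jq_def Jr_def Ju_def)

lemma Jq_nonneg: "0 \<le> t \<Longrightarrow> t \<le> 2/10 \<Longrightarrow> 0 \<le> Jq t"
proof -
  assume t: "0 \<le> t" "t \<le> 2/10"
  have "positive_on Leaf (0, 2, 10) (0, 1, 1) (JqP PX)" by code_simp
  from positive_on[OF this, of t 0] t show ?thesis by simp
qed

lemma Jr_nonneg: "0 \<le> t \<Longrightarrow> t \<le> 3/10 \<Longrightarrow> 0 \<le> Jr t"
proof -
  assume t: "0 \<le> t" "t \<le> 3/10"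
  have "positive_on Leaf (0, 3, 10) (0, 1, 1) (JrP PX)" by code_simp
  from positive_on[OF this, of t 0] t show ?thesis by simp
qed

lemma Qn_antimono_e:
  assumes "e \<le> e'" "0 \<le> n" "n \<le> 1/2"
  shows "Qn e' n \<le> Qn e n"
proof -
  have "Qn e n - Qn e' n = 8/3 * ((e' - e) * n * (1/4 - n\<^sup>2))"
    by (simp add: Qn_def field_simps eval_nat_numeral)
  moreover have "n\<^sup>2 \<le> (1/2)\<^sup>2" using assms by (intro power_mono)
  then have "0 \<le> (e' - e) * n * (1/4 - n\<^sup>2)"
    using assms by (intro mult_nonneg_nonneg) (auto simp: power2_eq_square)
  ultimately show ?thesis by simp
qed

text \<open>
  The common part of the two norms. For \<beta> = 1/2, everything but \<open>N_half\<close> is also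
  true of the Euclidean norm. \<open>N_ge_sum\<close> is the bound by the tangent on the diagonal, where it is sharp for the p-norm. \<open>N_half\<close>
  asks for a factor \<open>lam\<close> that makes the inequality true at (1/2, 1/2 + t) and that the norm affords for
  all distances up to t; the factor may depend on t.
\<close>

locale hamming_norm =
  fixes \<beta> :: real and N :: "real \<Rightarrow> real \<Rightarrow> real"
  assumes \<beta>: "1/2 \<le> \<beta>" "\<beta> \<le> 50057/100000"
    and N_nonneg: "0 \<le> N h b"
    and N_ge_2: "0 \<le> h \<Longrightarrow> 0 \<le> b \<Longrightarrow> h\<^sup>2 + b\<^sup>2 \<le> (N h b)\<^sup>2"
    and N_incr: "0 < h \<Longrightarrow> h \<le> h' \<Longrightarrow> 0 \<le> b \<Longrightarrow> (N h b)\<^sup>2 - h\<^sup>2 \<le> (N h' b)\<^sup>2 - h'\<^sup>2"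
    and N_ge_p: "0 \<le> h \<Longrightarrow> 0 \<le> b \<Longrightarrow> (h powr (1 / \<beta>) + b powr (1 / \<beta>)) powr \<beta> \<le> N h b"
    and N_ge_sum: "0 \<le> h \<Longrightarrow> 0 \<le> b \<Longrightarrow> 2 powr \<beta> / 2 * (h + b) \<le> N h b"
    and N_half: "0 \<le> t \<Longrightarrow> t \<le> 1/2 \<Longrightarrow> \<exists>lam\<ge>1.
        (2 * J (1/2 + t / 2) - 1/2)\<^sup>2 \<le> lam * t\<^sup>2 + (J (1/2 + t))\<^sup>2 \<and>
        (\<forall>h\<in>{0..t}. lam * h\<^sup>2 + (J (1/2 + t))\<^sup>2 \<le> (N h (J (1/2 + t)))\<^sup>2)"
begin

abbreviation b :: "real \<Rightarrow> real" where "b \<equiv> b_beta \<beta>"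
abbreviation \<theta> :: real where "\<theta> \<equiv> 2 powr \<beta>"
definition \<eta> :: real where "\<eta> = 3 - 2 * \<theta>"

definition good :: "real \<Rightarrow> real \<Rightarrow> bool" where
  "good x y \<longleftrightarrow> 0 \<le> N (y - x) (b y) + b x - 2 * b ((x + y) / 2) \<or> 0 \<le> G2_beta \<beta> b x y"

lemma \<theta>: "14142/10000 \<le> \<theta>" "\<theta> \<le> 14148/10000" "\<theta> = (3 - \<eta>) / 2"
  using theta_bounds \<beta> by (auto simp: \<eta>_def)

lemma \<eta>: "eL \<le> \<eta>" "\<eta> \<le> eU"
  using \<theta>(1,2) by (simp_all add: \<eta>_def)

lemma Q_eq: "Q_beta \<beta> x = Qn \<eta> (1/2 - x)"
  by (simp add: Q_beta_Qn \<eta>_def)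

lemma b_L: "0 \<le> x \<Longrightarrow> x \<le> 1/4 \<Longrightarrow> b x = L_beta \<beta> x"
  by (simp add: b_beta_def)

lemma b_0: "b 0 = 0"
  by (simp add: b_beta_def L_beta_def)

lemma b_Q: "1/4 \<le> x \<Longrightarrow> x \<le> 1/2 \<Longrightarrow> b x = Qn \<eta> (1/2 - x)"
proof (cases "x = 1/4")
  case True
  show ?thesis unfolding True using b_pieces(1)[of \<beta>] by (simp add: b_beta_def Q_eq)
qed (auto simp: b_beta_def Q_eq)

lemma b_J: "1/2 \<le> x \<Longrightarrow> b x = J x"
proof (cases "x = 1/2")
  case True
  show ?thesis unfolding True using b_pieces(2)[of \<beta>] by (simp add: b_beta_def)
qed (auto simp: b_beta_def)

lemma b_ge_Q: "0 < x \<Longrightarrow> x \<le> 1/2 \<Longrightarrow> Qn \<eta> (1/2 - x) \<le> b x"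
  using Q_le_L[OF \<beta>, of x] b_L[of x] b_Q[of x] Q_eq by (cases "x \<le> 1/4") auto

lemma b_ge_tangents:
  "0 \<le> x \<Longrightarrow> x \<le> 1/16 \<Longrightarrow> L16 x \<le> b x"
  "0 \<le> x \<Longrightarrow> x \<le> 1/8 \<Longrightarrow> L8 x \<le> b x"
  "1/8 \<le> x \<Longrightarrow> x \<le> 1/4 \<Longrightarrow> L8' x \<le> b x"
  "0 \<le> x \<Longrightarrow> x \<le> 1/4 \<Longrightarrow> L4 x \<le> b x"
proof -
  show "L16 x \<le> b x" if "0 \<le> x" "x \<le> 1/16"
    using L_beta_ge_quadratic(1)[OF \<beta>(1), of x] b_L[of x] that
    by (cases "x = 0") (auto simp: L16_def b_0)
  show "L8 x \<le> b x" if "0 \<le> x" "x \<le> 1/8"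
    using L_beta_ge_quadratic(2)[OF \<beta>(1), of x] b_L[of x] that
    by (cases "x = 0") (auto simp: L8_def b_0)
  show "L8' x \<le> b x" if "1/8 \<le> x" "x \<le> 1/4"
    using L_beta_ge_quadratic(3)[OF \<beta>(1), of x] b_L[of x] that by (auto simp: L8'_def)
  show "L4 x \<le> b x" if "0 \<le> x" "x \<le> 1/4"
    using L_beta_ge_quadratic(4)[OF \<beta>(1), of x] b_L[of x] that
    by (cases "x = 0") (auto simp: L4_def b_0)
qed

lemma b_Q_bounds:
  assumes "1/4 \<le> x" "x \<le> 1/2"
  shows "Qn eU (1/2 - x) \<le> b x" "b x \<le> Qn eL (1/2 - x)"
  using b_Q[OF assms] Qn_antimono_e[OF \<eta>(1), of "1/2 - x"] Qn_antimono_e[OF \<eta>(2), of "1/2 - x"] assms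
  by auto

lemma goodI_G2:
  assumes "1/2 \<le> y" "y \<le> 1" "j \<le> J y" "l \<le> b x" "b ((x + y) / 2) \<le> u"
    and "0 \<le> y - x + 4142/10000 * j + l - 2 * u"
  shows "good x y"
proof -
  have "4142/10000 * J y \<le> (\<theta> - 1) * J y"
    using \<theta>(1) J_nonneg[of y] assms(1,2) by (intro mult_right_mono) auto
  moreover have "G2_beta \<beta> b x y = y - x + (\<theta> - 1) * J y + b x - 2 * b ((x + y) / 2)"
    using b_J[OF assms(1)] by (simp add: G2_beta_def)
  ultimately have "0 \<le> G2_beta \<beta> b x y" using assms(3-6) by argo
  then show ?thesis by (simp add: good_def)
qed

lemma goodI_N:
  assumes "(2 * u - l)\<^sup>2 \<le> (N (y - x) (b y))\<^sup>2" "l \<le> b x" "b ((x + y) / 2) \<le> u"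
  shows "good x y"
proof -
  have "2 * u - l \<le> N (y - x) (b y)" using power2_le_imp_le[OF assms(1) N_nonneg] .
  then show ?thesis using assms(2,3) unfolding good_def by linarith
qed

lemma goodI_N2:
  assumes "x \<le> y" "0 \<le> j" "j \<le> b y" "l \<le> b x" "b ((x + y) / 2) \<le> u"
    and "(2 * u - l)\<^sup>2 \<le> (y - x)\<^sup>2 + j\<^sup>2"
  shows "good x y"
proof (rule goodI_N[OF _ assms(4,5)])
  have "(2 * u - l)\<^sup>2 \<le> (y - x)\<^sup>2 + j\<^sup>2" by fact
  also have "j\<^sup>2 \<le> (b y)\<^sup>2" using assms by (intro power_mono)
  also have "(y - x)\<^sup>2 + (b y)\<^sup>2 \<le> (N (y - x) (b y))\<^sup>2" by (rule N_ge_2) (use assms in auto)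
  finally show "(2 * u - l)\<^sup>2 \<le> (N (y - x) (b y))\<^sup>2" by simp
qed

subsection \<open>y at most 1/2\<close>

text \<open>
  In the names of this and the following lemmas, the letters are the pieces of b that
  decide about x and y.
\<close>

lemma good_LL:
  assumes "0 \<le> x" "x \<le> y" "y \<le> 1/2" "x + y \<le> 1/2"
  shows "good x y"
proof (cases "y = 0")
  case True
  then have "x = 0" using assms by simp
  with True show ?thesis using N_nonneg[of 0 0] by (simp add: good_def b_0)
next
  case False
  then have y: "0 < y" using assms by simp
  have ell: "0 \<le> ell y" using ell_antimono[of y "1/2"] ell_values(1) y assms by simp
  have Ly: "0 \<le> L_beta \<beta> y" using y by (simp add: L_beta_ell)
  have by_ge: "L_beta \<beta> y \<le> b y"
    using L_le_Q[OF \<beta>, of y] b_L[of y] b_Q[of y] Q_eq y assms by (cases "y \<le> 1/4") auto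
  have "((y - x) powr (1 / \<beta>) + L_beta \<beta> y powr (1 / \<beta>)) powr \<beta>
      \<le> ((y - x) powr (1 / \<beta>) + b y powr (1 / \<beta>)) powr \<beta>"
    using by_ge Ly \<beta> by (intro powr_mono2 add_left_mono) auto
  also have "\<dots> \<le> N (y - x) (b y)" using assms by_ge Ly by (intro N_ge_p) auto
  finally have "2 * L_beta \<beta> ((x + y) / 2) \<le> N (y - x) (b y) + L_beta \<beta> x"
    using L_two_point[of \<beta> x y] \<beta> assms y by simp
  then show ?thesis using b_L[of x] b_L[of "(x + y) / 2"] assms by (simp add: good_def)
qed

text \<open>
  Q is cubic, so its second difference with midpoint at distance a from 1/2 and step k is exactly
  - 4 (1 - 4 e a) k^2. The difference of the squares therefore has the factor k^2, and the inequality
  becomes (1 - 4 e a) S \<le> 1. The last part is the case k = a, in which the right point is 1/2.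
\<close>

lemma Q_difference:
  defines "S \<equiv> \<lambda>e a k. 2 * Qn e a + Qn e (a - k) - Qn e (a + k)"
  shows "(2 * k)\<^sup>2 + (Qn e (a - k))\<^sup>2 - (2 * Qn e a - Qn e (a + k))\<^sup>2 = 4 * k\<^sup>2 * (1 - (1 - 4 * e * a) * S e a k)"
    and "S e a k = 1 + 4/3 * e * (k - a) + 8 * a * k - 4 * a\<^sup>2 - 16 * e * a\<^sup>2 * k - 16/3 * e * (k ^ 3 - a ^ 3)"
    and "(1 - 4 * e * a) * S e a a = 1 + a * (- 4 * e + 4 * a - 32 * e * a\<^sup>2 + 64 * e\<^sup>2 * a ^ 3)"
proof -
  have D: "Qn e (a - k) - 2 * Qn e a + Qn e (a + k) = - (4 * (1 - 4 * e * a)) * k\<^sup>2"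
    unfolding Qn_def by (simp add: field_simps eval_nat_numeral)
  have "(2 * k)\<^sup>2 + (Qn e (a - k))\<^sup>2 - (2 * Qn e a - Qn e (a + k))\<^sup>2
      = 4 * k\<^sup>2 + (Qn e (a - k) - 2 * Qn e a + Qn e (a + k)) * S e a k"
    unfolding S_def by (simp add: algebra_simps power2_eq_square)
  then show "(2 * k)\<^sup>2 + (Qn e (a - k))\<^sup>2 - (2 * Qn e a - Qn e (a + k))\<^sup>2
      = 4 * k\<^sup>2 * (1 - (1 - 4 * e * a) * S e a k)"
    unfolding D by (simp add: algebra_simps)
  show *: "S e a k = 1 + 4/3 * e * (k - a) + 8 * a * k - 4 * a\<^sup>2 - 16 * e * a\<^sup>2 * k - 16/3 * e * (k ^ 3 - a ^ 3)" for k
    unfolding S_def Qn_def by (simp add: field_simps eval_nat_numeral)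
  show "(1 - 4 * e * a) * S e a a = 1 + a * (- 4 * e + 4 * a - 32 * e * a\<^sup>2 + 64 * e\<^sup>2 * a ^ 3)"
    unfolding * by (simp add: algebra_simps eval_nat_numeral)
qed

lemma Q_diagonal_le:
  assumes "0 \<le> a" "a \<le> 1/5"
  shows "- 4 * \<eta> + 4 * a - 32 * \<eta> * a\<^sup>2 + 64 * \<eta>\<^sup>2 * a ^ 3
    \<le> - 4 * eL + 4 * a - 32 * eL * a\<^sup>2 + 64 * eU\<^sup>2 * a ^ 3"
proof -
  have "32 * eL * a\<^sup>2 \<le> 32 * \<eta> * a\<^sup>2" using \<eta>(1) by (intro mult_right_mono) auto
  moreover have "64 * \<eta>\<^sup>2 * a ^ 3 \<le> 64 * eU\<^sup>2 * a ^ 3"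
    using \<eta> assms by (intro mult_right_mono mult_left_mono power_mono) auto
  ultimately show ?thesis using \<eta>(1) by linarith
qed

text \<open>
  By the previous lemmas the claim is (1 - 4 \<eta> a) S \<le> 1. For a \<le> 1/5 the left side is largest at
  k = a, where it equals 1 plus a multiple of a with negative cofactor. For larger a there is room, and
  \<eta> may be replaced by its bounds.
\<close>

lemma good_QQ:
  assumes "1/8 \<le> x" "x \<le> y" "y \<le> 1/2" "1/2 \<le> x + y"
  shows "good x y"
proof -
  define a where "a = 1/2 - (x + y) / 2"
  define k where "k = (y - x) / 2"
  have xy: "1/2 - x = a + k" "1/2 - y = a - k" "y - x = 2 * k" "1/2 - (x + y) / 2 = a"
    by (simp_all add: a_def k_def field_simps)
  have ak: "0 \<le> a" "a \<le> 1/4" "0 \<le> k" "k \<le> a" "k \<le> 3/8 - a"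
    using assms by (auto simp: a_def k_def field_simps)
  define S where "S = (\<lambda>k. 2 * Qn \<eta> a + Qn \<eta> (a - k) - Qn \<eta> (a + k))"
  have S: "S k = 1 + 4/3 * \<eta> * (k - a) + 8 * a * k - 4 * a\<^sup>2 - 16 * \<eta> * a\<^sup>2 * k - 16/3 * \<eta> * (k ^ 3 - a ^ 3)" for k
    using Q_difference(2)[of \<eta> a k] by (simp add: S_def)
  have "\<eta> * a \<le> eU * (1/4)" using \<eta> ak by (intro mult_mono) auto
  then have ea: "0 \<le> 1 - 4 * \<eta> * a" "\<eta> * a \<le> 1/16" by simp_all
  have "(1 - 4 * \<eta> * a) * S k \<le> 1"
  proof (cases "a \<le> 1/5")
    case True
    have "S k \<le> S a"
    proof -
      have "S a - S k = (a - k) * (4/3 * \<eta> + 8 * a - 16 * \<eta> * a\<^sup>2 - 16/3 * \<eta> * (a\<^sup>2 + a * k + k\<^sup>2))"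
        unfolding S by (simp add: field_simps eval_nat_numeral)
      moreover have "0 \<le> 4/3 * \<eta> + 8 * a - 16 * \<eta> * a\<^sup>2 - 16/3 * \<eta> * (a\<^sup>2 + a * k + k\<^sup>2)"
      proof -
        have "a * k \<le> a * a" "k * k \<le> a * a" using ak by (intro mult_mono; simp)+
        then have "16/3 * \<eta> * (a\<^sup>2 + a * k + k\<^sup>2) \<le> 16/3 * \<eta> * (3 * (a * a))"
          using \<eta>(1) by (intro mult_left_mono) (auto simp: power2_eq_square)
        also have "\<dots> = 16 * \<eta> * a\<^sup>2" by (simp add: power2_eq_square)
        finally have 1: "16/3 * \<eta> * (a\<^sup>2 + a * k + k\<^sup>2) \<le> 16 * \<eta> * a\<^sup>2" .
        have "a * (\<eta> * a) \<le> a * (1/16)" using ak ea by (intro mult_left_mono) auto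
        then have "16 * \<eta> * a\<^sup>2 \<le> a" by (simp add: power2_eq_square mult_ac)
        with 1 show ?thesis using \<eta>(1) ak(1) by linarith
      qed
      then have "0 \<le> (a - k) * (4/3 * \<eta> + 8 * a - 16 * \<eta> * a\<^sup>2 - 16/3 * \<eta> * (a\<^sup>2 + a * k + k\<^sup>2))"
        using ak by (intro mult_nonneg_nonneg) auto
      ultimately show ?thesis by linarith
    qed
    then have "(1 - 4 * \<eta> * a) * S k \<le> (1 - 4 * \<eta> * a) * S a" using ea by (intro mult_left_mono)
    also have "\<dots> = 1 + a * (- 4 * \<eta> + 4 * a - 32 * \<eta> * a\<^sup>2 + 64 * \<eta>\<^sup>2 * a ^ 3)"
      using Q_difference(3)[of \<eta> a] by (simp add: S_def)
    also have "\<dots> \<le> 1"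
    proof -
      have "positive_on (SplitX Leaf Leaf) (0, 1, 5) (0, 1, 1)
          (PC 4 1 \<otimes> eLP \<ominus> PC 4 1 \<otimes> PX \<oplus> PC 32 1 \<otimes> eLP \<otimes> PX \<up> 2 \<ominus> PC 64 1 \<otimes> eUP \<up> 2 \<otimes> PX \<up> 3)"
        by code_simp
      from positive_on[OF this, of a 0] ak True
      have "- 4 * eL + 4 * a - 32 * eL * a\<^sup>2 + 64 * eU\<^sup>2 * a ^ 3 \<le> 0" by simp
      then have "- 4 * \<eta> + 4 * a - 32 * \<eta> * a\<^sup>2 + 64 * \<eta>\<^sup>2 * a ^ 3 \<le> 0"
        using Q_diagonal_le[OF ak(1) True] by linarith
      then have "a * (- 4 * \<eta> + 4 * a - 32 * \<eta> * a\<^sup>2 + 64 * \<eta>\<^sup>2 * a ^ 3) \<le> 0"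
        using ak by (intro mult_nonneg_nonpos)
      then show ?thesis by simp
    qed
    finally show ?thesis .
  next
    case False
    define T where "T = 1 + 4/3 * (eU * k - eL * a) + 8 * a * k - 4 * a\<^sup>2 - 16 * eL * a\<^sup>2 * k
        + 16/3 * (eU * a ^ 3 - eL * k ^ 3)"
    have "S k \<le> T"
    proof -
      have "\<eta> * k \<le> eU * k" "eL * a \<le> \<eta> * a" "eL * (a\<^sup>2 * k) \<le> \<eta> * (a\<^sup>2 * k)" "\<eta> * a ^ 3 \<le> eU * a ^ 3"
        "eL * k ^ 3 \<le> \<eta> * k ^ 3"
        by (rule mult_right_mono, use \<eta> in simp, use ak in simp)+
      then show ?thesis unfolding S T_def by (simp add: field_simps)
    qed
    then have "(1 - 4 * \<eta> * a) * S k \<le> (1 - 4 * \<eta> * a) * T" using ea by (intro mult_left_mono)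
    also have "\<dots> \<le> 1"
    proof (cases "0 \<le> T")
      case True
      have "positive_on Leaf (4, 5, 20) (0, 7, 40)
          (PC 1 1 \<ominus> (PC 1 1 \<ominus> PC 4 1 \<otimes> eLP \<otimes> PX) \<otimes> (PC 1 1 \<oplus> PC 4 3 \<otimes> (eUP \<otimes> PY \<ominus> eLP \<otimes> PX) \<oplus> PC 8 1 \<otimes> PX \<otimes> PY
            \<ominus> PC 4 1 \<otimes> PX \<up> 2 \<ominus> PC 16 1 \<otimes> eLP \<otimes> PX \<up> 2 \<otimes> PY \<oplus> PC 16 3 \<otimes> (eUP \<otimes> PX \<up> 3 \<ominus> eLP \<otimes> PY \<up> 3)))"
        by code_simp
      from positive_on[OF this, of a k] ak False
      have "(1 - 4 * eL * a) * T \<le> 1" by (simp add: T_def)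
      moreover have "(1 - 4 * \<eta> * a) * T \<le> (1 - 4 * eL * a) * T"
      proof (rule mult_right_mono)
        have "eL * a \<le> \<eta> * a" using \<eta>(1) ak(1) by (rule mult_right_mono)
        then show "1 - 4 * \<eta> * a \<le> 1 - 4 * eL * a" by linarith
      qed fact
      ultimately show ?thesis by linarith
    next
      case False
      then have "(1 - 4 * \<eta> * a) * T \<le> 0" using ea by (intro mult_nonneg_nonpos) auto
      then show ?thesis by simp
    qed
    finally show ?thesis .
  qed
  then have "0 \<le> 4 * k\<^sup>2 * (1 - (1 - 4 * \<eta> * a) * S k)" by (intro mult_nonneg_nonneg) auto
  then have key: "(2 * Qn \<eta> a - Qn \<eta> (a + k))\<^sup>2 \<le> (2 * k)\<^sup>2 + (Qn \<eta> (a - k))\<^sup>2"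
    using Q_difference(1)[of k \<eta> a] by (simp add: S_def)
  have by_eq: "b y = Qn \<eta> (a - k)" using b_Q[of y] assms xy by simp
  have Q_pos: "0 \<le> Qn \<eta> (a - k)"
  proof -
    have "L_beta \<beta> y \<le> Qn \<eta> (a - k)" using L_le_Q[OF \<beta>, of y] Q_eq[of y] xy assms by simp
    moreover have "0 \<le> L_beta \<beta> y" using assms by (simp add: L_beta_ell)
    ultimately show ?thesis by simp
  qed
  show ?thesis
  proof (rule goodI_N2[OF assms(2) Q_pos])
    show "Qn \<eta> (a - k) \<le> b y" using by_eq by simp
    show "Qn \<eta> (a + k) \<le> b x" using b_ge_Q[of x] assms xy by simp
    show "b ((x + y) / 2) \<le> Qn \<eta> a" using b_Q[of "(x + y) / 2"] assms xy(4) by simp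
    show "(2 * Qn \<eta> a - Qn \<eta> (a + k))\<^sup>2 \<le> (y - x)\<^sup>2 + (Qn \<eta> (a - k))\<^sup>2"
      using key xy(3) by simp
  qed
qed

text \<open>
  At (0, 1/2) the bound \<open>N_ge_sum\<close> gives equality. The difference of the two sides is written as a
  combination of b x, x, t = 1/2 - y and x - t without constant term, and b x \<ge> 2 x outweighs the rest near
  this corner.
\<close>

lemma good_LQ:
  assumes "0 \<le> x" "x \<le> 1/8" "y \<le> 1/2" "1/2 \<le> x + y"
  shows "good x y"
proof -
  define t where "t = 1/2 - y"
  have t: "0 \<le> t" "t \<le> x" "y = 1/2 - t" using assms by (auto simp: t_def)
  define n where "n = 1/4 - (x - t) / 2"
  have n: "0 \<le> n" "1/2 - (x + y) / 2 = n" using t assms by (auto simp: n_def field_simps)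
  \<comment> \<open>(x - t) W \<eta> \<eta> is twice the increase of Q from 1/4 to the midpoint; the two occurrences
      of \<eta> are separated so that they can be bounded in opposite directions.\<close>
  define W where "W = (\<lambda>e e'. 1 + 2/3 * e - (x - t) - 8/3 * e' * (n * n + n * (1/4) + 1/16))"
  define T where "T = 7074/10000 * (1 + 2/3 * eU + 2 * t)"
  have yt: "1/2 - y = t" by (simp add: t_def)
  have by_eq: "b y = Qn \<eta> t" using b_Q[of y] assms unfolding yt by simp
  have "1/4 \<le> (x + y) / 2" "(x + y) / 2 \<le> 1/2" using assms by auto
  from b_Q[OF this] have bm: "b ((x + y) / 2) = Qn \<eta> n" unfolding n(2) .
  have Qt: "0 \<le> Qn \<eta> t"
  proof -
    have "L_beta \<beta> y \<le> Qn \<eta> t" using L_le_Q[OF \<beta>, of y] assms unfolding Q_eq[of y] yt by simp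
    moreover have "0 \<le> L_beta \<beta> y" using assms by (simp add: L_beta_ell)
    ultimately show ?thesis by simp
  qed
  have id: "\<theta> / 2 * (y - x + Qn \<eta> t) - 2 * Qn \<eta> n
      = - x * (\<theta> / 2) - \<theta> / 2 * t * (1 + 2/3 * \<eta> + 2 * t - 8/3 * \<eta> * t\<^sup>2) - (x - t) * W \<eta> \<eta>"
    unfolding \<theta>(3) t(3) W_def n_def Qn_def by (simp add: field_simps eval_nat_numeral)
  have lower: "b x - x * (7074/10000) - t * T - (x - t) * W \<eta> \<eta>
      \<le> N (y - x) (b y) + b x - 2 * b ((x + y) / 2)"
  proof -
    have "\<theta> / 2 * (y - x + Qn \<eta> t) \<le> N (y - x) (b y)"
      unfolding by_eq using assms Qt by (intro N_ge_sum) auto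
    moreover have "x * (\<theta> / 2) \<le> x * (7074/10000)" using \<theta> assms by (intro mult_left_mono) auto
    moreover have "\<theta> / 2 * t * (1 + 2/3 * \<eta> + 2 * t - 8/3 * \<eta> * t\<^sup>2) \<le> t * T"
    proof -
      have "1 + 2/3 * \<eta> + 2 * t - 8/3 * \<eta> * t\<^sup>2 \<le> 1 + 2/3 * eU + 2 * t"
      proof -
        have "0 \<le> 8/3 * \<eta> * t\<^sup>2" using \<eta>(1) by (intro mult_nonneg_nonneg) auto
        then show ?thesis using \<eta>(2) by linarith
      qed
      then have "(\<theta> / 2 * t) * (1 + 2/3 * \<eta> + 2 * t - 8/3 * \<eta> * t\<^sup>2) \<le> (\<theta> / 2 * t) * (1 + 2/3 * eU + 2 * t)"
        using t by (intro mult_left_mono) auto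
      also have "\<dots> \<le> (7074/10000 * t) * (1 + 2/3 * eU + 2 * t)"
        using t \<theta> by (intro mult_right_mono) auto
      finally show ?thesis by (simp add: T_def mult.commute mult.left_commute)
    qed
    ultimately show ?thesis using id bm by linarith
  qed
  have Wb: "W eL eU \<le> W \<eta> \<eta>" "W \<eta> \<eta> \<le> W eU eL"
  proof -
    have pos: "0 \<le> n * n + n * (1/4) + 1/16" using n by simp
    have "\<eta> * (n * n + n * (1/4) + 1/16) \<le> eU * (n * n + n * (1/4) + 1/16)"
      "eL * (n * n + n * (1/4) + 1/16) \<le> \<eta> * (n * n + n * (1/4) + 1/16)"
      using mult_right_mono[OF \<eta>(1) pos] mult_right_mono[OF \<eta>(2) pos] by simp_all
    then show "W eL eU \<le> W \<eta> \<eta>" "W \<eta> \<eta> \<le> W eU eL"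
      unfolding W_def using \<eta> by linarith+
  qed
  let ?n = "PC 1 4 \<ominus> PC 1 2 \<otimes> (PX \<ominus> PY)"
  let ?W = "\<lambda>e e'. PC 1 1 \<oplus> PC 2 3 \<otimes> e \<ominus> (PX \<ominus> PY) \<ominus> PC 8 3 \<otimes> e' \<otimes> (?n \<otimes> ?n \<oplus> ?n \<otimes> PC 1 4 \<oplus> PC 1 16)"
  let ?T = "PC 7074 10000 \<otimes> (PC 1 1 \<oplus> PC 2 3 \<otimes> eUP \<oplus> PC 2 1 \<otimes> PY)"
  have "0 \<le> b x - x * (7074/10000) - t * T - (x - t) * W \<eta> \<eta>"
  proof (cases "x \<le> 1/16")
    case True
    have "positive_on Leaf (0, 1, 16) (0, 1, 16) (PC 2 1 \<ominus> PC 7074 10000 \<ominus> ?W eUP eLP)" by code_simp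
    from positive_on[OF this, of x t] assms True t
    have 1: "0 < 2 - 7074/10000 - W eU eL" by (simp add: W_def n_def field_simps)
    have "positive_on Leaf (0, 1, 16) (0, 1, 16) (?W eLP eUP \<ominus> ?T)" by code_simp
    from positive_on[OF this, of x t] assms True t
    have 2: "0 < W eL eU - T" by (simp add: W_def n_def T_def field_simps)
    have "x * 2 \<le> b x"
    proof -
      have "x * 2 \<le> L16 x" unfolding L16_def using assms True by (intro mult_left_mono) auto
      then show ?thesis using b_ge_tangents(1)[of x] assms True by simp
    qed
    moreover have "0 \<le> x * (2 - 7074/10000 - W \<eta> \<eta>) + t * (W \<eta> \<eta> - T)"
      using 1 2 Wb t assms by (intro add_nonneg_nonneg mult_nonneg_nonneg) auto
    ultimately show ?thesis by (simp add: algebra_simps)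
  next
    case False
    have "positive_on (SplitX Leaf Leaf) (1, 2, 16) (0, 1, 8)
        (L8P PX \<ominus> PX \<otimes> PC 7074 10000 \<ominus> PY \<otimes> ?T \<ominus> (PX \<ominus> PY) \<otimes> ?W eUP eLP)" by code_simp
    from positive_on[OF this, of x t] assms False t
    have "0 < L8 x - x * (7074/10000) - t * T - (x - t) * W eU eL" by (simp add: W_def n_def T_def field_simps)
    moreover have "(x - t) * W \<eta> \<eta> \<le> (x - t) * W eU eL" using Wb t by (intro mult_left_mono) auto
    moreover have "L8 x \<le> b x" using b_ge_tangents(2)[of x] assms by simp
    ultimately show ?thesis by linarith
  qed
  with lower show ?thesis unfolding good_def by linarith
qed

lemma good_left:
  assumes "0 \<le> x" "x \<le> y" "y \<le> 1/2"
  shows "good x y"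
  using good_LL[of x y] good_QQ[of x y] good_LQ[of x y] assms by linarith

end


definition midQ :: pexp where "midQ = QP eLP (PC 1 2 \<ominus> midP)"

definition midJ :: pexp where "midJ = JuP (midP \<ominus> PC 1 2)"

context hamming_norm
begin

subsection \<open>y at least 1/2, x in the range of L\<close>

lemma Qn_le_line: "0 \<le> n \<Longrightarrow> n \<le> 1/2 \<Longrightarrow> Qn \<eta> n \<le> 1/2 - 1136/10000 * n"
proof -
  assume n: "0 \<le> n" "n \<le> 1/2"
  have "eL * n \<le> \<eta> * n" using \<eta>(1) n(1) by (rule mult_right_mono)
  moreover have "8/3 * \<eta> * n ^ 3 \<le> 2 * n\<^sup>2"
  proof -
    have "\<eta> * n \<le> 1 * (1/2)" using \<eta> n by (intro mult_mono) auto
    then have "8/3 * (\<eta> * n) \<le> 2" by linarith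
    then have "n\<^sup>2 * (8/3 * (\<eta> * n)) \<le> n\<^sup>2 * 2" by (intro mult_left_mono) auto
    then show ?thesis by (simp add: power2_eq_square power3_eq_cube mult_ac)
  qed
  ultimately show ?thesis unfolding Qn_def by linarith
qed

text \<open>
  The second alternative on the edge x = 0. It is an equality at y = 1/2, so the factor t = y - 1/2 is
  split off, and again at y = 1, where the bound for J that is linear in 1 - y is used.
\<close>

lemma G2_edge:
  assumes "1/2 \<le> y" "y \<le> 1"
  shows "0 \<le> y + (\<theta> - 1) * J y - 2 * Qn \<eta> (1/2 - y / 2)"
proof (cases "y \<le> 9/10")
  case True
  define t where "t = y - 1/2"
  have t: "0 \<le> t" "t \<le> 4/10" using assms True by (auto simp: t_def)
  define q where "q = 20697/100000 + t * pL t"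
  define m where "m = 1/4 - t / 2"
  have "t * q \<le> t * (s0 + t * pL t)"
    using t s0_bounds by (intro mult_left_mono) (auto simp: q_def)
  then have "1/2 + t * q \<le> J y"
    using J_bounds(1)[of t] t by (simp add: JL_def t_def)
  then have "(\<theta> - 1) * (1/2 + t * q) \<le> (\<theta> - 1) * J y" using \<theta>(1) by (intro mult_left_mono) auto
  moreover have "y + (\<theta> - 1) * (1/2 + t * q) - 2 * Qn \<eta> m
      = t * (1 + (1 - \<eta>) * (1/2) * q - 2/3 * \<eta> - 2 * (m + 1/4) + 8/3 * \<eta> * (m * m + m * (1/4) + 1/16))"
    unfolding \<theta>(3) m_def Qn_def t_def by (simp add: field_simps eval_nat_numeral)
  moreover have "0 \<le> t * (1 + (1 - \<eta>) * (1/2) * q - 2/3 * \<eta> - 2 * (m + 1/4) + 8/3 * \<eta> * (m * m + m * (1/4) + 1/16))"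
  proof -
    let ?m = "PC 1 4 \<ominus> PC 1 2 \<otimes> PX" and ?q = "PC 20697 100000 \<oplus> PX \<otimes> pLP PX"
    have "positive_on Leaf (0, 4, 10) (1704, 1716, 10000)
      (PC 1 1 \<oplus> (PC 1 1 \<ominus> PY) \<otimes> PC 1 2 \<otimes> ?q \<ominus> PC 2 3 \<otimes> PY \<ominus> PC 2 1 \<otimes> (?m \<oplus> PC 1 4)
        \<oplus> PC 8 3 \<otimes> PY \<otimes> (?m \<otimes> ?m \<oplus> ?m \<otimes> PC 1 4 \<oplus> PC 1 16))" by code_simp
    from positive_on[OF this, of t \<eta>] t \<eta>
    have "0 < 1 + (1 - \<eta>) * (1/2) * q - 2/3 * \<eta> - 2 * (m + 1/4) + 8/3 * \<eta> * (m * m + m * (1/4) + 1/16)"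
      by (simp add: q_def m_def field_simps)
    then show ?thesis using t by (intro mult_nonneg_nonneg) auto
  qed
  moreover have "1/2 - y / 2 = m" by (simp add: m_def t_def field_simps)
  ultimately show ?thesis by simp
next
  case False
  have "22/10 * (1 - y) \<le> J y" using J_ge_end[of y] assms False by simp
  then have "4142/10000 * (22/10 * (1 - y)) \<le> (\<theta> - 1) * J y"
    using \<theta>(1) assms by (intro mult_mono) auto
  moreover have "Qn \<eta> (1/2 - y / 2) \<le> 1/2 - 1136/10000 * (1/2 - y / 2)"
    by (rule Qn_le_line) (use assms False in auto)
  ultimately show ?thesis using assms by (simp add: field_simps)
qed

text \<open>
  Starting from the edge x = 0, the increase of b x - x outweighs the increase of 2 b at the midpoint.
\<close>

lemma good_LJ_strip:
  assumes "0 \<le> x" "x \<le> 1/16" "1/2 \<le> y" "y \<le> 15/16"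
  shows "good x y"
proof -
  define m where "m = 1/2 - y / 2"
  define n where "n = m - x / 2"
  have mn: "0 \<le> n" "n \<le> m" "m \<le> 1/4" "1/2 - (x + y) / 2 = n"
    using assms by (auto simp: m_def n_def field_simps)
  have "1/4 \<le> (x + y) / 2" "(x + y) / 2 \<le> 1/2" using assms by auto
  from b_Q[OF this] have bm: "b ((x + y) / 2) = Qn \<eta> n" unfolding mn(4) .
  define K where "K = m * m + m * n + n * n"
  have K: "0 \<le> K" "K \<le> 3/16"
  proof -
    have "m * m \<le> 1/4 * (1/4)" "m * n \<le> 1/4 * (1/4)" "n * n \<le> 1/4 * (1/4)"
      using mn by (intro mult_mono; simp)+
    then show "K \<le> 3/16" by (simp add: K_def)
    show "0 \<le> K" using mn by (simp add: K_def)
  qed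
  have "\<eta> * (2/3 - 8/3 * K) \<le> eU * (2/3 - 8/3 * K)" using \<eta>(2) K by (intro mult_right_mono) auto
  moreover have "2 * (Qn \<eta> n - Qn \<eta> m) = x * (\<eta> * (2/3 - 8/3 * K) + 2 * (m + n))"
    unfolding K_def n_def Qn_def by (simp add: field_simps eval_nat_numeral)
  moreover have "x * (\<eta> * (2/3 - 8/3 * K) + 2 * (m + n)) \<le> x * (eU * (2/3 - 8/3 * K) + 2 * (m + n))"
    using assms(1) calculation(1) by (intro mult_left_mono) linarith+
  ultimately have 1: "2 * (Qn \<eta> n - Qn \<eta> m) \<le> x * (eU * (2/3 - 8/3 * K) + 2 * (m + n))"
    by (simp only:)
  let ?m = "PC 1 2 \<ominus> PC 1 2 \<otimes> PY"
  let ?n = "?m \<ominus> PC 1 2 \<otimes> PX"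
  have "positive_on Leaf (0, 1, 16) (8, 15, 16)
      (PC 1 1 \<oplus> PC 577 100 \<otimes> (PC 1 16 \<ominus> PX) \<ominus> (eUP \<otimes> (PC 2 3 \<ominus> PC 8 3 \<otimes> (?m \<otimes> ?m \<oplus> ?m \<otimes> ?n \<oplus> ?n \<otimes> ?n))
        \<oplus> PC 2 1 \<otimes> (?m \<oplus> ?n)))" by code_simp
  from positive_on[OF this, of x y] assms
  have "0 < 1 + 577/100 * (1/16 - x) - (eU * (2/3 - 8/3 * K) + 2 * (m + n))"
    by (simp add: K_def n_def m_def field_simps)
  then have "0 \<le> x * (1 + 577/100 * (1/16 - x) - (eU * (2/3 - 8/3 * K) + 2 * (m + n)))"
    using assms by (intro mult_nonneg_nonneg) auto
  then have "x * (eU * (2/3 - 8/3 * K) + 2 * (m + n)) \<le> L16 x - x"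
    by (simp add: L16_def field_simps)
  with 1 have "2 * (Qn \<eta> n - Qn \<eta> m) \<le> L16 x - x" by (rule order_trans)
  moreover have "L16 x \<le> b x" by (rule b_ge_tangents(1)[OF assms(1,2)])
  moreover have "0 \<le> y + (\<theta> - 1) * J y - 2 * Qn \<eta> m"
    using G2_edge[of y] assms by (simp add: m_def)
  moreover have "G2_beta \<beta> b x y = y - x + (\<theta> - 1) * J y + b x - 2 * b ((x + y) / 2)"
    using b_J[OF assms(3)] by (simp add: G2_beta_def)
  ultimately have "0 \<le> G2_beta \<beta> b x y" using bm by simp
  then show ?thesis by (simp add: good_def)
qed

text \<open>
  All quantities are replaced by bounds that are linear on either side of the line x + y = 1 and
  exact at (0, 1).
\<close>

lemma good_LJ_corner:
  assumes "0 \<le> x" "x \<le> 1/16" "15/16 \<le> y" "y \<le> 1"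
  shows "good x y"
proof (rule goodI_G2[where u = "1/2 + max (1136/10000 * ((x + y) / 2 - 1/2)) (207/1000 * ((x + y) / 2 - 1/2))"])
  show "1/2 \<le> y" "y \<le> 1" using assms by auto
  show "22/10 * (1 - y) \<le> J y" using J_ge_end[of y] assms by simp
  show "2 * x \<le> b x"
  proof -
    have "x * 2 \<le> L16 x" unfolding L16_def using assms by (intro mult_left_mono) auto
    then show ?thesis using b_ge_tangents(1)[of x] assms by simp
  qed
  show "b ((x + y) / 2) \<le> 1/2 + max (1136/10000 * ((x + y) / 2 - 1/2)) (207/1000 * ((x + y) / 2 - 1/2))"
  proof (cases "(x + y) / 2 \<le> 1/2")
    case True
    then have "b ((x + y) / 2) \<le> 1/2 - 1136/10000 * (1/2 - (x + y) / 2)"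
      using b_Q[of "(x + y) / 2"] Qn_le_line[of "1/2 - (x + y) / 2"] assms by simp
    also have "\<dots> = 1/2 + 1136/10000 * ((x + y) / 2 - 1/2)" by (simp add: field_simps)
    finally show ?thesis by linarith
  next
    case False
    define r where "r = (x + y) / 2 - 1/2"
    have r: "0 \<le> r" "r \<le> 1/4" using False assms by (auto simp: r_def)
    have "b ((x + y) / 2) \<le> Ju r"
      using J_pieces(3)[of "(x + y) / 2"] b_J[of "(x + y) / 2"] False r by (simp add: r_def)
    also have "Ju r \<le> 1/2 + 207/1000 * r"
    proof -
      have "r\<^sup>2 * (276/1000 * r) \<le> r\<^sup>2 * 2" using r by (intro mult_left_mono) auto
      then show ?thesis by (simp add: Ju_def power2_eq_square power3_eq_cube mult_ac)
    qed
    finally show ?thesis unfolding r_def by linarith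
  qed
  show "0 \<le> y - x + 4142/10000 * (22/10 * (1 - y)) + 2 * x
      - 2 * (1/2 + max (1136/10000 * ((x + y) / 2 - 1/2)) (207/1000 * ((x + y) / 2 - 1/2)))"
    using assms by (auto simp: max_def field_simps)
qed

lemma b_mid_Q:
  assumes "1/4 \<le> (x + y) / 2" "(x + y) / 2 \<le> 1/2"
  shows "b ((x + y) / 2) \<le> peval midQ x y"
  using b_Q_bounds(2)[OF assms] by (simp add: midQ_def)

lemma b_mid_J:
  assumes "1/2 \<le> (x + y) / 2" "(x + y) / 2 \<le> 3/4"
  shows "b ((x + y) / 2) \<le> peval midJ x y"
  using J_pieces(3)[OF assms] b_J[OF assms(1)] by (simp add: midJ_def)

lemma good_LJ_box_N:
  assumes pos: "positive_on tr (c1, c2, c3) (d1, d2, d3)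
      ((PY \<ominus> PX) \<up> 2 \<oplus> JqP (PY \<ominus> PC 1 2) \<up> 2 \<ominus> (PC 2 1 \<otimes> midQ \<ominus> l) \<up> 2)"
    and box: "of_int c1 / of_int c3 \<le> x" "x \<le> of_int c2 / of_int c3"
      "of_int d1 / of_int d3 \<le> y" "y \<le> of_int d2 / of_int d3"
    and xy: "1/16 \<le> x" "x \<le> 1/4" "1/2 \<le> y" "y \<le> 7/10" and l: "peval l x y \<le> b x"
  shows "good x y"
proof (rule goodI_N2[where j = "Jq (y - 1/2)" and u = "peval midQ x y", OF _ _ _ l])
  show "x \<le> y" using xy by simp
  show "0 \<le> Jq (y - 1/2)" by (rule Jq_nonneg) (use xy in auto)
  show "Jq (y - 1/2) \<le> b y" using J_pieces(1)[of y] b_J[of y] xy by simp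
  show "b ((x + y) / 2) \<le> peval midQ x y" by (rule b_mid_Q) (use xy in auto)
  from positive_on[OF pos box]
  show "(2 * peval midQ x y - peval l x y)\<^sup>2 \<le> (y - x)\<^sup>2 + (Jq (y - 1/2))\<^sup>2" by simp
qed

lemma good_box_G2:
  assumes pos: "positive_on tr (c1, c2, c3) (d1, d2, d3)
      (PY \<ominus> PX \<oplus> PC 4142 10000 \<otimes> j \<oplus> l \<ominus> PC 2 1 \<otimes> m)"
    and box: "of_int c1 / of_int c3 \<le> x" "x \<le> of_int c2 / of_int c3"
      "of_int d1 / of_int d3 \<le> y" "y \<le> of_int d2 / of_int d3"
    and y: "1/2 \<le> y" "y \<le> 1" and j: "peval j x y \<le> J y" and l: "peval l x y \<le> b x"
    and m: "b ((x + y) / 2) \<le> peval m x y"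
  shows "good x y"
  by (rule goodI_G2[OF y j l m]) (use positive_on[OF pos box] in simp)

lemma good_LJ_upper:
  assumes x: "1/16 \<le> x" "x \<le> 1/4" and y: "7/10 \<le> y" "y \<le> 1"
  shows "good x y"
proof -
  define ls :: "(int \<times> int \<times> pexp) list" where "ls = [(1, 2, L8P PX), (2, 4, L4P PX)]"
  define js :: "(int \<times> int \<times> pexp) list" where
    "js = [(7, 8, PC 631 1000 \<ominus> PC 85 100 \<otimes> (PY \<ominus> PC 1 2)),
           (8, 9, PC 844 1000 \<ominus> PC 156 100 \<otimes> (PY \<ominus> PC 1 2)),
           (9, 10, PC 22 10 \<otimes> (PC 1 1 \<ominus> PY))]"
  define ms where "ms = [midQ, midJ]"
  have checks: "\<forall>(a, a', l)\<in>set ls. \<forall>(c, c', j)\<in>set js. \<forall>m\<in>set ms.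
      positive_on Leaf (a, a', 16) (c, c', 10) (PY \<ominus> PX \<oplus> PC 4142 10000 \<otimes> j \<oplus> l \<ominus> PC 2 1 \<otimes> m)"
    unfolding ls_def js_def ms_def by code_simp
  obtain a a' l where l: "(a, a', l) \<in> set ls" "of_int a / of_int 16 \<le> x" "x \<le> of_int a' / of_int 16"
    "peval l x y \<le> b x"
  proof (cases "x \<le> 1/8")
    case True
    then show ?thesis using that[of 1 2 "L8P PX"] b_ge_tangents(2)[of x] x by (simp add: ls_def)
  next
    case False
    then show ?thesis using that[of 2 4 "L4P PX"] b_ge_tangents(4)[of x] x by (simp add: ls_def)
  qed
  obtain c c' j where j: "(c, c', j) \<in> set js" "of_int c / of_int 10 \<le> y" "y \<le> of_int c' / of_int 10"
    "peval j x y \<le> J y"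
  proof -
    consider "y \<le> 8/10" | "8/10 \<le> y" "y \<le> 85/100" | "85/100 \<le> y" "y \<le> 9/10" | "9/10 \<le> y" by linarith
    then show ?thesis
    proof cases
      case 1
      then show ?thesis
        using that[of 7 8 "PC 631 1000 \<ominus> PC 85 100 \<otimes> (PY \<ominus> PC 1 2)"] J_ge_chords(1)[of y] y
        by (simp add: js_def)
    next
      case 2
      then have "844/1000 - 156/100 * (y - 1/2) \<le> J y" using J_ge_chords(2)[of y] by (simp add: field_simps)
      then show ?thesis
        using that[of 8 9 "PC 844 1000 \<ominus> PC 156 100 \<otimes> (PY \<ominus> PC 1 2)"] 2 by (simp add: js_def)
    next
      case 3
      then have "844/1000 - 156/100 * (y - 1/2) \<le> J y" using J_ge_chords(3)[of y] by (simp add: field_simps)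
      then show ?thesis
        using that[of 8 9 "PC 844 1000 \<ominus> PC 156 100 \<otimes> (PY \<ominus> PC 1 2)"] 3 by (simp add: js_def)
    next
      case 4
      then show ?thesis
        using that[of 9 10 "PC 22 10 \<otimes> (PC 1 1 \<ominus> PY)"] J_ge_end[of y] y by (simp add: js_def)
    qed
  qed
  obtain m where m: "m \<in> set ms" "b ((x + y) / 2) \<le> peval m x y"
  proof (cases "(x + y) / 2 \<le> 1/2")
    case True
    then show ?thesis using that[of midQ] b_mid_Q[of x y] x y by (simp add: ms_def)
  next
    case False
    then show ?thesis using that[of midJ] b_mid_J[of x y] x y by (simp add: ms_def)
  qed
  have pos: "positive_on Leaf (a, a', 16) (c, c', 10) (PY \<ominus> PX \<oplus> PC 4142 10000 \<otimes> j \<oplus> l \<ominus> PC 2 1 \<otimes> m)"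
    using checks l(1) j(1) m(1) by fast
  show ?thesis
    by (rule good_box_G2[OF pos l(2,3) j(2,3) _ y(2) j(4) l(4) m(2)]) (use y in simp)
qed

lemma good_LJ_lower:
  assumes x: "1/16 \<le> x" "x \<le> 1/4" and y: "1/2 \<le> y" "y \<le> 7/10"
  shows "good x y"
proof -
  let ?E = "\<lambda>l. (PY \<ominus> PX) \<up> 2 \<oplus> JqP (PY \<ominus> PC 1 2) \<up> 2 \<ominus> (PC 2 1 \<otimes> midQ \<ominus> l) \<up> 2"
  have 1: "positive_on Leaf (1, 2, 16) (5, 6, 10) (?E (L8P PX))" by code_simp
  have 2: "positive_on (SplitY Leaf (SplitY Leaf (SplitX Leaf Leaf))) (8, 11, 64) (5, 7, 10) (?E (L8P' PX))"
    by code_simp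
  have 3: "positive_on (SplitY (SplitX Leaf Leaf) (SplitX (SplitY Leaf Leaf) Leaf)) (11, 16, 64) (5, 7, 10) (?E (L4P PX))"
    by code_simp
  have 4: "positive_on Leaf (1, 2, 16) (6, 7, 10)
     (PY \<ominus> PX \<oplus> PC 4142 10000 \<otimes> JqP (PY \<ominus> PC 1 2) \<oplus> L8P PX \<ominus> PC 2 1 \<otimes> midQ)" by code_simp
  have mQ: "b ((x + y) / 2) \<le> peval midQ x y" by (rule b_mid_Q) (use x y in auto)
  have j: "peval (JqP (PY \<ominus> PC 1 2)) x y \<le> J y" using J_pieces(1)[of y] y by simp
  have y1: "y \<le> 1" using y by simp
  consider "x \<le> 1/8" "y \<le> 6/10" | "x \<le> 1/8" "6/10 \<le> y" | "1/8 \<le> x" "x \<le> 11/64" | "11/64 \<le> x"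
    by linarith
  then show ?thesis
  proof cases
    case 1
    then show ?thesis
      using good_LJ_box_N[OF \<open>positive_on Leaf (1, 2, 16) (5, 6, 10) _\<close>, of x y] b_ge_tangents(2)[of x] x y by simp
  next
    case 2
    then show ?thesis
      using good_box_G2[OF 4 _ _ _ _ y(1) y1 j _ mQ] b_ge_tangents(2)[of x] x y by simp
  next
    case 3
    then show ?thesis
      using good_LJ_box_N[OF \<open>positive_on (SplitY Leaf (SplitY Leaf (SplitX Leaf Leaf))) _ _ _\<close>, of x y]
        b_ge_tangents(3)[of x] x y by simp
  next
    case 4
    then show ?thesis
      using good_LJ_box_N[OF \<open>positive_on (SplitY (SplitX Leaf Leaf) (SplitX (SplitY Leaf Leaf) Leaf)) _ _ _\<close>, of x y]
        b_ge_tangents(4)[of x] x y by simp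
  qed
qed

subsection \<open>y at least 1/2, x in the range of Q\<close>

text \<open>
  J - Q, with Q continued beyond 1/2 as a polynomial, has a positive slope at 1/2.
\<close>

lemma J_minus_Q:
  assumes "0 \<le> v" "v \<le> 1/4"
  shows "v * (925/10000 + 35/100 * v\<^sup>2) \<le> J (1/2 + v) - Qn \<eta> (- v)"
proof -
  have "positive_on Leaf (0, 1, 4) (206970, 206985, 1000000)
     (PY \<ominus> PC 2 3 \<otimes> eUP \<oplus> PX \<otimes> (pLP PX \<oplus> PC 2 1) \<oplus> PC 8 3 \<otimes> eLP \<otimes> PX \<up> 2 \<ominus> PC 925 10000 \<ominus> PC 35 100 \<otimes> PX \<up> 2)"
    by code_simp
  from positive_on[OF this, of v s0] assms s0_box
  have 1: "925/10000 + 35/100 * v\<^sup>2 < s0 - 2/3 * eU + v * (pL v + 2) + 8/3 * eL * v\<^sup>2" by simp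
  have "eL * v\<^sup>2 \<le> \<eta> * v\<^sup>2" using \<eta>(1) by (intro mult_right_mono) auto
  then have "925/10000 + 35/100 * v\<^sup>2 \<le> s0 - 2/3 * \<eta> + v * (pL v + 2) + 8/3 * \<eta> * v\<^sup>2"
    using 1 \<eta>(2) by linarith
  then have "v * (925/10000 + 35/100 * v\<^sup>2) \<le> v * (s0 - 2/3 * \<eta> + v * (pL v + 2) + 8/3 * \<eta> * v\<^sup>2)"
    using assms by (intro mult_left_mono)
  also have "\<dots> = JL v - Qn \<eta> (- v)"
    by (simp add: JL_def Qn_def algebra_simps eval_nat_numeral)
  finally show ?thesis using J_bounds(1)[of v] assms by simp
qed

text \<open>
  With the continuation of Q in place of J at y, the identity of lemma \<open>Q_difference\<close> still holds, but
  (1 - 4 \<eta> a) S may exceed 1, by an amount proportional to v = y - 1/2. This is repaid by J - Q at y,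
  which is at least v e.
\<close>

lemma good_QJ_mid_left:
  assumes x: "1/4 \<le> x" and y: "1/2 \<le> y" and mid: "x + y \<le> 1"
  shows "good x y"
proof -
  define a where "a = 1/2 - (x + y) / 2"
  define k where "k = (y - x) / 2"
  define v where "v = k - a"
  have xy: "1/2 - x = a + k" "y = 1/2 + v" "y - x = 2 * k" "1/2 - (x + y) / 2 = a" "a - k = - v"
    by (simp_all add: a_def k_def v_def field_simps)
  have av: "0 \<le> a" "0 \<le> v" "2 * a + v \<le> 1/4" "k = a + v" "0 \<le> k"
    using assms by (auto simp: a_def k_def v_def field_simps)
  define S where "S = (\<lambda>k. 2 * Qn \<eta> a + Qn \<eta> (a - k) - Qn \<eta> (a + k))"
  have S: "S k = 1 + 4/3 * \<eta> * (k - a) + 8 * a * k - 4 * a\<^sup>2 - 16 * \<eta> * a\<^sup>2 * k - 16/3 * \<eta> * (k ^ 3 - a ^ 3)" for k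
    using Q_difference(2)[of \<eta> a k] by (simp add: S_def)
  define psi where "psi = - 4 * eL + 4 * a - 32 * eL * a\<^sup>2 + 64 * eU\<^sup>2 * a ^ 3"
  have "\<eta> * a \<le> eU * (1/4)" using \<eta> av by (intro mult_mono) auto
  then have ea: "0 \<le> 1 - 4 * \<eta> * a" by simp
  have "(1 - 4 * \<eta> * a) * S k \<le> 1 + a * psi + v * (4/3 * eU + 8 * a)"
  proof -
    have "S k - S a = v * (4/3 * \<eta> + 8 * a) - v * (16 * \<eta> * a\<^sup>2 + 16/3 * \<eta> * (a\<^sup>2 + a * k + k\<^sup>2))"
      unfolding S v_def by (simp add: field_simps eval_nat_numeral)
    moreover have "0 \<le> v * (16 * \<eta> * a\<^sup>2 + 16/3 * \<eta> * (a\<^sup>2 + a * k + k\<^sup>2))"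
      using av \<eta>(1) by (intro mult_nonneg_nonneg add_nonneg_nonneg) auto
    ultimately have "S k \<le> S a + v * (4/3 * \<eta> + 8 * a)" by linarith
    then have "(1 - 4 * \<eta> * a) * S k \<le> (1 - 4 * \<eta> * a) * (S a + v * (4/3 * \<eta> + 8 * a))"
      using ea by (rule mult_left_mono)
    also have "\<dots> = (1 - 4 * \<eta> * a) * S a + (1 - 4 * \<eta> * a) * (v * (4/3 * \<eta> + 8 * a))"
      by (rule distrib_left)
    also have "(1 - 4 * \<eta> * a) * (v * (4/3 * \<eta> + 8 * a)) \<le> 1 * (v * (4/3 * eU + 8 * a))"
      using av \<eta> by (intro mult_mono mult_left_mono) auto
    also have "(1 - 4 * \<eta> * a) * S a = 1 + a * (- 4 * \<eta> + 4 * a - 32 * \<eta> * a\<^sup>2 + 64 * \<eta>\<^sup>2 * a ^ 3)"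
      using Q_difference(3)[of \<eta> a] by (simp add: S_def)
    also have "a * (- 4 * \<eta> + 4 * a - 32 * \<eta> * a\<^sup>2 + 64 * \<eta>\<^sup>2 * a ^ 3) \<le> a * psi"
      unfolding psi_def using Q_diagonal_le[of a] av by (intro mult_left_mono) auto
    finally show ?thesis by simp
  qed
  then have "4 * k\<^sup>2 * (- (a * psi + v * (4/3 * eU + 8 * a))) \<le> 4 * k\<^sup>2 * (1 - (1 - 4 * \<eta> * a) * S k)"
    by (intro mult_left_mono) auto
  then have 1: "(2 * Qn \<eta> a - Qn \<eta> (a + k))\<^sup>2
      \<le> (2 * k)\<^sup>2 + (Qn \<eta> (- v))\<^sup>2 + 4 * k\<^sup>2 * (a * psi + v * (4/3 * eU + 8 * a))"
    using Q_difference(1)[of k \<eta> a] xy(5) by (simp add: S_def algebra_simps)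
  define e where "e = 925/10000 + 35/100 * v\<^sup>2"
  define q where "q = 1/2 + 2/3 * eL * v - 2 * v\<^sup>2 - 8/3 * eU * v ^ 3"
  have v4: "v \<le> 1/4" using av by simp
  have eJ: "v * e \<le> J y - Qn \<eta> (- v)" using J_minus_Q[OF av(2) v4] by (simp add: e_def xy(2))
  have "eL * v \<le> \<eta> * v" "\<eta> * v ^ 3 \<le> eU * v ^ 3"
    using mult_right_mono[OF \<eta>(1) av(2)] mult_right_mono[OF \<eta>(2), of "v ^ 3"] av(2) by auto
  then have q: "q \<le> Qn \<eta> (- v)" by (simp add: q_def Qn_def) 
  have ve: "0 \<le> v * e" using av by (simp add: e_def)
  \<comment> \<open>v br is the gain from J - Q minus the part of the excess that is proportional to v; the other
      part has the factor a psi, and psi < 0 for small a.\<close>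
  define br where "br = e * (2 * q + v * e) - 4 * k\<^sup>2 * (4/3 * eU + 8 * a)"
  \<comment> \<open>The substitution v = w (1/4 - 2 a) maps the triangle 2 a + v \<le> 1/4 to a box.\<close>
  define w where "w = (if 1/4 - 2 * a = 0 then 0 else v / (1/4 - 2 * a))"
  have w: "0 \<le> w" "w \<le> 1" "v = w * (1/4 - 2 * a)"
    using av by (auto simp: w_def field_simps)
  let ?v = "PY \<otimes> (PC 1 4 \<ominus> PC 2 1 \<otimes> PX)"
  let ?e = "PC 925 10000 \<oplus> PC 35 100 \<otimes> ?v \<up> 2"
  let ?q = "PC 1 2 \<oplus> PC 2 3 \<otimes> eLP \<otimes> ?v \<ominus> PC 2 1 \<otimes> ?v \<up> 2 \<ominus> PC 8 3 \<otimes> eUP \<otimes> ?v \<up> 3"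
  let ?br = "?e \<otimes> (PC 2 1 \<otimes> ?q \<oplus> ?v \<otimes> ?e) \<ominus> PC 4 1 \<otimes> (PX \<oplus> ?v) \<up> 2 \<otimes> (PC 4 3 \<otimes> eUP \<oplus> PC 8 1 \<otimes> PX)"
  let ?psi = "PC 4 1 \<otimes> PX \<oplus> PC 64 1 \<otimes> eUP \<up> 2 \<otimes> PX \<up> 3 \<ominus> PC 4 1 \<otimes> eLP \<ominus> PC 32 1 \<otimes> eLP \<otimes> PX \<up> 2"
  have "0 \<le> v * br - 4 * k\<^sup>2 * (a * psi)"
  proof (cases "a \<le> 3/100")
    case True
    have "positive_on (SplitX Leaf (SplitX Leaf Leaf)) (0, 3, 100) (0, 1, 1) ?br" by code_simp
    from positive_on[OF this, of a w] av True w(1,2)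
    have "0 < br" by (simp add: br_def e_def q_def av(4) flip: w(3))
    moreover have "positive_on Leaf (0, 1, 8) (0, 1, 1) (PNeg ?psi)" by code_simp
    from positive_on[OF this, of a w] av True w(1,2)
    have "psi < 0" by (simp add: psi_def algebra_simps)
    then have "4 * k\<^sup>2 * (a * psi) \<le> 0" using av by (intro mult_nonneg_nonpos) auto
    moreover have "0 \<le> v * br" using av \<open>0 < br\<close> by (intro mult_nonneg_nonneg) auto
    ultimately show ?thesis by linarith
  next
    case False
    let ?X = SplitX and ?Y = SplitY and ?L = Leaf
    have "positive_on (?X (?Y (?Y (?Y (?Y (?Y ?L ?L) ?L) ?L) (?X ?L ?L)) (?X ?L ?L)) (?Y (?Y (?Y ?L ?L) (?X ?L ?L)) (?X ?L ?L)))
       (30, 125, 1000) (0, 1, 1) (?v \<otimes> ?br \<ominus> PC 4 1 \<otimes> (PX \<oplus> ?v) \<up> 2 \<otimes> (PX \<otimes> ?psi))" by code_simp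
    from positive_on[OF this, of a w] av False w(1,2)
    have "0 < v * br - 4 * k\<^sup>2 * (a * (4 * a + 64 * eU\<^sup>2 * a ^ 3 - 4 * eL - 32 * eL * a\<^sup>2))"
      by (simp add: br_def e_def q_def av(4) flip: w(3))
    then show ?thesis by (simp add: psi_def algebra_simps)
  qed
  then have 2: "4 * k\<^sup>2 * (a * psi + v * (4/3 * eU + 8 * a)) \<le> v * e * (2 * q + v * e)"
    by (simp add: br_def algebra_simps)
  have Q0: "0 \<le> Qn \<eta> (- v) + v * e"
  proof -
    have "positive_on Leaf (0, 1, 4) (0, 1, 1)
      (PC 1 2 \<oplus> PC 2 3 \<otimes> eLP \<otimes> PX \<ominus> PC 2 1 \<otimes> PX \<up> 2 \<ominus> PC 8 3 \<otimes> eUP \<otimes> PX \<up> 3)" by code_simp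
    from positive_on[OF this, of v 0] av v4 have "0 < q" by (simp add: q_def)
    then show ?thesis using q ve by simp
  qed
  show ?thesis
  proof (rule goodI_N2[where j = "Qn \<eta> (- v) + v * e" and l = "Qn \<eta> (a + k)" and u = "Qn \<eta> a", OF _ Q0])
    show "x \<le> y" using assms by simp
    show "Qn \<eta> (- v) + v * e \<le> b y" using eJ b_J[OF y] by simp
    show "Qn \<eta> (a + k) \<le> b x" using b_ge_Q[of x] assms xy(1) by simp
    show "b ((x + y) / 2) \<le> Qn \<eta> a" using b_Q[of "(x + y) / 2"] assms xy(4) by simp
    have "v * e * (2 * q + v * e) \<le> v * e * (2 * Qn \<eta> (- v) + v * e)"
      using q ve by (intro mult_left_mono) auto
    then show "(2 * Qn \<eta> a - Qn \<eta> (a + k))\<^sup>2 \<le> (y - x)\<^sup>2 + (Qn \<eta> (- v) + v * e)\<^sup>2"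
      using 1 2 xy(3) by (simp add: power2_eq_square algebra_simps)
  qed
qed

end


context hamming_norm
begin

text \<open>
  The derivative of (u + v)^2 - A(u)^2 with respect to u, halved, is u + v - A(u) A'(u), where
  A(u) = 2 J(1/2 + (v - u) / 2) - Q(1/2 - u) is what N has to dominate. Both A and A' are
  bounded above by polynomials.
\<close>

lemma QJ_excess_deriv_nonneg:
  assumes u: "0 \<le> u" "u \<le> v" and v: "v \<le> 2/10 \<or> 2/10 \<le> v \<and> v \<le> 35/100 \<and> u \<le> 1/10"
  defines "n \<equiv> (v - u) / 2"
  shows "(2 * Je (1/2 + n) - Qn \<eta> u) * (- dJ (1/2 + n) + (2/3 * \<eta> + 4 * u - 8 * \<eta> * u\<^sup>2)) \<le> u + v"
proof -
  define A where "A = 2 * Je (1/2 + n) - Qn \<eta> u"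
  define A' where "A' = 2/3 * eU + 4 * u - 8 * eL * u\<^sup>2 - dJl n"
  have n: "0 \<le> n" "n \<le> 175/1000" using u v by (auto simp: n_def)
  have Je: "Je (1/2 + n) = J (1/2 + n)" using n J_eq_Je[of "1/2 + n"] by simp
  have u2: "u \<le> 2/10" using u v by auto
  have A: "0 \<le> A"
  proof -
    have "Qn \<eta> u \<le> 1/2" using Qn_le_line[of u] u u2 by simp
    moreover have "1/4 \<le> Jq n"
    proof -
      have "n * n \<le> 175/1000 * (175/1000)" using n by (intro mult_mono) auto
      then show ?thesis using n by (simp add: Jq_def power2_eq_square)
    qed
    moreover have "Jq n \<le> J (1/2 + n)" using J_pieces(1)[of "1/2 + n"] n by simp
    ultimately show ?thesis using Je by (simp add: A_def)
  qed
  have Aup: "A \<le> 2 * Ju n - Qn eU u"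
    using J_pieces(3)[of "1/2 + n"] n Qn_antimono_e[OF \<eta>(2), of u] u u2 Je by (simp add: A_def)
  have "eL * u\<^sup>2 \<le> \<eta> * u\<^sup>2" using \<eta>(1) by (intro mult_right_mono) auto
  moreover have "dJl n \<le> dJ (1/2 + n)" using dJ_ge_cubic[of n] n by (simp add: dJl_def)
  ultimately have "- dJ (1/2 + n) + (2/3 * \<eta> + 4 * u - 8 * \<eta> * u\<^sup>2) \<le> A'"
    using \<eta>(2) by (simp add: A'_def)
  then have "A * (- dJ (1/2 + n) + (2/3 * \<eta> + 4 * u - 8 * \<eta> * u\<^sup>2)) \<le> A * A'"
    using A by (rule mult_left_mono)
  also have "A * A' \<le> u + v"
  proof (cases "0 \<le> A'")
    case False
    then have "A * A' \<le> 0" using A by (intro mult_nonneg_nonpos) auto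
    then show ?thesis using u by simp
  next
    case True
    have "A * A' \<le> (2 * Ju n - Qn eU u) * A'" using Aup True by (rule mult_right_mono)
    also have "\<dots> \<le> u + v"
    proof -
      let ?E = "\<lambda>u. let n = PC 1 2 \<otimes> (PY \<ominus> u) in u \<oplus> PY \<ominus> (PC 2 1 \<otimes> JuP n \<ominus> QP eUP u) \<otimes>
        (PC 2 3 \<otimes> eUP \<oplus> PC 4 1 \<otimes> u \<ominus> PC 8 1 \<otimes> eLP \<otimes> u \<up> 2 \<ominus> dJlP n)"
      show ?thesis
        using v
      proof
        assume v: "v \<le> 2/10"
        \<comment> \<open>The triangle u \<le> v becomes a box in the variables w = u / v and v.\<close>
        define w where "w = (if v = 0 then 0 else u / v)"
        have w: "0 \<le> w" "w \<le> 1" "u = w * v" using u by (auto simp: w_def field_simps)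
        have "positive_on (SplitY Leaf Leaf) (0, 1, 1) (0, 2, 10) (?E (PX \<otimes> PY))" by code_simp
        from positive_on[OF this, of w v] w(1,2) v u
        show ?thesis
          by (simp add: Let_def n_def A'_def flip: w(3))
      next
        assume v: "2/10 \<le> v \<and> v \<le> 35/100 \<and> u \<le> 1/10"
        have "positive_on Leaf (0, 10, 100) (20, 35, 100) (?E PX)" by code_simp
        from positive_on[OF this, of u v] v u
        show ?thesis by (simp add: Let_def n_def A'_def)
      qed
    qed
    finally show ?thesis .
  qed
  finally show ?thesis unfolding A_def .
qed

text \<open>
  Moving x = 1/2 - u to the left of 1/2 increases the square of h = u + v at least as much as the
  square of the other side, so that the worst case is u = 0.
\<close>

lemma QJ_excess_mono:
  assumes u: "0 \<le> u" "u \<le> v" and v: "v \<le> 2/10 \<or> 2/10 \<le> v \<and> v \<le> 35/100 \<and> u \<le> 1/10"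
  shows "(2 * J (1/2 + (v - u) / 2) - Qn \<eta> u)\<^sup>2 - (u + v)\<^sup>2 \<le> (2 * J (1/2 + v / 2) - 1/2)\<^sup>2 - v\<^sup>2"
proof -
  define A where "A = (\<lambda>u. 2 * Je (1/2 + (v - u) / 2) - Qn \<eta> u)"
  define A' where "A' = (\<lambda>u. - dJ (1/2 + (v - u) / 2) + (2/3 * \<eta> + 4 * u - 8 * \<eta> * u\<^sup>2))"
  have vb: "v \<le> 35/100" using v by auto
  have DA: "(A has_real_derivative A' s) (at s)" if "0 \<le> s" "s \<le> u" for s
  proof -
    have 1: "((\<lambda>s. 1/2 + (v - s) / 2) has_real_derivative - 1/2) (at s)"
      by (auto intro!: derivative_eq_intros)
    have "0 \<le> v - s" "v - s < 1" using that u vb by linarith+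
    then have vs: "1/2 \<le> 1/2 + (v - s) / 2" "1/2 + (v - s) / 2 < 1" by (simp_all add: field_simps)
    have "((\<lambda>s. Je (1/2 + (v - s) / 2)) has_real_derivative dJ (1/2 + (v - s) / 2) * (- 1/2)) (at s)"
      by (rule DERIV_chain2[OF Je_deriv[OF vs] 1])
    from DERIV_cmult[OF this, of 2]
    have 2: "((\<lambda>s. 2 * Je (1/2 + (v - s) / 2)) has_real_derivative 2 * (dJ (1/2 + (v - s) / 2) * (- 1/2))) (at s)" .
    have 3: "(Qn \<eta> has_real_derivative - (2/3 * \<eta>) - 4 * s + 8 * \<eta> * s\<^sup>2) (at s)"
    proof -
      have "((\<lambda>s. 1/2 - 2/3 * \<eta> * s - 2 * s\<^sup>2 + 8/3 * \<eta> * s ^ 3) has_real_derivative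
          - (2/3 * \<eta>) - 4 * s + 8 * \<eta> * s\<^sup>2) (at s)"
        by (auto intro!: derivative_eq_intros simp: power2_eq_square)
      then show ?thesis by (simp add: Qn_def[abs_def])
    qed
    have "2 * (dJ (1/2 + (v - s) / 2) * (- 1/2)) - (- (2/3 * \<eta>) - 4 * s + 8 * \<eta> * s\<^sup>2) = A' s"
      by (simp add: A'_def)
    with DERIV_diff[OF 2 3] show ?thesis by (simp only: A_def)
  qed
  have "(0 + v)\<^sup>2 - (A 0)\<^sup>2 \<le> (u + v)\<^sup>2 - (A u)\<^sup>2"
  proof (rule DERIV_nonneg_imp_nondecreasing[OF u(1), where f = "\<lambda>s. (s + v)\<^sup>2 - (A s)\<^sup>2"])
    fix s assume s: "0 \<le> s" "s \<le> u"
    have "((\<lambda>s. (s + v)\<^sup>2) has_real_derivative 2 * (s + v)) (at s)"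
      by (auto intro!: derivative_eq_intros)
    moreover have "((\<lambda>s. (A s)\<^sup>2) has_real_derivative 2 * (A s * A' s)) (at s)"
      using DERIV_power[OF DA[OF s], of 2] by (simp add: mult_ac)
    ultimately have "((\<lambda>s. (s + v)\<^sup>2 - (A s)\<^sup>2) has_real_derivative 2 * (s + v) - 2 * (A s * A' s)) (at s)"
      by (rule DERIV_diff)
    moreover have "A s * A' s \<le> s + v"
      unfolding A_def A'_def by (rule QJ_excess_deriv_nonneg) (use s u v in auto)
    ultimately show "\<exists>d. ((\<lambda>s. (s + v)\<^sup>2 - (A s)\<^sup>2) has_real_derivative d) (at s) \<and> 0 \<le> d"
      by (intro exI[of _ "2 * (s + v) - 2 * (A s * A' s)"]) simp
  qed
  moreover have "A 0 = 2 * J (1/2 + v / 2) - 1/2"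
    using J_eq_Je[of "1/2 + v / 2"] u vb by (simp add: A_def Qn_def)
  moreover have "1/2 \<le> 1/2 + (v - u) / 2" "1/2 + (v - u) / 2 < 1"
    using u vb by (simp_all add: field_simps)
  moreover have "A u = 2 * J (1/2 + (v - u) / 2) - Qn \<eta> u"
    using J_eq_Je[of "1/2 + (v - u) / 2"] calculation(3,4) by (simp add: A_def)
  ultimately show ?thesis by simp
qed

text \<open>
  On the line u = 0 the inequality is provided by \<open>N_half\<close>. The excess of the squared norm over h^2 does
  not decrease with h by \<open>N_incr\<close>, and the excess that is needed does not increase with u.
\<close>

lemma good_QJ_mid_right:
  assumes u: "0 \<le> u" "u \<le> v" and v: "v \<le> 2/10 \<or> 2/10 \<le> v \<and> v \<le> 35/100 \<and> u \<le> 1/10"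
  shows "good (1/2 - u) (1/2 + v)"
proof -
  have uv: "u \<le> 1/4" "v \<le> 35/100" "0 \<le> v" using u v by auto
  have mid: "(1/2 - u + (1/2 + v)) / 2 = 1/2 + (v - u) / 2" by (simp add: field_simps)
  have m: "1/2 \<le> 1/2 + (v - u) / 2" using u by simp
  have h: "1/2 + v - (1/2 - u) = u + v" by simp
  let ?j = "J (1/2 + v)"
  have j: "0 \<le> ?j" using J_nonneg uv by simp
  have slope: "(2 * J (1/2 + (v - u) / 2) - Qn \<eta> u)\<^sup>2 - (u + v)\<^sup>2 \<le> (N v ?j)\<^sup>2 - v\<^sup>2"
  proof -
    obtain lam where "(2 * J (1/2 + v / 2) - 1/2)\<^sup>2 \<le> lam * v\<^sup>2 + ?j\<^sup>2"
      "\<forall>h\<in>{0..v}. lam * h\<^sup>2 + ?j\<^sup>2 \<le> (N h ?j)\<^sup>2"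
      using N_half[of v] uv by auto
    then have "(2 * J (1/2 + v / 2) - 1/2)\<^sup>2 \<le> (N v ?j)\<^sup>2" using uv by force
    then show ?thesis using QJ_excess_mono[OF assms] by linarith
  qed
  have "(N v ?j)\<^sup>2 - v\<^sup>2 \<le> (N (u + v) ?j)\<^sup>2 - (u + v)\<^sup>2"
  proof (cases "v = 0")
    case False
    then show ?thesis using N_incr[of v "u + v" ?j] u uv j by simp
  qed (use u in auto)
  with slope have "(2 * J (1/2 + (v - u) / 2) - Qn \<eta> u)\<^sup>2 \<le> (N (u + v) ?j)\<^sup>2" by linarith
  then show ?thesis
    using goodI_N[of "J (1/2 + (v - u) / 2)" "Qn \<eta> u" "1/2 + v" "1/2 - u"]
      b_Q[of "1/2 - u"] b_J[of "1/2 + v"] b_J[OF m] u uv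
    unfolding mid h by simp
qed

lemma good_QJ:
  assumes x: "1/4 \<le> x" "x \<le> 1/2" and y: "1/2 \<le> y" "y \<le> 1"
  shows "good x y"
proof (cases "x + y \<le> 1")
  case True
  then show ?thesis using good_QJ_mid_left x y by simp
next
  case False
  define u where "u = 1/2 - x"
  define v where "v = y - 1/2"
  have uv: "0 \<le> u" "u \<le> 1/4" "u \<le> v" "v \<le> 1/2" "x = 1/2 - u" "y = 1/2 + v"
    using False x y by (auto simp: u_def v_def)
  let ?G = "\<lambda>j. PY \<ominus> PX \<oplus> PC 4142 10000 \<otimes> j \<oplus> QP eUP (PC 1 2 \<ominus> PX) \<ominus> PC 2 1 \<otimes> midJ"
  let ?c2 = "PC 772 1000 \<ominus> PC 132 100 \<otimes> (PY \<ominus> PC 1 2)"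
  let ?c3 = "PC 94 100 \<ominus> PC 18 10 \<otimes> (PY \<ominus> PC 1 2)"
  let ?c4 = "PC 22 10 \<otimes> (PC 1 1 \<ominus> PY)"
  have l: "peval (QP eUP (PC 1 2 \<ominus> PX)) x y \<le> b x" using b_Q_bounds(1)[OF x] by simp
  have m: "b ((x + y) / 2) \<le> peval midJ x y" by (rule b_mid_J) (use False x y in auto)
  consider "v \<le> 2/10 \<or> 2/10 \<le> v \<and> v \<le> 35/100 \<and> u \<le> 1/10" | "1/10 \<le> u" "2/10 \<le> v" "v \<le> 3/10"
    | "1/10 \<le> u" "3/10 \<le> v" "v \<le> 35/100" | "35/100 \<le> v" "v \<le> 4/10" | "4/10 \<le> v"
    by linarith
  then show ?thesis
  proof cases
    case 1
    then show ?thesis using good_QJ_mid_right[of u v] uv by simp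
  next
    case 2
    have "positive_on Leaf (10, 25, 100) (20, 30, 100)
      ((PX \<oplus> PY) \<up> 2 \<oplus> JrP PY \<up> 2 \<ominus> (PC 2 1 \<otimes> JuP (PC 1 2 \<otimes> (PY \<ominus> PX)) \<ominus> QP eUP PX) \<up> 2)"
      by code_simp
    from positive_on[OF this, of u v] 2 uv
    have pos: "(2 * Ju ((v - u) / 2) - Qn eU u)\<^sup>2 \<le> (y - x)\<^sup>2 + (Jr v)\<^sup>2" by (simp add: add.commute)
    have mid: "(x + y) / 2 = 1/2 + (v - u) / 2" by (simp add: uv(5,6) field_simps)
    have m1: "1/2 \<le> 1/2 + (v - u) / 2" "1/2 + (v - u) / 2 \<le> 3/4"
      using uv 2 by (simp_all add: field_simps)
    show ?thesis
    proof (rule goodI_N2[OF _ _ _ _ _ pos])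
      show "0 \<le> Jr v" using Jr_nonneg[of v] 2 by simp
      show "Jr v \<le> b y" using J_pieces(2)[of y] b_J[of y] 2 uv by simp
      show "Qn eU u \<le> b x" using b_Q_bounds(1)[OF x] by (simp add: u_def)
      show "b ((x + y) / 2) \<le> Ju ((v - u) / 2)"
        unfolding mid using J_pieces(3)[OF m1] b_J[OF m1(1)] by simp
    qed (use x y in auto)
  next
    case 3
    have "positive_on Leaf (25, 40, 100) (80, 85, 100) (?G ?c2)" by code_simp
    from good_box_G2[OF this _ _ _ _ y _ l m] show ?thesis
      using J_ge_chords(2)[of y] 3 uv by simp
  next
    case 4
    have "positive_on Leaf (25, 50, 100) (85, 90, 100) (?G ?c3)" by code_simp
    from good_box_G2[OF this _ _ _ _ y _ l m] show ?thesis
      using J_ge_chords(3)[of y] 4 uv by simp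
  next
    case 5
    have "positive_on Leaf (25, 50, 100) (90, 100, 100) (?G ?c4)" by code_simp
    from good_box_G2[OF this _ _ _ _ y _ l m] show ?thesis
      using J_ge_end[of y] 5 uv by simp
  qed
qed

text \<open>
  The factor \<open>lam\<close> for the line x = 1/2 serves for all larger x with the same y.
\<close>

lemma good_JJ:
  assumes x: "1/2 \<le> x" "x \<le> y" and y: "y \<le> 1"
  shows "good x y"
proof -
  define t where "t = y - 1/2"
  have t: "0 \<le> t" "t \<le> 1/2" "1/2 + t = y" "1/2 + t / 2 = (1/2 + y) / 2"
    using assms by (auto simp: t_def field_simps)
  obtain lam where lam: "1 \<le> lam" "(2 * J ((1/2 + y) / 2) - 1/2)\<^sup>2 \<le> lam * t\<^sup>2 + (J y)\<^sup>2"
    "\<forall>h\<in>{0..t}. lam * h\<^sup>2 + (J y)\<^sup>2 \<le> (N h (J y))\<^sup>2"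
    using N_half[OF t(1,2)] unfolding t(3,4) by auto
  have "(2 * J ((x + y) / 2) - J x)\<^sup>2 \<le> lam * (y - x)\<^sup>2 + (J y)\<^sup>2"
    by (rule J_two_point_from_half[OF lam(1) y _ x]) (use lam(2) in \<open>simp only: J_half t_def\<close>)
  also have "\<dots> \<le> (N (y - x) (J y))\<^sup>2"
    using lam(3) x by (auto simp: t_def)
  finally show ?thesis
    using goodI_N[of "J ((x + y) / 2)" "J x" y x] b_J[of x] b_J[of y] b_J[of "(x + y) / 2"] assms by simp
qed

theorem good_everywhere:
  assumes "0 \<le> x" "x \<le> y" "y \<le> 1"
  shows "good x y"
proof -
  consider "y \<le> 1/2" | "1/2 \<le> x" | "1/4 \<le> x" "x \<le> 1/2" "1/2 \<le> y" | "1/16 \<le> x" "x \<le> 1/4" "1/2 \<le> y"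
    | "x \<le> 1/16" "1/2 \<le> y" by linarith
  then show ?thesis
  proof cases
    case 1
    then show ?thesis using good_left assms by simp
  next
    case 2
    then show ?thesis using good_JJ assms by simp
  next
    case 3
    then show ?thesis using good_QJ assms by simp
  next
    case 4
    then show ?thesis using good_LJ_lower[of x y] good_LJ_upper[of x y] assms by linarith
  next
    case 5
    then show ?thesis using good_LJ_strip[of x y] good_LJ_corner[of x y] assms by linarith
  qed
qed

end


lemma (in hamming_norm) b_nonneg:
  assumes "0 \<le> y" "y \<le> 1"
  shows "0 \<le> b y"
proof (cases "1/2 \<le> y")
  case True
  then show ?thesis using J_nonneg[of y] b_J[of y] assms by simp
next
  case False
  have "0 \<le> L_beta \<beta> y" using assms by (simp add: L_beta_def)
  then show ?thesis
    using L_le_Q[OF \<beta>, of y] b_L[of y] b_Q[of y] Q_eq False assms by (cases "y \<le> 1/4") auto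
qed

section \<open>The exponent 1/2\<close>

text \<open>
  Here \<open>lam\<close> = 1 / 0.997^2 for every t.
\<close>

lemma hamming_norm_euclidean:
  "hamming_norm (1/2) (\<lambda>h b. sqrt ((h / (997/1000))\<^sup>2 + b\<^sup>2))"
proof
  fix h h' b t :: real
  show "(1/2::real) \<le> 1/2" "1/2 \<le> (50057/100000::real)" by simp_all
  show "0 \<le> sqrt ((h / (997/1000))\<^sup>2 + b\<^sup>2)" by simp
  have sq: "(h / (997/1000))\<^sup>2 = 1000000/994009 * h\<^sup>2" for h :: real
    by (simp add: power2_eq_square field_simps)
  show ge_2: "h\<^sup>2 + b\<^sup>2 \<le> (sqrt ((h / (997/1000))\<^sup>2 + b\<^sup>2))\<^sup>2"
    unfolding sq by simp
  show "(sqrt ((h / (997/1000))\<^sup>2 + b\<^sup>2))\<^sup>2 - h\<^sup>2 \<le> (sqrt ((h' / (997/1000))\<^sup>2 + b\<^sup>2))\<^sup>2 - h'\<^sup>2"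
    if "0 < h" "h \<le> h'" "0 \<le> b"
  proof -
    have "h\<^sup>2 \<le> h'\<^sup>2" using that by (intro power_mono) auto
    then show ?thesis unfolding sq by simp
  qed
  have le: "sqrt (h\<^sup>2 + b\<^sup>2) \<le> sqrt ((h / (997/1000))\<^sup>2 + b\<^sup>2)" unfolding sq by simp
  show "(h powr (1 / (1/2)) + b powr (1 / (1/2))) powr (1/2) \<le> sqrt ((h / (997/1000))\<^sup>2 + b\<^sup>2)"
    if "0 \<le> h" "0 \<le> b"
    using le that by (simp add: powr_half_sqrt)
  show "2 powr (1/2) / 2 * (h + b) \<le> sqrt ((h / (997/1000))\<^sup>2 + b\<^sup>2)" if "0 \<le> h" "0 \<le> b"
  proof (rule order_trans[OF real_le_rsqrt le])
    have "(sqrt 2 / 2 * (h + b))\<^sup>2 = (h + b)\<^sup>2 / 2"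
      by (simp add: power_mult_distrib power_divide)
    also have "\<dots> \<le> h\<^sup>2 + b\<^sup>2" using sum_squares_bound[of h b] by (simp add: power2_sum)
    finally show "(2 powr (1/2) / 2 * (h + b))\<^sup>2 \<le> h\<^sup>2 + b\<^sup>2" by (simp add: powr_half_sqrt)
  qed
  show "\<exists>lam\<ge>1. (2 * J (1/2 + t / 2) - 1/2)\<^sup>2 \<le> lam * t\<^sup>2 + (J (1/2 + t))\<^sup>2 \<and>
      (\<forall>h\<in>{0..t}. lam * h\<^sup>2 + (J (1/2 + t))\<^sup>2 \<le> (sqrt ((h / (997/1000))\<^sup>2 + (J (1/2 + t))\<^sup>2))\<^sup>2)"
    if "0 \<le> t" "t \<le> 1/2"
  proof (intro exI[of _ "1000000/994009"] conjI ballI)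
    show "(2 * J (1/2 + t / 2) - 1/2)\<^sup>2 \<le> 1000000/994009 * t\<^sup>2 + (J (1/2 + t))\<^sup>2"
      using J_two_point_at_half(1,4)[of t "1000000/994009"] that by (cases "t \<le> 2/10") auto
    show "1000000/994009 * h\<^sup>2 + (J (1/2 + t))\<^sup>2 \<le> (sqrt ((h / (997/1000))\<^sup>2 + (J (1/2 + t))\<^sup>2))\<^sup>2" for h
      unfolding sq by simp
  qed simp
qed

section \<open>The exponent 0.50057\<close>

definition lp_norm :: "real \<Rightarrow> real \<Rightarrow> real \<Rightarrow> real" where
  "lp_norm \<beta> h b = (h powr (1 / \<beta>) + b powr (1 / \<beta>)) powr \<beta>"

lemma powr_add_minus_mono:
  fixes u u' k q :: real
  assumes "1 \<le> q" "0 < u" "u \<le> u'" "0 \<le> k"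
  shows "(u + k) powr q - u powr q \<le> (u' + k) powr q - u' powr q"
proof (rule DERIV_nonneg_imp_nondecreasing[OF assms(3), where f = "\<lambda>s. (s + k) powr q - s powr q"])
  fix s assume s: "u \<le> s" "s \<le> u'"
  have "((\<lambda>s. (s + k) powr q - s powr q) has_real_derivative q * (s + k) powr (q - 1) - q * s powr (q - 1)) (at s)"
    using s assms by (auto intro!: derivative_eq_intros)
  moreover have "q * s powr (q - 1) \<le> q * (s + k) powr (q - 1)"
    using s assms by (intro mult_left_mono powr_mono2) auto
  ultimately show "\<exists>d. ((\<lambda>s. (s + k) powr q - s powr q) has_real_derivative d) (at s) \<and> 0 \<le> d"
    by (intro exI[of _ "q * (s + k) powr (q - 1) - q * s powr (q - 1)"]) simp
qed

lemma powr_superadditive: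
  fixes u k q :: real
  assumes "1 \<le> q" "0 \<le> u" "0 \<le> k"
  shows "u powr q + k powr q \<le> (u + k) powr q"
proof -
  have *: "x * x powr (q - 1) = x powr q" if "0 \<le> x" for x :: real
    using powr_mult_base[OF that, of "q - 1"] by simp
  have "u * u powr (q - 1) + k * k powr (q - 1) \<le> u * (u + k) powr (q - 1) + k * (u + k) powr (q - 1)"
    using assms by (intro add_mono mult_left_mono powr_mono2) auto
  then show ?thesis using *[of u] *[of k] *[of "u + k"] assms by (simp add: distrib_right)
qed

lemma lp_norm_square: "(lp_norm \<beta> h b)\<^sup>2 = (h powr (1 / \<beta>) + b powr (1 / \<beta>)) powr (2 * \<beta>)"
  by (simp add: lp_norm_def power2_eq_square powr_add[symmetric])

lemma square_powr:
  assumes "0 \<le> (h::real)" "0 < \<beta>"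
  shows "h\<^sup>2 = (h powr (1 / \<beta>)) powr (2 * \<beta>)"
  using assms by (simp add: powr_powr)

lemma lp_norm_ge_2:
  assumes "1/2 \<le> \<beta>" "0 \<le> h" "0 \<le> b"
  shows "h\<^sup>2 + b\<^sup>2 \<le> (lp_norm \<beta> h b)\<^sup>2"
  using powr_superadditive[of "2 * \<beta>" "h powr (1 / \<beta>)" "b powr (1 / \<beta>)"] assms
    square_powr[of h \<beta>] square_powr[of b \<beta>] by (simp add: lp_norm_square)

lemma lp_norm_incr:
  assumes "1/2 \<le> \<beta>" "0 < h" "h \<le> h'" "0 \<le> b"
  shows "(lp_norm \<beta> h b)\<^sup>2 - h\<^sup>2 \<le> (lp_norm \<beta> h' b)\<^sup>2 - h'\<^sup>2"
proof -
  have "h powr (1 / \<beta>) \<le> h' powr (1 / \<beta>)" using assms by (intro powr_mono2) auto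
  from powr_add_minus_mono[OF _ _ this, of "2 * \<beta>" "b powr (1 / \<beta>)"] show ?thesis
    using assms square_powr[of h \<beta>] square_powr[of h' \<beta>] by (simp add: lp_norm_square)
qed

lemma lp_norm_ge_sum:
  assumes \<beta>: "1/2 \<le> \<beta>" "\<beta> \<le> 1" and hb: "0 \<le> h" "0 \<le> b"
  shows "2 powr \<beta> / 2 * (h + b) \<le> lp_norm \<beta> h b"
proof (cases "h + b = 0")
  case True
  then show ?thesis by (simp add: lp_norm_def)
next
  case False
  define c where "c = (h + b) / 2"
  define p where "p = 1 / \<beta>"
  have c: "0 < c" and p: "1 \<le> p" using False hb \<beta> by (auto simp: c_def p_def)
  have "c powr p + p * c powr (p - 1) * (h - c) \<le> h powr p"
    "c powr p + p * c powr (p - 1) * (b - c) \<le> b powr p"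
    using powr_tangent p c hb by auto
  moreover have "p * c powr (p - 1) * (h - c) + p * c powr (p - 1) * (b - c) = 0"
    by (simp add: c_def field_simps)
  ultimately have "2 * c powr p \<le> h powr p + b powr p" by linarith
  then have "(2 * c powr p) powr \<beta> \<le> lp_norm \<beta> h b"
    unfolding lp_norm_def p_def using \<beta> c by (intro powr_mono2) auto
  moreover have "(2 * c powr p) powr \<beta> = 2 powr \<beta> * c"
    using c \<beta> by (simp add: powr_mult powr_powr p_def)
  ultimately show ?thesis by (simp add: c_def)
qed

lemma exp_2_le: "exp (2::real) \<le> 73891/10000"
proof -
  obtain t :: real where t: "\<bar>t\<bar> \<le> \<bar>1\<bar>" "exp (1::real) = (\<Sum>m<12. 1 ^ m / fact m) + exp t / fact 12 * 1 ^ 12"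
    using Maclaurin_exp_le[of "1::real" 12] by blast
  have "exp t \<le> exp 1" using t(1) by simp
  also have "\<dots> \<le> 3" by (rule exp_le)
  finally have "exp (1::real) \<le> 2718283/1000000"
    using t(2) by (simp add: eval_nat_numeral fact_numeral lessThan_Suc) 
  then have "exp (1::real) * exp 1 \<le> 2718283/1000000 * (2718283/1000000)" by (intro mult_mono) auto
  moreover have "exp (2::real) = exp 1 * exp 1" by (simp flip: exp_add)
  ultimately show ?thesis by simp
qed

abbreviation \<beta>\<^sub>0 :: real where "\<beta>\<^sub>0 \<equiv> 50057/100000"

text \<open>
  With r = h / b and p = 1 / \<beta>, Bernoulli's inequality gives
  N^2 \<ge> b^2 + 2 \<beta> b^2 r^p, and b^2 r^p = h^2 r^(p - 2) is at least h^2 because r \<le> 1: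
  r^(p - 2) \<ge> 1 + e (- ln r) for e \<le> 2 - p. Finally ln r \<le> exp 2 * r - 3, the tangent of ln at
  exp(-2), makes the bound linear in r. The numbers are 2 \<beta> = 1.00114 and e = 0.002277 \<le> 2 - 1 / \<beta>.
\<close>

lemma lp_norm_gain:
  assumes h: "0 \<le> h" "h \<le> b" and b: "0 < b" and K: "73891/10000 * h \<le> K * b"
  shows "100114/100000 * (1 + 2277/1000000 * (3 - K)) * h\<^sup>2 + b\<^sup>2 \<le> (lp_norm \<beta>\<^sub>0 h b)\<^sup>2"
proof (cases "h = 0")
  case True
  then show ?thesis using lp_norm_ge_2[of \<beta>\<^sub>0 0 b] b by simp
next
  case False
  define p where "p = 1 / \<beta>\<^sub>0"
  define e where "e = (2277/1000000 :: real)"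
  define r where "r = h / b"
  have r: "0 < r" "r \<le> 1" "h = r * b" using h b False by (auto simp: r_def)
  have K: "73891/10000 * r \<le> K" using K b by (simp add: r(3))
  have "r\<^sup>2 * (1 + e * (3 - K)) \<le> r\<^sup>2 * r powr (- e)"
  proof (rule mult_left_mono)
    have "ln (exp 2 * r) \<le> exp 2 * r - 1" using r by (intro ln_le_minus_one) simp
    moreover have "ln (exp 2 * r) = 2 + ln r" using r by (simp add: ln_mult)
    moreover have "exp 2 * r \<le> 73891/10000 * r" using exp_2_le r by (intro mult_right_mono) auto
    ultimately have "3 - K \<le> - ln r" using K by linarith
    then have "e * (3 - K) \<le> - e * ln r" by (simp add: e_def)
    also have "1 + (- e * ln r) \<le> exp (- e * ln r)" by (rule exp_ge_add_one_self)
    finally show "1 + e * (3 - K) \<le> r powr (- e)" using r by (simp add: powr_def)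
  qed simp
  also have "\<dots> = r powr (2 - e)" using r by (simp add: powr_diff powr_minus divide_inverse)
  also have "\<dots> \<le> r powr p" using r by (intro powr_mono') (auto simp: e_def p_def)
  finally have 1: "r\<^sup>2 * (1 + e * (3 - K)) \<le> r powr p" .
  have "1 + 2 * \<beta>\<^sub>0 * (r\<^sup>2 * (1 + e * (3 - K))) \<le> 1 + 2 * \<beta>\<^sub>0 * r powr p" using 1 by simp
  also have "\<dots> \<le> (1 + r powr p) powr (2 * \<beta>\<^sub>0)"
    using powr_tangent[of "2 * \<beta>\<^sub>0" 1 "1 + r powr p"] by simp
  finally have "b\<^sup>2 * (1 + 2 * \<beta>\<^sub>0 * (r\<^sup>2 * (1 + e * (3 - K)))) \<le> b\<^sup>2 * (1 + r powr p) powr (2 * \<beta>\<^sub>0)"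
    by (intro mult_left_mono) auto
  moreover have "b\<^sup>2 * (1 + r powr p) powr (2 * \<beta>\<^sub>0) = (lp_norm \<beta>\<^sub>0 h b)\<^sup>2"
  proof -
    have "h powr p + b powr p = b powr p * (1 + r powr p)"
      using r b by (simp add: powr_mult algebra_simps)
    then have "(lp_norm \<beta>\<^sub>0 h b)\<^sup>2 = (b powr p) powr (2 * \<beta>\<^sub>0) * (1 + r powr p) powr (2 * \<beta>\<^sub>0)"
      unfolding lp_norm_square p_def[symmetric] by (simp only: powr_mult)
    also have "(b powr p) powr (2 * \<beta>\<^sub>0) = b\<^sup>2" using square_powr[of b \<beta>\<^sub>0] b unfolding p_def by simp
    finally show ?thesis by simp
  qed
  moreover have "b\<^sup>2 * (1 + 2 * \<beta>\<^sub>0 * (r\<^sup>2 * (1 + e * (3 - K))))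
      = 100114/100000 * (1 + 2277/1000000 * (3 - K)) * h\<^sup>2 + b\<^sup>2"
    by (simp add: r(3) e_def power_mult_distrib field_simps)
  ultimately show ?thesis by simp
qed

text \<open>
  For t \<le> 1/10 and for 1/10 \<le> t \<le> 2/10 the lower bounds 1/2 and 46/100 of J(1/2 + t) give
  73891/10000 * h / J(1/2 + t) \<le> K t for h \<le> t with K = 14.7784 and K = 16.0633.
\<close>

lemma hamming_norm_lp: "hamming_norm \<beta>\<^sub>0 (lp_norm \<beta>\<^sub>0)"
proof
  fix h h' b t :: real
  show "1/2 \<le> \<beta>\<^sub>0" "\<beta>\<^sub>0 \<le> 50057/100000" by simp_all
  show "0 \<le> lp_norm \<beta>\<^sub>0 h b" by (simp add: lp_norm_def)
  show ge_2: "h\<^sup>2 + b\<^sup>2 \<le> (lp_norm \<beta>\<^sub>0 h b)\<^sup>2" if "0 \<le> h" "0 \<le> b" for h b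
    by (rule lp_norm_ge_2) (use that in auto)
  show "(lp_norm \<beta>\<^sub>0 h b)\<^sup>2 - h\<^sup>2 \<le> (lp_norm \<beta>\<^sub>0 h' b)\<^sup>2 - h'\<^sup>2" if "0 < h" "h \<le> h'" "0 \<le> b"
    by (rule lp_norm_incr) (use that in auto)
  show "(h powr (1 / \<beta>\<^sub>0) + b powr (1 / \<beta>\<^sub>0)) powr \<beta>\<^sub>0 \<le> lp_norm \<beta>\<^sub>0 h b" by (simp add: lp_norm_def)
  show "2 powr \<beta>\<^sub>0 / 2 * (h + b) \<le> lp_norm \<beta>\<^sub>0 h b" if "0 \<le> h" "0 \<le> b"
    by (rule lp_norm_ge_sum) (use that in auto)
  let ?j = "J (1/2 + t)"
  show "\<exists>lam\<ge>1. (2 * J (1/2 + t / 2) - 1/2)\<^sup>2 \<le> lam * t\<^sup>2 + ?j\<^sup>2 \<and>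
      (\<forall>h\<in>{0..t}. lam * h\<^sup>2 + ?j\<^sup>2 \<le> (lp_norm \<beta>\<^sub>0 h ?j)\<^sup>2)"
    if t: "0 \<le> t" "t \<le> 1/2"
  proof -
    have gain: ?thesis
      if half: "\<And>lam. 100114/100000 * (1 + 2277/1000000 * (3 - K * t)) \<le> lam \<Longrightarrow>
          (2 * J (1/2 + t / 2) - 1/2)\<^sup>2 \<le> lam * t\<^sup>2 + ?j\<^sup>2"
        and j: "j \<le> ?j" "t \<le> j" "0 < j" "73891/10000 \<le> K * j" and K: "K * t \<le> 34/10" for K j
    proof (intro exI[of _ "100114/100000 * (1 + 2277/1000000 * (3 - K * t))"] conjI ballI)
      show "(2 * J (1/2 + t / 2) - 1/2)\<^sup>2
          \<le> 100114/100000 * (1 + 2277/1000000 * (3 - K * t)) * t\<^sup>2 + ?j\<^sup>2"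
        by (rule half) simp
      fix h assume h: "h \<in> {0..t}"
      have "0 < K * j" using j(4) by linarith
      then have K0: "0 \<le> K" using zero_less_mult_pos2[of K j] j(3) by simp
      show "100114/100000 * (1 + 2277/1000000 * (3 - K * t)) * h\<^sup>2 + ?j\<^sup>2 \<le> (lp_norm \<beta>\<^sub>0 h ?j)\<^sup>2"
      proof (rule lp_norm_gain)
        have "73891/10000 * h \<le> K * j * t" using j(4) h by (intro mult_mono) auto
        also have "\<dots> \<le> K * ?j * t" using j(1) K0 t by (intro mult_right_mono mult_left_mono)
        finally show "73891/10000 * h \<le> K * t * ?j" by (simp add: mult_ac)
      qed (use h j in auto)
    qed (use K in \<open>simp add: field_simps\<close>)
    have Jq: "Jq t \<le> ?j" if "t \<le> 2/10" using J_pieces(1)[of "1/2 + t"] that t by simp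
    consider "t \<le> 1/10" | "1/10 \<le> t" "t \<le> 2/10" | "2/10 \<le> t" by linarith
    then show ?thesis
    proof cases
      case 1
      show ?thesis
      proof (rule gain[where K = "147784/10000" and j = "1/2", OF J_two_point_at_half(2)[OF t(1) 1]])
        have "0 \<le> t * (2069/10000 - 202/100 * t)" using t 1 by (intro mult_nonneg_nonneg) auto
        then have "1/2 \<le> Jq t" by (simp add: Jq_def power2_eq_square algebra_simps)
        with Jq 1 show "1/2 \<le> ?j" by simp
      qed (use t 1 in auto)
    next
      case 2
      show ?thesis
      proof (rule gain[where K = "160633/10000" and j = "46/100", OF J_two_point_at_half(3)[OF 2]])
        have "0 \<le> (t - 1/10) * (2/10 - t)" using 2 by (intro mult_nonneg_nonneg) auto
        then have "46/100 \<le> Jq t" using 2 by (simp add: Jq_def power2_eq_square algebra_simps)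
        with Jq 2 show "46/100 \<le> ?j" by simp
      qed (use 2 in auto)
    next
      case 3
      have "0 \<le> ?j" using J_nonneg[of "1/2 + t"] t by simp
      then show ?thesis using J_two_point_at_half(4)[OF 3 t(2), of 1] ge_2[of _ ?j] by (intro exI[of _ 1]) auto
    qed
  qed
qed

theorem theorem2p2:
  fixes x y :: real
  assumes "0 \<le> x" and "x \<le> y" and "y \<le> 1"
  shows "G_beta 0.50057 (b_beta 0.50057) x y \<ge> 0 \<and> G_beta (1/2) (\<lambda>t. 0.997 * b_beta (1/2) t) x y \<ge> 0"
proof
  interpret A: hamming_norm "\<beta>\<^sub>0" "lp_norm \<beta>\<^sub>0" by (rule hamming_norm_lp)
  have "0 \<le> G_beta \<beta>\<^sub>0 (b_beta \<beta>\<^sub>0) x y"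
    using A.good_everywhere[OF assms] unfolding A.good_def G_beta_def G1_beta_def lp_norm_def by linarith
  then show "0 \<le> G_beta 0.50057 (b_beta 0.50057) x y" by simp
next
  interpret B: hamming_norm "1/2" "\<lambda>h b. sqrt ((h / (997/1000))\<^sup>2 + b\<^sup>2)" by (rule hamming_norm_euclidean)
  let ?c = "997/1000 :: real" and ?b = "b_beta (1/2)"
  let ?B = "\<lambda>t. ?c * ?b t"
  have rescale: "?c\<^sup>2 * (h / ?c)\<^sup>2 = h\<^sup>2" for h by (simp add: power_divide)
  have b: "0 \<le> ?b y" using B.b_nonneg assms by simp
  have "0 \<le> G_beta (1/2) ?B x y"
    using B.good_everywhere[OF assms] unfolding B.good_def
  proof
    assume "0 \<le> sqrt (((y - x) / ?c)\<^sup>2 + (?b y)\<^sup>2) + ?b x - 2 * ?b ((x + y) / 2)"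
    then have "0 \<le> ?c * (sqrt (((y - x) / ?c)\<^sup>2 + (?b y)\<^sup>2) + ?b x - 2 * ?b ((x + y) / 2))" by simp
    also have "\<dots> = ?c * sqrt (((y - x) / ?c)\<^sup>2 + (?b y)\<^sup>2) + ?B x - 2 * ?B ((x + y) / 2)"
      by (simp add: algebra_simps)
    also have "?c * sqrt (((y - x) / ?c)\<^sup>2 + (?b y)\<^sup>2) = sqrt (?c\<^sup>2 * (((y - x) / ?c)\<^sup>2 + (?b y)\<^sup>2))"
      by (simp add: real_sqrt_mult)
    also have "?c\<^sup>2 * (((y - x) / ?c)\<^sup>2 + (?b y)\<^sup>2) = (y - x)\<^sup>2 + (?B y)\<^sup>2"
      using rescale[of "y - x"] by (simp only: power_mult_distrib distrib_left)
    also have "sqrt \<dots> + ?B x - 2 * ?B ((x + y) / 2) = G1_beta (1/2) ?B x y"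
      using assms b by (simp add: G1_beta_def powr_half_sqrt)
    finally show ?thesis by (simp add: G_beta_def)
  next
    assume "0 \<le> G2_beta (1/2) ?b x y"
    then have "0 \<le> ?c * G2_beta (1/2) ?b x y" by simp
    moreover have "G2_beta (1/2) ?B x y = ?c * G2_beta (1/2) ?b x y + 3/1000 * (y - x)"
      by (simp add: G2_beta_def field_simps)
    ultimately have "0 \<le> G2_beta (1/2) ?B x y" using assms by simp
    then show ?thesis by (simp add: G_beta_def)
  qed
  then show "0 \<le> G_beta (1/2) (\<lambda>t. 0.997 * b_beta (1/2) t) x y" by simp
qed

end
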